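(* Let $r\ge 1$ be an integer and $j\in\{1,\dots,d\}$. Let $f(\bm x)=g(\bm x)\,\mathbb{I}\{\phi(\bm x)\ge0\}$ with $g,\phi\in\mathcal{C}^r(\mathbb{R}^d)$. Suppose that, with fixed constants $B_1,\dots,B_d\in(0,1)$ and $B>0$, conditions (A1), (A2), (A3) stated in the context hold for this $r$ and $j$. (i) If $B_j<1/(2r+1)$, then $P_jf\in\mathcal{C}^r(\mathbb{R}^{d-1})$. (ii) Suppose that $r\ge d-1$ and $B_j<1/(2d-1)$. If $$\gamma_j:=(2d-1)\max_{i\in\{1,\dots,d\}\setminus\{j\}}B_i+B<1,$$ then $$\mathbb{E}\big[|\hat I(P_jf)-I(f)|\big]=O(n^{-1+\gamma_j+\epsilon})$$ for arbitrarily small $\epsilon>0$. (iii) Suppose that $r\ge d-1$. If $B_1,\dots,B_d$ and $B$ are arbitrarily small (that is, (A2) and (A3) hold for arbitrarily small choices of these positive constants, with $L,L'$ allowed to depend on the choice), then $$\mathbb{E}\big[|\hat I(P_jf)-I(f)|\big]=O(n^{-1+\epsilon})$$ for arbitrarily small $\epsilon>0$.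
   Context: Setting. The components of $\bm x=(x_1,\dots,x_d)\in\mathbb{R}^d$ are IID with probability density function $\rho$ and cumulative distribution function $\Phi$; $I(f)=\mathbb{E}[f(\bm x)]$. $\bm x_{-j}$ denotes the components of $\bm x$ other than $x_j$, and $(P_jf)(\bm x_{-j})=\int_{-\infty}^\infty f(x_j,\bm x_{-j})\rho(x_j)\,\mathrm{d}x_j$. $D_j=\partial/\partial x_j$; for a multi-index $\bm\alpha$ of nonnegative integers, $D^{\bm\alpha}$ is the corresponding partial derivative and $|\bm\alpha|=\sum_i\alpha_i$. $\rho^{(c)}$ is the $c$-th derivative of $\rho$. Conditions (with $r$, $j$, $B_i$, $B$ given). (A1) $(D_j\phi)(\bm x)\ne0$ for all $\bm x\in\mathbb{R}^d$. (A2) There is a constant $L>0$ such that for all $\bm x\in\mathbb{R}^d$ each of $|(D^{\bm\alpha}g)(\bm x)|$, $|(D^{\bm\alpha}\phi)(\bm x)|$ and $|(D_j\phi)(\bm x)|^{-b}$ is at most $L\prod_{i=1}^d\min(\Phi(x_i),1-\Phi(x_i))^{-B_i}$, for every $b$ with $1\le b\le 2r-1$ and every multi-index $\bm\alpha$ with $|\bm\alpha|\le r$. (A3) $\rho\in\mathcal{C}^{r-1}(\mathbb{R})$ is strictly positive; there is a constant $L'>0$ such that $\frac{\mathrm{d}\Phi^{-1}(u)}{\mathrm{d}u}\le L'\min(u,1-u)^{-1-B}$ for $u\in(0,1)$; and for any nonnegative integer $c\le r-1$ and any $a\in(0,1)$, $\lim_{x\to\infty}\rho^{(c)}(x)/(1-\Phi(x))^a=0$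 and $\lim_{x\to-\infty}\rho^{(c)}(x)/\Phi(x)^a=0$. Quadrature. For a function $h$ of $s$ real variables, $\hat I(h)=\frac1n\sum_{i=1}^nh(\Phi^{-1}(\bm u_i))$, with $\Phi^{-1}$ applied componentwise, where $\bm u_1,\dots,\bm u_n\in(0,1)^s$ are the first $n$ points of a scrambled $(t,s)$-sequence in a fixed base $\mathsf{b}\ge2$ (here $s=d-1$). $O(\cdot)$ is as $n\to\infty$ and $\mathbb{E}$ is over the scrambling. Convention: if $s=0$ then $h$ is a constant and $\hat I(h)=h$; the maximum over an empty index set is $0$. A $(t,m,s)$-net in base $\mathsf b$ is a set of $\mathsf b^m$ points of $[0,1)^s$ such that every box $\prod_{k=1}^s[a_k\mathsf b^{-\ell_k},(a_k+1)\mathsf b^{-\ell_k})$ (integers $\ell_k\ge0$, $0\le a_k<\mathsf b^{\ell_k}$) of volume $\mathsf b^{t-m}$ contains exactly $\mathsf b^t$ of them; a $(t,s)$-sequence is an infinite sequence $(\bm p_i)_{i\ge1}$ such that for all integers $k\ge0$, $m\ge t$ the points $\bm p_{k\mathsf b^m+1},\dots,\bm p_{(k+1)\mathsf b^m}$ form a $(t,m,s)$-net. Scrambling (Owen): independently for each coordinate, a value with base-$\mathsf b$ digits $0.a_1a_2a_3\dots$ is replaced by $0.\pi(a_1)\,\pi_{a_1}(a_2)\,\pi_{a_1a_2}(a_3)\dots$, where the permutations $\pi,\pi_{a_1},\pi_{a_1a_2},\dots$ of $\{0,\dots,\mathsf b-1\}$, indexed by the preceding digits, are mutually independent and uniformly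 distributed, and are the same for all points of the sequence. *)

theory Defs
  imports "HOL-Probability.Probability" "HOL-Library.Landau_Symbols"
    "HOL-Combinatorics.Permutations"
begin

subsection \<open>Real vectors with an arbitrary finite index set\<close>

text \<open>The vectors whose components are indexed by a finite set \<open>S\<close> are the extensional
  functions on \<open>S\<close>. Thus \<open>R\<^sup>d\<close> is \<open>rspace {1..d}\<close>, the space of the vectors
  \<open>x\<^sub>-\<^sub>j\<close> is \<open>rspace ({1..d} - {j})\<close>, and putting \<open>x\<^sub>j\<close> back is the function
  update \<open>x(j := t)\<close>. The zero-dimensional space is \<open>rspace {}\<close>, a single point.
  The topology of the function type restricts to the Euclidean topology on \<open>rspace S\<close>.\<close>

definition rspace :: "nat set \<Rightarrow> (nat \<Rightarrow> real) set" where
  "rspace S = S \<rightarrow>\<^sub>E UNIV"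

definition partial_deriv ::
    "nat \<Rightarrow> ((nat \<Rightarrow> real) \<Rightarrow> real) \<Rightarrow> (nat \<Rightarrow> real) \<Rightarrow> real" where
  "partial_deriv i h x = deriv (\<lambda>t. h (x(i := t))) (x i)"

definition has_partial_on ::
    "nat set \<Rightarrow> nat \<Rightarrow> ((nat \<Rightarrow> real) \<Rightarrow> real) \<Rightarrow> bool" where
  "has_partial_on S i h \<longleftrightarrow>
     (\<forall>x\<in>rspace S. (\<lambda>t. h (x(i := t))) field_differentiable (at (x i)))"

text \<open>All iterated partial derivatives of order at most \<open>r\<close>, in every order of
  differentiation, exist and are continuous.\<close>

fun Cr_on :: "nat set \<Rightarrow> nat \<Rightarrow> ((nat \<Rightarrow> real) \<Rightarrow> real) \<Rightarrow> bool" where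
  "Cr_on S 0 h \<longleftrightarrow> continuous_on (rspace S) h"
| "Cr_on S (Suc r) h \<longleftrightarrow> continuous_on (rspace S) h \<and>
     (\<forall>i\<in>S. has_partial_on S i h \<and> Cr_on S r (partial_deriv i h))"

text \<open>\<open>D\<^sub>1^(\<alpha> 1) (\<dots> (D\<^sub>d^(\<alpha> d) h))\<close>; the fixed order of differentiation is
  immaterial for the functions of class \<open>C^r\<close> to which this is applied.\<close>

definition multi_deriv ::
    "nat \<Rightarrow> (nat \<Rightarrow> nat) \<Rightarrow> ((nat \<Rightarrow> real) \<Rightarrow> real) \<Rightarrow> (nat \<Rightarrow> real) \<Rightarrow> real" where
  "multi_deriv d \<alpha> h = foldr (\<lambda>i. partial_deriv i ^^ \<alpha> i) [1..<Suc d] h"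

definition Cr_real :: "nat \<Rightarrow> (real \<Rightarrow> real) \<Rightarrow> bool" where
  "Cr_real r h \<longleftrightarrow>
     (\<forall>c<r. \<forall>x. ((deriv ^^ c) h) field_differentiable (at x)) \<and>
     (\<forall>c\<le>r. continuous_on UNIV ((deriv ^^ c) h))"


subsection \<open>IID components with a given density\<close>

definition prob_density :: "(real \<Rightarrow> real) \<Rightarrow> bool" where
  "prob_density \<rho> \<longleftrightarrow> \<rho> \<in> borel_measurable borel \<and> (\<forall>x. 0 \<le> \<rho> x) \<and>
     (\<integral>\<^sup>+x. ennreal (\<rho> x) \<partial>lborel) = 1"

definition law :: "(real \<Rightarrow> real) \<Rightarrow> real measure" where
  "law \<rho> = density lborel (\<lambda>x. ennreal (\<rho> x))"

definition joint_law :: "(real \<Rightarrow> real) \<Rightarrow> nat set \<Rightarrow> (nat \<Rightarrow> real) measure" where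
  "joint_law \<rho> S = Pi\<^sub>M S (\<lambda>_. law \<rho>)"

text \<open>The value of \<open>\<Phi>\<inverse>\<close> matters on the range of \<open>\<Phi>\<close> only, which is the
  interval from 0 to 1 without end points when \<open>\<rho>\<close> is strictly positive.\<close>

abbreviation Phi :: "(real \<Rightarrow> real) \<Rightarrow> real \<Rightarrow> real" where
  "Phi \<rho> \<equiv> cdf (law \<rho>)"

abbreviation Phi_inv :: "(real \<Rightarrow> real) \<Rightarrow> real \<Rightarrow> real" where
  "Phi_inv \<rho> \<equiv> inv (Phi \<rho>)"

definition Iexact :: "(real \<Rightarrow> real) \<Rightarrow> nat \<Rightarrow> ((nat \<Rightarrow> real) \<Rightarrow> real) \<Rightarrow> real" where
  "Iexact \<rho> d f = (\<integral>x. f x \<partial>joint_law \<rho> {1..d})"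

definition Pj ::
    "(real \<Rightarrow> real) \<Rightarrow> nat \<Rightarrow> ((nat \<Rightarrow> real) \<Rightarrow> real) \<Rightarrow> (nat \<Rightarrow> real) \<Rightarrow> real" where
  "Pj \<rho> j f x = (\<integral>t. f (x(j := t)) * \<rho> t \<partial>lborel)"


subsection \<open>The conditions\<close>

definition condA1 :: "nat \<Rightarrow> nat \<Rightarrow> ((nat \<Rightarrow> real) \<Rightarrow> real) \<Rightarrow> bool" where
  "condA1 d j \<phi> \<longleftrightarrow> (\<forall>x\<in>rspace {1..d}. partial_deriv j \<phi> x \<noteq> 0)"

definition growth_bound ::
    "(real \<Rightarrow> real) \<Rightarrow> nat \<Rightarrow> (nat \<Rightarrow> real) \<Rightarrow> (nat \<Rightarrow> real) \<Rightarrow> real" where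
  "growth_bound \<rho> d Bs x =
     (\<Prod>i=1..d. min (Phi \<rho> (x i)) (1 - Phi \<rho> (x i)) powr (- Bs i))"

definition condA2 ::
    "(real \<Rightarrow> real) \<Rightarrow> nat \<Rightarrow> nat \<Rightarrow> nat \<Rightarrow> (nat \<Rightarrow> real) \<Rightarrow>
     ((nat \<Rightarrow> real) \<Rightarrow> real) \<Rightarrow> ((nat \<Rightarrow> real) \<Rightarrow> real) \<Rightarrow> bool" where
  "condA2 \<rho> d r j Bs g \<phi> \<longleftrightarrow> (\<exists>L>0. \<forall>x\<in>rspace {1..d}.
     (\<forall>\<alpha>. (\<Sum>i=1..d. \<alpha> i) \<le> r \<longrightarrow>
        \<bar>multi_deriv d \<alpha> g x\<bar> \<le> L * growth_bound \<rho> d Bs x \<and>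
        \<bar>multi_deriv d \<alpha> \<phi> x\<bar> \<le> L * growth_bound \<rho> d Bs x) \<and>
     (\<forall>b::nat. 1 \<le> b \<and> b \<le> 2 * r - 1 \<longrightarrow>
        \<bar>partial_deriv j \<phi> x\<bar> powi (- int b) \<le> L * growth_bound \<rho> d Bs x))"

definition condA3 :: "(real \<Rightarrow> real) \<Rightarrow> nat \<Rightarrow> real \<Rightarrow> bool" where
  "condA3 \<rho> r B \<longleftrightarrow>
     Cr_real (r - 1) \<rho> \<and> (\<forall>x. 0 < \<rho> x) \<and>
     (\<exists>L'>0. \<forall>u\<in>{0<..<1}. deriv (Phi_inv \<rho>) u \<le> L' * min u (1 - u) powr (- 1 - B)) \<and>
     (\<forall>c\<le>r - 1. \<forall>a\<in>{0<..<1}.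
        ((\<lambda>x. (deriv ^^ c) \<rho> x / (1 - Phi \<rho> x) powr a) \<longlongrightarrow> 0) at_top \<and>
        ((\<lambda>x. (deriv ^^ c) \<rho> x / (Phi \<rho> x) powr a) \<longlongrightarrow> 0) at_bot)"


subsection \<open>Nets, sequences and scrambling\<close>

text \<open>The points are given as a family \<open>p\<close>, with \<open>p i k\<close> the coordinate \<open>k \<in> S\<close> of the
  point \<open>p i\<close>. The points of a net are counted with multiplicity, that is, by their
  indices, since for positive \<open>t\<close> points of a net may coincide.\<close>

definition elementary_box ::
    "nat \<Rightarrow> nat set \<Rightarrow> (nat \<Rightarrow> nat) \<Rightarrow> (nat \<Rightarrow> nat) \<Rightarrow> (nat \<Rightarrow> real) set" where
  "elementary_box b S l a =
     {x. \<forall>k\<in>S. real (a k) / real b ^ l k \<le> x k \<and> x k < (real (a k) + 1) / real b ^ l k}"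

definition tms_net ::
    "nat \<Rightarrow> nat \<Rightarrow> nat \<Rightarrow> nat set \<Rightarrow> nat set \<Rightarrow> (nat \<Rightarrow> nat \<Rightarrow> real) \<Rightarrow> bool" where
  "tms_net b t m S J p \<longleftrightarrow> finite J \<and> card J = b ^ m \<and>
     (\<forall>i\<in>J. \<forall>k\<in>S. p i k \<in> {0..<1}) \<and>
     (\<forall>l a. (\<forall>k\<in>S. a k < b ^ l k) \<and>
        (\<Prod>k\<in>S. 1 / real b ^ l k) = real b powi (int t - int m) \<longrightarrow>
        card {i\<in>J. p i \<in> elementary_box b S l a} = b ^ t)"

definition ts_sequence ::
    "nat \<Rightarrow> nat \<Rightarrow> nat set \<Rightarrow> (nat \<Rightarrow> nat \<Rightarrow> real) \<Rightarrow> bool" where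
  "ts_sequence b t S p \<longleftrightarrow>
     (\<forall>k m. t \<le> m \<longrightarrow> tms_net b t m S {k * b ^ m + 1..(k + 1) * b ^ m} p)"

text \<open>The \<open>k\<close>-th digit after the point, for \<open>k \<ge> 1\<close>.\<close>

definition digit :: "nat \<Rightarrow> real \<Rightarrow> nat \<Rightarrow> nat" where
  "digit b x k = nat (\<lfloor>x * real b ^ k\<rfloor> mod int b)"

text \<open>The permutation \<open>\<tau> w\<close> is applied to the digit preceded by the digits \<open>w\<close>.\<close>

definition scramble :: "nat \<Rightarrow> (nat list \<Rightarrow> nat \<Rightarrow> nat) \<Rightarrow> real \<Rightarrow> real" where
  "scramble b \<tau> x =
     (\<Sum>k. real (\<tau> (map (digit b x) [1..<Suc k]) (digit b x (Suc k))) / real b ^ Suc k)"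

abbreviation digit_perms :: "nat \<Rightarrow> (nat \<Rightarrow> nat) set" where
  "digit_perms b \<equiv> {\<sigma>. \<sigma> permutes {..<b}}"

definition owen_permutations ::
    "'w measure \<Rightarrow> nat \<Rightarrow> nat set \<Rightarrow> (nat \<Rightarrow> nat list \<Rightarrow> 'w \<Rightarrow> nat \<Rightarrow> nat) \<Rightarrow> bool" where
  "owen_permutations M b S \<pi> \<longleftrightarrow> prob_space M \<and>
     prob_space.indep_vars M (\<lambda>_. count_space (digit_perms b)) (\<lambda>(k, w). \<pi> k w)
       (S \<times> lists {..<b}) \<and>
     (\<forall>k\<in>S. \<forall>w\<in>lists {..<b}.
        distr M (count_space (digit_perms b)) (\<pi> k w) = uniform_count_measure (digit_perms b))"

definition scrambled_point ::
    "nat \<Rightarrow> nat set \<Rightarrow> (nat \<Rightarrow> nat list \<Rightarrow> 'w \<Rightarrow> nat \<Rightarrow> nat) \<Rightarrow> (nat \<Rightarrow> nat \<Rightarrow> real) \<Rightarrow>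
     nat \<Rightarrow> 'w \<Rightarrow> nat \<Rightarrow> real" where
  "scrambled_point b S \<pi> p i \<omega> = (\<lambda>k\<in>S. scramble b (\<lambda>w. \<pi> k w \<omega>) (p i k))"

text \<open>For \<open>S = {}\<close> and \<open>n \<ge> 1\<close> this is the value of \<open>h\<close> at the only point of
  \<open>rspace {}\<close>, as it should be.\<close>

definition Ihat ::
    "(real \<Rightarrow> real) \<Rightarrow> nat set \<Rightarrow> (nat \<Rightarrow> nat \<Rightarrow> real) \<Rightarrow> nat \<Rightarrow>
     ((nat \<Rightarrow> real) \<Rightarrow> real) \<Rightarrow> real" where
  "Ihat \<rho> S u n h = 1 / real n * (\<Sum>i=1..n. h (\<lambda>k\<in>S. Phi_inv \<rho> (u i k)))"

definition quad_error ::
    "(real \<Rightarrow> real) \<Rightarrow> nat \<Rightarrow> nat \<Rightarrow> nat \<Rightarrow> (nat \<Rightarrow> nat list \<Rightarrow> 'w \<Rightarrow> nat \<Rightarrow> nat) \<Rightarrow>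
     (nat \<Rightarrow> nat \<Rightarrow> real) \<Rightarrow> ((nat \<Rightarrow> real) \<Rightarrow> real) \<Rightarrow> nat \<Rightarrow> 'w \<Rightarrow> real" where
  "quad_error \<rho> d j b \<pi> p f n \<omega> =
     \<bar>Ihat \<rho> ({1..d} - {j}) (\<lambda>i. scrambled_point b ({1..d} - {j}) \<pi> p i \<omega>) n (Pj \<rho> j f)
       - Iexact \<rho> d f\<bar>"

definition gamma_rate :: "nat \<Rightarrow> nat \<Rightarrow> (nat \<Rightarrow> real) \<Rightarrow> real \<Rightarrow> real" where
  "gamma_rate d j Bs B =
     (2 * real d - 1) * (if {1..d} - {j} = {} then 0 else Max (Bs ` ({1..d} - {j}))) + B"

end

theory Submission
  imports Defs
begin

text \<open>Smoothness. By (A1) the function \<open>\<phi>\<close> is strictly monotone in \<open>x\<^sub>j\<close>, so on an open set \<open>U\<close> it has a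
  unique zero \<open>x\<^sub>j = \<psi>(x\<^sub>-\<^sub>j)\<close>, and off \<open>U\<close> it has no zero. A partial derivative of order \<open>m\<close> of the
  preintegrated function is the preintegral of the derivative of \<open>g\<close> plus a boundary term
  \<open>A / (D\<^sub>j \<phi>)^(2m-1)\<close> evaluated at \<open>x\<^sub>j = \<psi>\<close>, where \<open>A\<close> is a sum of products of one derivative of \<open>g\<close>,
  one derivative of \<open>\<rho>\<close> and at most \<open>2m-1\<close> derivatives of \<open>\<phi>\<close>. By (A2) such a term grows like the
  power \<open>2m+1\<close> of the growth function, and since \<open>(2m+1) B\<^sub>j < 1\<close> the decay of \<open>\<rho>\<close> makes it vanish as
  \<open>\<psi>\<close> escapes to infinity at the boundary of \<open>U\<close>; this gives the continuity there and, by a mean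
  value argument, the differentiability.

  Quadrature. Anchoring at the median \<open>c\<close>, the preintegrated function \<open>H\<close> satisfies
  \<open>H(x) = \<Sum>\<^sub>v \<integral> D\<^sup>v H(y, c) \<Prod>\<^sub>k (1{c < y\<^sub>k} - 1{x\<^sub>k < y\<^sub>k}) dy\<close>, the product being over \<open>k \<in> v\<close>. So the error
  is an integral of errors for corner boxes. Their expected error is at most a constant times
  \<open>\<mu> = \<Prod>\<^sub>k min(\<Phi>(y\<^sub>k), 1 - \<Phi>(y\<^sub>k))\<close>, because each scrambled point is uniformly distributed, and at most the
  discrepancy \<open>n^(-1+\<epsilon>)\<close>, because a scrambled sequence is almost surely again a \<open>(t,s)\<close>-sequence.
  Interpolating, it is at most a constant times \<open>\<mu>^\<theta> n^(-(1-\<epsilon>)(1-\<theta>))\<close>, and for \<open>\<theta> > \<gamma>\<close> the weight \<open>\<mu>^\<theta>\<close> makes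
  the integral converge by the bound on the derivative of \<open>\<Phi>\<inverse>\<close> in (A3).\<close>

subsection \<open>Calculus on the line\<close>

text \<open>Smoothness is continuity of all iterated partial derivatives, so the calculus runs along
  coordinate lines with one-dimensional mean value arguments. The constant 2r+1 counts growth
  factors: a boundary term of order m has at most 2m derivatives of g and \<phi> above the fraction
  bar, and one more factor for the reciprocal power of D_j \<phi>, which (A2) bounds as a whole; its
  exponent 2m-1 explains the range of b in (A2). Quadrature involves mixed derivatives of order at
  most d-1, whence 2d-1. These derivatives are only known to be bounded by unbounded growth
  functions, so a finite variation in the manner of Koksma and Hlawka is not at hand. For a single
  corner box, discrepancy gives nearly the full rate but no decay in y, whereas uniform distribution
  of each point gives decay but no rate. Their geometric mean gives enough of both: the weight costs
  the fraction \<theta> of the rate, so \<theta> is taken just above \<gamma>. The expectation is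
  taken inside the y-integral so that the two bounds can be combined for each y separately.\<close>

lemma partial_increment:
  fixes F F' :: "real \<Rightarrow> real \<Rightarrow> real"
  assumes der: "\<And>t s. ((\<lambda>t. F t s) has_real_derivative F' t s) (at t)"
    and cont: "isCont (\<lambda>z. F' (fst z) (snd z)) (t0, p t0)" and p: "isCont p t0"
  obtains Q where "\<And>t. F t (p t) - F t0 (p t) = (t - t0) * Q t" "isCont Q t0" "Q t0 = F' t0 (p t0)"
proof -
  \<comment> \<open>Mean value theorem in the first argument, with the second frozen at
    \<open>p t\<close>. The intermediate point is no further from \<open>t0\<close> than
    \<open>t\<close> is, so joint continuity of \<open>F'\<close> at a single point makes
    \<open>Q\<close> continuous at \<open>t0\<close>.\<close>
  have "\<exists>z. F t (p t) - F t0 (p t) = (t - t0) * F' z (p t) \<and> \<bar>z - t0\<bar> \<le> \<bar>t - t0\<bar>" for t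
  proof (cases t t0 rule: linorder_cases)
    case less
    from MVT2[OF this, of "\<lambda>z. F z (p t)" "\<lambda>z. F' z (p t)"] der obtain z where
      "t < z" "z < t0" "F t0 (p t) - F t (p t) = (t0 - t) * F' z (p t)" by auto
    then show ?thesis by (intro exI[of _ z]) (auto simp: algebra_simps)
  next
    case greater
    from MVT2[OF this, of "\<lambda>z. F z (p t)" "\<lambda>z. F' z (p t)"] der obtain z where
      "t0 < z" "z < t" "F t (p t) - F t0 (p t) = (t - t0) * F' z (p t)" by auto
    then show ?thesis by (intro exI[of _ z]) auto
  qed auto
  then obtain \<xi> where \<xi>: "\<And>t. F t (p t) - F t0 (p t) = (t - t0) * F' (\<xi> t) (p t)"
    "\<And>t. \<bar>\<xi> t - t0\<bar> \<le> \<bar>t - t0\<bar>" by metis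
  have [simp]: "\<xi> t0 = t0" using \<xi>(2)[of t0] by simp
  have "((\<lambda>t. \<xi> t - t0) \<longlongrightarrow> 0) (at t0)"
  proof (rule Lim_null_comparison)
    show "\<forall>\<^sub>F t in at t0. norm (\<xi> t - t0) \<le> \<bar>t - t0\<bar>" using \<xi>(2) by simp
    show "((\<lambda>t. \<bar>t - t0\<bar>) \<longlongrightarrow> 0) (at t0)" by (auto intro!: tendsto_eq_intros)
  qed
  then have "isCont \<xi> t0"
    by (simp add: isCont_def LIM_zero_iff)
  then have "isCont (\<lambda>t. (\<xi> t, p t)) t0" using p by (intro continuous_intros)
  then have "isCont (\<lambda>t. F' (fst (\<xi> t, p t)) (snd (\<xi> t, p t))) t0"
    by (rule isCont_o2) (use cont in simp)
  then show ?thesis by (intro that[of "\<lambda>t. F' (\<xi> t) (p t)"]) (use \<xi> in auto)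
qed

text \<open>The increment is split into one with the second argument held at \<open>p t\<close> and
  one along the line through \<open>t0\<close>; the latter is an ordinary chain rule, so a
  derivative in the second argument enters only at \<open>p t0\<close>.\<close>

lemma has_derivative_along_curve:
  fixes F F' :: "real \<Rightarrow> real \<Rightarrow> real"
  assumes der: "\<And>t s. ((\<lambda>t. F t s) has_real_derivative F' t s) (at t)"
    and cont: "isCont (\<lambda>z. F' (fst z) (snd z)) (t0, p t0)"
    and der2: "((\<lambda>s. F t0 s) has_real_derivative c) (at (p t0))"
    and p: "(p has_real_derivative p') (at t0)"
  shows "((\<lambda>t. F t (p t)) has_real_derivative F' t0 (p t0) + c * p') (at t0)"
proof -
  have "isCont p t0" using p by (rule DERIV_isCont)
  from partial_increment[of F F' t0 p, OF der cont this] obtain Q where Q: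
    "\<And>t. F t (p t) - F t0 (p t) = (t - t0) * Q t" "isCont Q t0" "Q t0 = F' t0 (p t0)" by blast
  have "((\<lambda>t. F t (p t) - F t0 (p t)) has_real_derivative F' t0 (p t0)) (at t0)"
    unfolding CARAT_DERIV using Q by (intro exI[of _ Q]) (auto simp: mult.commute)
  moreover have "((\<lambda>t. F t0 (p t)) has_real_derivative c * p') (at t0)"
    by (rule DERIV_chain2[OF der2 p])
  ultimately show ?thesis by (auto dest: DERIV_add)
qed

text \<open>The identity \<open>0 = (t - t0) * Q t + q (p t) * (p t - p t0)\<close>, with
  Caratheodory factors \<open>Q\<close> and \<open>q\<close> for the two arguments, is solved for
  the difference quotient. Existence and continuity of \<open>p\<close> are inputs: for the zero of
  \<phi> they come from monotonicity.\<close>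

lemma implicit_derivative:
  fixes F F' :: "real \<Rightarrow> real \<Rightarrow> real"
  assumes der: "\<And>t s. ((\<lambda>t. F t s) has_real_derivative F' t s) (at t)"
    and cont: "isCont (\<lambda>z. F' (fst z) (snd z)) (t0, p t0)"
    and der2: "((\<lambda>s. F t0 s) has_real_derivative c) (at (p t0))" and c: "c \<noteq> 0"
    and p: "isCont p t0" and zero: "\<forall>\<^sub>F t in nhds t0. F t (p t) = 0"
  shows "(p has_real_derivative - F' t0 (p t0) / c) (at t0)"
proof -
  from partial_increment[of F F' t0 p, OF der cont p] obtain Q where Q:
    "\<And>t. F t (p t) - F t0 (p t) = (t - t0) * Q t" "isCont Q t0" "Q t0 = F' t0 (p t0)" by blast
  from der2 obtain q where q: "\<And>s. F t0 s - F t0 (p t0) = q s * (s - p t0)"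
    "isCont q (p t0)" "q (p t0) = c" by (auto simp: CARAT_DERIV)
  have z0: "F t0 (p t0) = 0" using zero by (rule eventually_nhds_x_imp_x)
  have iq: "isCont (\<lambda>t. q (p t)) t0" by (rule isCont_o2[OF p q(2)])
  then have "\<forall>\<^sub>F t in at t0. q (p t) \<noteq> 0"
    unfolding isCont_def using q(3) c by (intro tendsto_imp_eventually_ne) auto
  moreover have "\<forall>\<^sub>F t in at t0. F t (p t) = 0"
    using zero by (auto simp: eventually_at_filter elim: eventually_mono)
  moreover have "\<forall>\<^sub>F t in at t0. t \<noteq> t0" by (auto simp: eventually_at_filter)
  ultimately have ev: "\<forall>\<^sub>F t in at t0. - Q t / q (p t) = (p t - p t0) / (t - t0)"
  proof eventually_elim
    case (elim t)
    have "0 = (t - t0) * Q t + q (p t) * (p t - p t0)" using Q(1)[of t] q(1)[of "p t"] elim z0 by simp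
    then show ?case using elim by (simp add: field_simps)
  qed
  have "((\<lambda>t. - Q t / q (p t)) \<longlongrightarrow> - F' t0 (p t0) / c) (at t0)"
    using Q(2,3) iq q(3) c unfolding isCont_def by (intro tendsto_intros) auto
  then have "((\<lambda>t. (p t - p t0) / (t - t0)) \<longlongrightarrow> - F' t0 (p t0) / c) (at t0)"
    by (rule Lim_transform_eventually) (rule ev)
  then show ?thesis by (simp add: has_field_derivative_iff)
qed

lemma last_zero:
  fixes h :: "real \<Rightarrow> real"
  assumes "a \<le> c" "continuous_on {a..c} h" "h a = 0"
  obtains e where "a \<le> e" "e \<le> c" "h e = 0" "\<And>x. e < x \<Longrightarrow> x \<le> c \<Longrightarrow> h x \<noteq> 0"
proof -
  let ?Z = "{x\<in>{a..c}. h x = 0}"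
  have "closed ?Z" using continuous_closed_preimage[OF assms(2), of "{0}"]
    by (simp add: vimage_def Int_def)
  then have "compact ({a..c} \<inter> ?Z)" by (rule compact_Int_closed[OF compact_Icc])
  moreover have "{a..c} \<inter> ?Z = ?Z" by auto
  ultimately have "compact ?Z" by simp
  from compact_attains_sup[OF this] assms obtain e where "e \<in> ?Z" "\<forall>x\<in>?Z. x \<le> e" by fastforce
  then show ?thesis by (intro that[of e]) (simp_all add: order.strict_iff_not, meson order_trans)
qed

text \<open>Apply the mean value theorem between \<open>t\<close> and the last zero of \<open>h\<close> on the way from \<open>t0\<close>.\<close>

lemma has_derivative_zero_flat:
  fixes h k :: "real \<Rightarrow> real"
  assumes I: "open I" "t0 \<in> I" and cont: "continuous_on I h" and h0: "h t0 = 0"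
    and der: "\<And>t. t \<in> I \<Longrightarrow> h t \<noteq> 0 \<Longrightarrow> (h has_real_derivative k t) (at t)"
    and k: "(k \<longlongrightarrow> 0) (at t0)"
  shows "(h has_real_derivative 0) (at t0)"
proof -
  have "((\<lambda>t. (h t - h t0) / (t - t0)) \<longlongrightarrow> 0) (at t0)"
  proof (rule LIM_I)
    fix e :: real assume e: "0 < e"
    from LIM_D[OF k e] obtain \<delta> where \<delta>: "\<delta> > 0"
      "\<And>t. t \<noteq> t0 \<Longrightarrow> \<bar>t - t0\<bar> < \<delta> \<Longrightarrow> \<bar>k t\<bar> < e" by auto
    from I obtain \<delta>' where \<delta>': "\<delta>' > 0" "ball t0 \<delta>' \<subseteq> I" by (meson openE)
    define \<eta> where "\<eta> = min \<delta> \<delta>'"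
    have bnd: "\<bar>h t\<bar> < e * \<bar>t - t0\<bar>" if t: "t \<noteq> t0" "\<bar>t - t0\<bar> < \<eta>" for t
    proof (cases "h t = 0")
      case True then show ?thesis using t e by simp
    next
      case False
      \<comment> \<open>Reparametrised by the distance from \<open>t0\<close>, so that both sides of
        \<open>t0\<close> are treated at once.\<close>
      define h' where "h' = (\<lambda>x. h (t0 + sgn (t - t0) * x))"
      define c where "c = \<bar>t - t0\<bar>"
      have inI: "t0 + sgn (t - t0) * x \<in> I" if "0 \<le> x" "x \<le> c" for x
        using that t \<delta>' by (intro subsetD[OF \<delta>'(2)])
          (auto simp: dist_real_def \<eta>_def c_def abs_mult sgn_if)
      have ct: "h' c = h t" by (auto simp: h'_def c_def sgn_if)
      have "continuous_on {0..c} h'" unfolding h'_def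
        by (rule continuous_on_compose2[OF cont]) (auto intro!: continuous_intros inI)
      from last_zero[of 0 c h', OF _ this] obtain z where z: "0 \<le> z" "z \<le> c" "h' z = 0"
        "\<And>x. z < x \<Longrightarrow> x \<le> c \<Longrightarrow> h' x \<noteq> 0" by (auto simp: c_def h'_def h0)
      have "z < c" using z(2,3) ct False by (cases "z = c") auto
      have d: "(h' has_real_derivative k (t0 + sgn (t - t0) * x) * sgn (t - t0)) (at x)"
        if "z < x" "x \<le> c" for x
        unfolding h'_def
        by (rule DERIV_chain2[where g="\<lambda>x. t0 + sgn (t - t0) * x"])
          (use z(4)[OF that] inI[of x] that z(1) in \<open>auto intro!: der derivative_eq_intros simp: h'_def\<close>)
      have "continuous_on {z..c} h'"
        by (rule continuous_on_subset[OF \<open>continuous_on {0..c} h'\<close>]) (use z in auto)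
      then obtain \<xi> where \<xi>: "z < \<xi>" "\<xi> < c"
        "h' c - h' z = (c - z) * (k (t0 + sgn (t - t0) * \<xi>) * sgn (t - t0))"
        using MVT[OF \<open>z < c\<close>, of h'] d DERIV_unique
        by (metis less_imp_le real_differentiable_def)
      have "\<bar>k (t0 + sgn (t - t0) * \<xi>)\<bar> < e" using \<xi> z t
        by (intro \<delta>(2)) (auto simp: \<eta>_def c_def abs_mult sgn_if)
      then have "\<bar>h' c\<bar> < (c - z) * e"
        using \<xi> z t \<open>z < c\<close> by (simp add: abs_mult)
      also have "\<dots> \<le> e * c" using e z by (simp add: mult.commute)
      finally show ?thesis unfolding ct by (simp add: c_def)
    qed
    show "\<exists>s>0. \<forall>t. t \<noteq> t0 \<and> norm (t - t0) < s \<longrightarrow> norm ((h t - h t0) / (t - t0) - 0) < e"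
      using \<delta>(1) \<delta>'(1) bnd h0 by (intro exI[of _ \<eta>]) (auto simp: \<eta>_def field_simps)
  qed
  then show ?thesis by (simp add: has_field_derivative_iff)
qed

subsection \<open>Iterated partial derivatives\<close>

text \<open>The second difference of \<open>F\<close> over a square of side \<open>h\<close> equals
  \<open>h * h\<close> times a value of \<open>F12\<close>, and likewise times a value of
  \<open>F21\<close>, by two mean value steps in either order. Both points tend to
  \<open>(a, b)\<close> with \<open>h\<close>.\<close>

lemma clairaut_real:
  fixes F F1 F2 F12 F21 :: "real \<Rightarrow> real \<Rightarrow> real"
  assumes 1: "\<And>t s. ((\<lambda>t. F t s) has_real_derivative F1 t s) (at t)"
    and 2: "\<And>t s. ((\<lambda>s. F t s) has_real_derivative F2 t s) (at s)"
    and 12: "\<And>t s. ((\<lambda>s. F1 t s) has_real_derivative F12 t s) (at s)"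
    and 21: "\<And>t s. ((\<lambda>t. F2 t s) has_real_derivative F21 t s) (at t)"
    and c12: "isCont (\<lambda>z. F12 (fst z) (snd z)) (a, b)"
    and c21: "isCont (\<lambda>z. F21 (fst z) (snd z)) (a, b)"
  shows "F12 a b = F21 a b"
proof -
  have "\<exists>x y x' y'. \<bar>x - a\<bar> \<le> h \<and> \<bar>y - b\<bar> \<le> h \<and> \<bar>x' - a\<bar> \<le> h \<and> \<bar>y' - b\<bar> \<le> h \<and> F12 x y = F21 x' y'"
    if h: "h > 0" for h
  proof -
    obtain x where x: "a < x" "x < a + h"
      "(F (a+h) (b+h) - F (a+h) b) - (F a (b+h) - F a b) = h * (F1 x (b+h) - F1 x b)"
      using MVT2[of a "a+h" "\<lambda>t. F t (b+h) - F t b" "\<lambda>t. F1 t (b+h) - F1 t b"] h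
        DERIV_diff[OF 1 1] by auto
    obtain y where y: "b < y" "y < b + h" "F1 x (b+h) - F1 x b = h * F12 x y"
      using MVT2[of b "b+h" "F1 x" "F12 x"] h 12 by auto
    obtain y' where y': "b < y'" "y' < b + h"
      "(F (a+h) (b+h) - F a (b+h)) - (F (a+h) b - F a b) = h * (F2 (a+h) y' - F2 a y')"
      using MVT2[of b "b+h" "\<lambda>s. F (a+h) s - F a s" "\<lambda>s. F2 (a+h) s - F2 a s"] h
        DERIV_diff[OF 2 2] by auto
    obtain x' where x': "a < x'" "x' < a + h" "F2 (a+h) y' - F2 a y' = h * F21 x' y'"
      using MVT2[of a "a+h" "\<lambda>t. F2 t y'" "\<lambda>t. F21 t y'"] h 21 by auto
    have "h * (h * F12 x y) = h * (h * F21 x' y')"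
      using x(3) y(3) x'(3) y'(3) by (simp add: algebra_simps)
    then have "F12 x y = F21 x' y'" using h by simp
    then show ?thesis using x y x' y' by (intro exI conjI) auto
  qed
  from this[of "inverse (real (Suc n))" for n]
  obtain x y x' y' where *: "\<And>n. \<bar>x n - a\<bar> \<le> inverse (real (Suc n))"
    "\<And>n. \<bar>y n - b\<bar> \<le> inverse (real (Suc n))" "\<And>n. \<bar>x' n - a\<bar> \<le> inverse (real (Suc n))"
    "\<And>n. \<bar>y' n - b\<bar> \<le> inverse (real (Suc n))" and eq: "\<And>n. F12 (x n) (y n) = F21 (x' n) (y' n)"
    unfolding inverse_positive_iff_positive using of_nat_0_less_iff zero_less_Suc by metis
  have lim: "z \<longlonglongrightarrow> c" if "\<And>n. \<bar>z n - c\<bar> \<le> inverse (real (Suc n))" for z and c :: real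
    by (rule LIM_zero_cancel, rule Lim_null_comparison[OF _ LIMSEQ_inverse_real_of_nat])
      (use that in auto)
  have "(\<lambda>n. F12 (fst (x n, y n)) (snd (x n, y n))) \<longlonglongrightarrow> F12 (fst (a, b)) (snd (a, b))"
    by (rule isCont_tendsto_compose[OF c12]) (intro tendsto_Pair lim *)
  moreover have "(\<lambda>n. F21 (fst (x' n, y' n)) (snd (x' n, y' n))) \<longlonglongrightarrow> F21 (fst (a, b)) (snd (a, b))"
    by (rule isCont_tendsto_compose[OF c21]) (intro tendsto_Pair lim *)
  ultimately show ?thesis unfolding fst_conv snd_conv eq by (rule LIMSEQ_unique)
qed

section \<open>Coordinatewise convergence and continuity on \<open>rspace\<close>\<close>

lemma rspace_iff: "x \<in> rspace S \<longleftrightarrow> (\<forall>i. i \<notin> S \<longrightarrow> x i = undefined)"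
  by (auto simp: rspace_def PiE_iff extensional_def)

lemma rspace_upd [simp, intro]: "x \<in> rspace S \<Longrightarrow> i \<in> S \<Longrightarrow> x(i := t) \<in> rspace S"
  by (auto simp: rspace_iff)

lemma tendsto_fun_iff:
  fixes l :: "'a \<Rightarrow> 'b::topological_space"
  shows "(X \<longlongrightarrow> l) F \<longleftrightarrow> (\<forall>i. ((\<lambda>n. X n i) \<longlongrightarrow> l i) F)"
  using limitin_componentwise[of "\<lambda>_::'a. euclidean::'b topology" UNIV X l F]
  by (simp add: euclidean_product_topology)

lemma tendsto_fun_upd [tendsto_intros]:
  fixes l :: "'a \<Rightarrow> 'b::topological_space"
  assumes "(X \<longlongrightarrow> l) F" "(a \<longlongrightarrow> a0) F"
  shows "((\<lambda>n. (X n)(i := a n)) \<longlongrightarrow> l(i := a0)) F"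
  using assms by (auto simp: tendsto_fun_iff)

lemma continuous_on_rspace_tendsto:
  assumes "continuous_on (rspace S) h" "(X \<longlongrightarrow> x) F" "x \<in> rspace S" "\<forall>\<^sub>F n in F. X n \<in> rspace S"
  shows "((\<lambda>n. h (X n)) \<longlongrightarrow> h x) F"
  by (rule continuous_on_tendsto_compose[OF assms])

lemma continuous_on_rspace_plane:
  assumes "continuous_on (rspace S) h" "x \<in> rspace S" "i \<in> S" "k \<in> S"
  shows "isCont (\<lambda>z. h (x(i := fst z, k := snd z))) z0"
  unfolding isCont_def
  by (rule continuous_on_rspace_tendsto[OF assms(1)])
    (use assms(2-) in \<open>auto intro!: tendsto_intros\<close>)

lemma continuous_on_rspace_line:
  assumes "continuous_on (rspace S) h" "x \<in> rspace S" "i \<in> S"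
  shows "isCont (\<lambda>t. h (x(i := t))) t0"
  unfolding isCont_def
  by (rule continuous_on_rspace_tendsto[OF assms(1)])
    (use assms(2-) in \<open>auto intro!: tendsto_intros\<close>)

section \<open>Calculus with the classes \<open>Cr_on\<close>\<close>

lemma partial_deriv_cong:
  assumes "\<And>x. x \<in> rspace S \<Longrightarrow> h x = h' x" "i \<in> S" "x \<in> rspace S"
  shows "partial_deriv i h x = partial_deriv i h' x"
  using assms by (simp add: partial_deriv_def)

lemma Cr_on_continuous: "Cr_on S r h \<Longrightarrow> continuous_on (rspace S) h"
  by (cases r) auto

lemma Cr_on_Suc: "Cr_on S (Suc r) h \<Longrightarrow> Cr_on S r h"
  by (induction r arbitrary: h) (auto dest: Cr_on_continuous)

lemma Cr_on_mono: "Cr_on S r h \<Longrightarrow> r' \<le> r \<Longrightarrow> Cr_on S r' h"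
  by (induction r) (auto simp: le_Suc_eq simp del: Cr_on.simps dest: Cr_on_Suc)

lemma Cr_on_has_partial:
  assumes "Cr_on S r h" "0 < r" "i \<in> S" "x \<in> rspace S"
  shows "((\<lambda>t. h (x(i := t))) has_real_derivative partial_deriv i h (x(i := t))) (at t)"
proof -
  have "has_partial_on S i h" using assms(1-3) by (cases r) auto
  then have "(\<lambda>s. h ((x(i := t))(i := s))) field_differentiable (at ((x(i := t)) i))"
    using assms(3,4) unfolding has_partial_on_def by blast
  then show ?thesis by (simp add: partial_deriv_def field_differentiable_derivI)
qed

text \<open>Derivatives are indexed by words instead of multi-indices, outermost derivative first:
  an induction that differentiates once more just prepends a letter.\<close>

abbreviation pd :: "nat list \<Rightarrow> ((nat \<Rightarrow> real) \<Rightarrow> real) \<Rightarrow> (nat \<Rightarrow> real) \<Rightarrow> real" where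
  "pd w h \<equiv> foldr partial_deriv w h"

lemma Cr_on_pd:
  "Cr_on S r h \<Longrightarrow> set w \<subseteq> S \<Longrightarrow> length w \<le> r \<Longrightarrow> Cr_on S (r - length w) (pd w h)"
proof (induction w)
  case (Cons i w)
  then have "Cr_on S (Suc (r - Suc (length w))) (pd w h)" by (simp add: Suc_diff_Suc del: Cr_on.simps)
  then show ?case using Cons.prems by simp
qed simp

lemma partial_deriv_commute:
  assumes "Cr_on S r h" "2 \<le> r" "i \<in> S" "k \<in> S" "x \<in> rspace S"
  shows "partial_deriv i (partial_deriv k h) x = partial_deriv k (partial_deriv i h) x"
proof (cases "i = k")
  case False
  have C: "Cr_on S 2 h" by (rule Cr_on_mono[OF assms(1,2)])
  then have C1: "Cr_on S 1 (partial_deriv i h)" "Cr_on S 1 (partial_deriv k h)"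
    and C2: "Cr_on S 0 (partial_deriv k (partial_deriv i h))" "Cr_on S 0 (partial_deriv i (partial_deriv k h))"
    using assms(3,4) by (auto simp: numeral_2_eq_2)
  have "partial_deriv k (partial_deriv i h) (x(i := x i, k := x k))
      = partial_deriv i (partial_deriv k h) (x(i := x i, k := x k))"
  proof (rule clairaut_real[where F="\<lambda>t s. h (x(i := t, k := s))"
        and ?F1.0="\<lambda>t s. partial_deriv i h (x(i := t, k := s))"
        and ?F2.0="\<lambda>t s. partial_deriv k h (x(i := t, k := s))"
        and ?F12.0="\<lambda>t s. partial_deriv k (partial_deriv i h) (x(i := t, k := s))"
        and ?F21.0="\<lambda>t s. partial_deriv i (partial_deriv k h) (x(i := t, k := s))"])
    fix t s
    show "((\<lambda>s. h (x(i := t, k := s))) has_real_derivative partial_deriv k h (x(i := t, k := s))) (at s)"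
      by (rule Cr_on_has_partial[OF C]) (use assms in auto)
    show "((\<lambda>s. partial_deriv i h (x(i := t, k := s))) has_real_derivative
        partial_deriv k (partial_deriv i h) (x(i := t, k := s))) (at s)"
      by (rule Cr_on_has_partial[OF C1(1)]) (use assms in auto)
    show "((\<lambda>t. h (x(i := t, k := s))) has_real_derivative partial_deriv i h (x(i := t, k := s))) (at t)"
      using Cr_on_has_partial[OF C, of i "x(k := s)" t] assms False by (simp add: fun_upd_twist)
    show "((\<lambda>t. partial_deriv k h (x(i := t, k := s))) has_real_derivative
        partial_deriv i (partial_deriv k h) (x(i := t, k := s))) (at t)"
      using Cr_on_has_partial[OF C1(2), of i "x(k := s)" t] assms False by (simp add: fun_upd_twist)
    show "isCont (\<lambda>z. partial_deriv k (partial_deriv i h) (x(i := fst z, k := snd z))) (x i, x k)"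
      by (rule continuous_on_rspace_plane[OF Cr_on_continuous[OF C2(1)]]) (use assms in auto)
    show "isCont (\<lambda>z. partial_deriv i (partial_deriv k h) (x(i := fst z, k := snd z))) (x i, x k)"
      by (rule continuous_on_rspace_plane[OF Cr_on_continuous[OF C2(2)]]) (use assms in auto)
  qed
  then show ?thesis by simp
qed simp

lemma pd_insort:
  assumes "Cr_on S r h" "set (i # w) \<subseteq> S" "length (i # w) \<le> r" "x \<in> rspace S"
  shows "pd (insort i w) h x = pd (i # w) h x"
  using assms(2-)
proof (induction w arbitrary: x)
  case (Cons k w)
  show ?case
  proof (cases "i \<le> k")
    case False
    have "pd (insort i (k # w)) h x = partial_deriv k (pd (insort i w) h) x" using False by simp
    also have "\<dots> = partial_deriv k (pd (i # w) h) x"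
      by (rule partial_deriv_cong[of S]) (use Cons in auto)
    also have "\<dots> = partial_deriv i (partial_deriv k (pd w h)) x"
      using partial_deriv_commute[OF Cr_on_pd[OF assms(1), of w], of k i x] Cons.prems by simp
    finally show ?thesis by simp
  qed simp
qed simp

lemma pd_sort:
  assumes "Cr_on S r h" "set w \<subseteq> S" "length w \<le> r" "x \<in> rspace S"
  shows "pd (sort w) h x = pd w h x"
  using assms(2-)
proof (induction w arbitrary: x)
  case (Cons i w)
  have "pd (sort (i # w)) h x = pd (insort i (sort w)) h x" by simp
  also have "\<dots> = pd (i # sort w) h x" using Cons.prems by (intro pd_insort[OF assms(1)]) auto
  also have "\<dots> = partial_deriv i (pd (sort w) h) x" by simp
  also have "\<dots> = partial_deriv i (pd w h) x"
    by (rule partial_deriv_cong[of S]) (use Cons in auto)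
  finally show ?case by simp
qed simp

lemma multi_deriv_eq_pd:
  "multi_deriv d \<alpha> h = pd (concat (map (\<lambda>i. replicate (\<alpha> i) i) [1..<Suc d])) h"
proof -
  have "pd (replicate n i) h = (partial_deriv i ^^ n) h" for n i h by (induction n) auto
  then have "foldr (\<lambda>i. partial_deriv i ^^ \<alpha> i) xs h = pd (concat (map (\<lambda>i. replicate (\<alpha> i) i) xs)) h" for xs
    by (induction xs) auto
  then show ?thesis by (simp add: multi_deriv_def)
qed

text \<open>The word behind \<open>multi_deriv\<close> is sorted and has the letter counts of
  \<open>w\<close>, hence it is \<open>sort w\<close>. This carries the bounds of (A2) from
  multi-indices over to words.\<close>

lemma pd_eq_multi_deriv:
  assumes "Cr_on {1..d} r h" "set w \<subseteq> {1..d}" "length w \<le> r" "x \<in> rspace {1..d}"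
  shows "pd w h x = multi_deriv d (count_list w) h x"
proof -
  let ?c = "\<lambda>xs. concat (map (\<lambda>i. replicate (count_list w i) i) xs)"
  have "sorted xs \<Longrightarrow> sorted (?c xs)" for xs
    by (induction xs) (auto simp: sorted_append)
  from this[of "[1..<Suc d]"] have "sorted (?c [1..<Suc d])" by (simp del: upt_Suc)
  moreover have "count (mset (?c xs)) k = (if k \<in> set xs then count_list w k else 0)"
    if "distinct xs" for xs k
    using that by (induction xs) auto
  then have "mset (?c [1..<Suc d]) = mset w"
    using assms(2) by (intro multiset_eqI) (auto simp: count_mset count_list_0_iff simp del: upt_Suc)
  ultimately have "sort w = ?c [1..<Suc d]" by (metis properties_for_sort)
  then show ?thesis using pd_sort[OF assms] by (simp add: multi_deriv_eq_pd)
qed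

lemma sum_count_list: "finite A \<Longrightarrow> set w \<subseteq> A \<Longrightarrow> (\<Sum>i\<in>A. count_list w i) = length w"
proof (induction w)
  case (Cons a w)
  have "(\<Sum>i\<in>A. count_list (a # w) i) = (\<Sum>i\<in>A. count_list w i + of_bool (i = a))"
    by (intro sum.cong) auto
  then show ?case using Cons by (simp add: sum.distrib)
qed simp

subsection \<open>Positive continuous densities\<close>

text \<open>The half-line is cut at \<open>v - 1\<close>: the part below is constant near
  \<open>v\<close>, and the rest is an integral over a compact interval, to which the fundamental
  theorem applies.\<close>

lemma has_derivative_indefinite_integral:
  fixes q :: "real \<Rightarrow> real"
  assumes int: "integrable lborel q" and cont: "continuous_on UNIV q"
  shows "((\<lambda>v. \<integral>s. q s * indicator {..v} s \<partial>lborel) has_real_derivative q v) (at v)"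
proof -
  define a where "a = v - 1"
  define b where "b = v + 1"
  have si: "set_integrable lborel A q" if "A \<in> sets borel" for A
    unfolding set_integrable_def scaleR_conv_of_real of_real_eq_id id_def
    using integrable_mult_indicator[OF _ int, of A] that by (simp add: ac_simps)
  have split: "(\<integral>s. q s * indicator {..x} s \<partial>lborel)
      = (\<integral>s. q s * indicator {..a} s \<partial>lborel) + integral {a..x} q" if "a \<le> x" for x
  proof -
    have "(\<integral>s. q s * indicator {..x} s \<partial>lborel) = (LINT s:{..a} \<union> {a<..x}|lborel. q s)"
      unfolding set_lebesgue_integral_def by (simp add: ac_simps ivl_disj_un_one that)
    also have "\<dots> = (LINT s:{..a}|lborel. q s) + (LINT s:{a<..x}|lborel. q s)"
      by (rule set_integral_Un) (auto intro!: si)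
    also have "(LINT s:{a<..x}|lborel. q s) = (LINT s:{a..x}|lborel. q s)"
    proof (rule set_integral_null_delta[OF int])
      have "sym_diff {a<..x} {a..x} = {a}" using that by auto
      then show "sym_diff {a<..x} {a..x} \<in> null_sets lborel" by (simp add: null_sets_def)
    qed auto
    also have "\<dots> = integral {a..x} q"
      by (rule set_borel_integral_eq_integral(2)[OF si]) simp
    finally show ?thesis by (simp add: set_lebesgue_integral_def ac_simps)
  qed
  have "((\<lambda>x. integral {a..x} q) has_real_derivative q v) (at v within {a..b})"
    by (rule integral_has_real_derivative) (auto simp: a_def b_def intro: continuous_on_subset[OF cont])
  then have "((\<lambda>x. integral {a..x} q) has_real_derivative q v) (at v)"
    using at_within_interior[of v "{a..b}"] by (simp add: a_def b_def)
  then have "((\<lambda>x. (\<integral>s. q s * indicator {..a} s \<partial>lborel) + integral {a..x} q) has_real_derivative q v) (at v)"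
    by (auto intro!: derivative_eq_intros)
  then show ?thesis
    by (rule has_field_derivative_transform_within_open[where S="{a<..}"])
      (auto simp: a_def split[unfolded a_def, symmetric])
qed

locale positive_density =
  fixes \<rho> :: "real \<Rightarrow> real"
  assumes dens: "prob_density \<rho>" and cont: "continuous_on UNIV \<rho>" and pos: "\<And>x. 0 < \<rho> x"
begin

lemma rho_measurable [measurable]: "\<rho> \<in> borel_measurable borel"
  using dens by (simp add: prob_density_def)

sublocale law: real_distribution "law \<rho>"
  unfolding real_distribution_def real_distribution_axioms_def
  using dens by (auto simp: law_def prob_density_def emeasure_density intro!: prob_spaceI)

lemma integrable_law: "h \<in> borel_measurable borel \<Longrightarrow> integrable (law \<rho>) h \<longleftrightarrow> integrable lborel (\<lambda>x. h x * \<rho> x)"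
  unfolding law_def using pos
  by (subst integrable_density) (auto simp: less_imp_le mult.commute)

lemma integral_law: "h \<in> borel_measurable borel \<Longrightarrow> (\<integral>x. h x \<partial>law \<rho>) = (\<integral>x. h x * \<rho> x \<partial>lborel)"
  unfolding law_def using pos
  by (subst integral_density) (auto simp: less_imp_le mult.commute)

lemma integrable_rho: "integrable lborel \<rho>"
  using integrable_law[of "\<lambda>_. 1"] by simp

lemma Phi_derivative: "(Phi \<rho> has_real_derivative \<rho> x) (at x)"
proof -
  have "Phi \<rho> = (\<lambda>v. \<integral>s. \<rho> s * indicator {..v} s \<partial>lborel)"
  proof
    fix v
    have "Phi \<rho> v = (\<integral>x. indicator {..v} x \<partial>law \<rho>)" by (simp add: cdf_def)
    then show "Phi \<rho> v = (\<integral>s. \<rho> s * indicator {..v} s \<partial>lborel)"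
      by (subst (asm) integral_law) (auto simp: ac_simps)
  qed
  then show ?thesis using has_derivative_indefinite_integral[OF integrable_rho cont] by simp
qed

lemma Phi_strict_mono: "x < y \<Longrightarrow> Phi \<rho> x < Phi \<rho> y"
  by (rule DERIV_pos_imp_increasing) (auto intro: Phi_derivative pos)

lemma Phi_less_iff [simp]: "Phi \<rho> x < Phi \<rho> y \<longleftrightarrow> x < y"
  using Phi_strict_mono by (metis linorder_less_linear order_less_imp_not_less)

lemma Phi_pos [simp]: "0 < Phi \<rho> x" and Phi_less_1 [simp]: "Phi \<rho> x < 1"
  using Phi_strict_mono[of "x - 1" x] law.cdf_nonneg[of "x - 1"] Phi_strict_mono[of x "x + 1"]
    law.cdf_bounded_prob[of "x + 1"] by linarith+

lemma isCont_Phi [continuous_intros]: "isCont (Phi \<rho>) x"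
  using Phi_derivative by (rule DERIV_isCont)

lemma continuous_on_Phi [continuous_intros]: "continuous_on A h \<Longrightarrow> continuous_on A (\<lambda>x. Phi \<rho> (h x))"
  by (rule continuous_on_compose2[where t=UNIV and g="Phi \<rho>"])
    (auto intro!: continuous_at_imp_continuous_on isCont_Phi)

lemma Phi_measurable [measurable]: "Phi \<rho> \<in> borel_measurable borel"
  by (intro borel_measurable_continuous_onI continuous_intros)

lemma inj_Phi: "inj (Phi \<rho>)"
  by (metis Phi_less_iff injI less_irrefl linorder_less_linear)

lemma Phi_inv_Phi [simp]: "Phi_inv \<rho> (Phi \<rho> x) = x"
  using inj_Phi by simp

lemma Phi_surj: assumes "0 < u" "u < 1" obtains x where "Phi \<rho> x = u"
proof -
  have "\<forall>\<^sub>F x in at_bot. Phi \<rho> x < u" "\<forall>\<^sub>F x in at_top. u < Phi \<rho> x"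
    using order_tendstoD[OF law.cdf_lim_at_bot] order_tendstoD[OF law.cdf_lim_at_top_prob] assms by auto
  then obtain a b where "Phi \<rho> a < u" "u < Phi \<rho> b"
    by (meson eventually_at_bot_linorder eventually_at_top_linorder order_refl)
  moreover from this have "a < b" using Phi_less_iff by (meson order_less_trans)
  ultimately show ?thesis using IVT[of "Phi \<rho>" a u b] that isCont_Phi by auto
qed

lemma Phi_Phi_inv: "0 < u \<Longrightarrow> u < 1 \<Longrightarrow> Phi \<rho> (Phi_inv \<rho> u) = u"
  using Phi_surj Phi_inv_Phi by metis

lemma Phi_inv_derivative: "(Phi_inv \<rho> has_real_derivative 1 / \<rho> x) (at (Phi \<rho> x))"
proof -
  have "isCont (Phi_inv \<rho>) (Phi \<rho> x)"
    by (rule isCont_inverse_function[of 1 x "Phi_inv \<rho>" "Phi \<rho>"]) (simp_all add: isCont_Phi)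
  then have "(Phi_inv \<rho> has_real_derivative inverse (\<rho> x)) (at (Phi \<rho> x))"
    by (rule DERIV_inverse_function[where f="Phi \<rho>" and a=0 and b=1, rotated -1])
      (use Phi_derivative[of x] pos[of x] in \<open>simp_all add: Phi_Phi_inv\<close>)
  then show ?thesis by (simp add: divide_inverse)
qed

section \<open>The function \<open>tail\<close>, in whose powers all growth is measured\<close>

definition tail :: "real \<Rightarrow> real" where "tail x = min (Phi \<rho> x) (1 - Phi \<rho> x)"

lemma tail_pos [simp]: "0 < tail x" and tail_le_half: "tail x \<le> 1/2" and tail_nz [simp]: "tail x \<noteq> 0"
  and tail_nonneg [simp]: "0 \<le> tail x"
  by (auto simp: tail_def min_def) (use Phi_pos[of x] Phi_less_1[of x] in linarith)+

lemma continuous_on_tail [continuous_intros]: "continuous_on A h \<Longrightarrow> continuous_on A (\<lambda>x. tail (h x))"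
  unfolding tail_def by (intro continuous_intros)

lemma tail_measurable [measurable]: "tail \<in> borel_measurable borel"
  unfolding tail_def by measurable

lemma tail_powr_mono: "a \<le> b \<Longrightarrow> tail x powr b \<le> tail x powr a"
  by (rule powr_mono') (use tail_le_half[of x] in \<open>auto simp: less_imp_le\<close>)

lemma tail_powr_power: "(tail s powr (- b)) ^ n = tail s powr (- (real n * b))"
  by (simp add: powr_powr[symmetric] powr_realpow[symmetric] powr_powr mult.commute)

text \<open>The substitution u = \<Phi>(x) turns these into integrals of a power of u or 1 - u over
  the unit interval. It is carried out through the explicit antiderivative, whose limits at both
  infinities are finite because \<open>p + 1 > 0\<close>.\<close>

lemma integrable_Phi_powr:
  assumes p: "-1 < p"
  shows "integrable lborel (\<lambda>x. Phi \<rho> x powr p * \<rho> x)"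
    and "integrable lborel (\<lambda>x. (1 - Phi \<rho> x) powr p * \<rho> x)"
proof -
  have c: "isCont \<rho> x" for x using cont by (simp add: continuous_on_eq_continuous_at)
  have top: "((\<lambda>x. Phi \<rho> x) \<longlongrightarrow> 1) at_top" and bot: "((\<lambda>x. Phi \<rho> x) \<longlongrightarrow> 0) at_bot"
    using law.cdf_lim_at_bot law.cdf_lim_at_top_prob by auto
  have top': "((\<lambda>x. 1 - Phi \<rho> x) \<longlongrightarrow> 0) at_top" and bot': "((\<lambda>x. 1 - Phi \<rho> x) \<longlongrightarrow> 1) at_bot"
    using tendsto_diff[OF tendsto_const[of 1] top] tendsto_diff[OF tendsto_const[of 1] bot] by simp_all
  have "set_integrable lborel (einterval (-\<infinity>) \<infinity>) (\<lambda>x. Phi \<rho> x powr p * \<rho> x)"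
  proof (rule interval_integral_FTC_nonneg(1)[where F="\<lambda>x. Phi \<rho> x powr (p+1) / (p+1)" and A=0 and B="1 / (p+1)"])
    fix x :: real
    show "((\<lambda>x. Phi \<rho> x powr (p+1) / (p+1)) has_real_derivative Phi \<rho> x powr p * \<rho> x) (at x)"
    proof -
      have "((\<lambda>x. Phi \<rho> x powr (p+1)) has_real_derivative (p + 1) * Phi \<rho> x powr (p + 1 - 1) * \<rho> x) (at x)"
        by (rule DERIV_chain2[where f="\<lambda>z. z powr (p+1)"])
          (rule has_real_derivative_powr Phi_derivative Phi_pos)+
      from DERIV_cdivide[OF this, of "p+1"] p show ?thesis by simp
    qed
    show "isCont (\<lambda>x. Phi \<rho> x powr p * \<rho> x) x"
      by (intro continuous_intros c isCont_Phi) (simp add: less_imp_neq[THEN not_sym])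
    have "((\<lambda>x. Phi \<rho> x powr (p+1) / (p+1)) \<longlongrightarrow> 0 powr (p+1) / (p+1)) at_bot"
      by (intro tendsto_intros bot) (use p in \<open>auto simp: less_imp_le\<close>)
    then show "(((\<lambda>x. Phi \<rho> x powr (p+1) / (p+1)) \<circ> real_of_ereal) \<longlongrightarrow> 0) (at_right (-\<infinity>))"
      by (simp add: ereal_tendsto_simps)
    have "((\<lambda>x. Phi \<rho> x powr (p+1) / (p+1)) \<longlongrightarrow> 1 powr (p+1) / (p+1)) at_top"
      by (intro tendsto_intros top) (use p in auto)
    then show "(((\<lambda>x. Phi \<rho> x powr (p+1) / (p+1)) \<circ> real_of_ereal) \<longlongrightarrow> 1 / (p+1)) (at_left \<infinity>)"
      by (simp add: ereal_tendsto_simps)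
  qed (auto simp: less_imp_le[OF pos])
  then show "integrable lborel (\<lambda>x. Phi \<rho> x powr p * \<rho> x)"
    by (simp add: set_integrable_def)
  have "set_integrable lborel (einterval (-\<infinity>) \<infinity>) (\<lambda>x. (1 - Phi \<rho> x) powr p * \<rho> x)"
  proof (rule interval_integral_FTC_nonneg(1)[where F="\<lambda>x. - ((1 - Phi \<rho> x) powr (p+1) / (p+1))" and A="- (1 / (p+1))" and B="0"])
    fix x :: real
    have "0 < 1 - Phi \<rho> x" by simp
    then show "((\<lambda>x. - ((1 - Phi \<rho> x) powr (p+1) / (p+1))) has_real_derivative (1 - Phi \<rho> x) powr p * \<rho> x) (at x)"
    proof -
      have "((\<lambda>x. 1 - Phi \<rho> x) has_real_derivative - \<rho> x) (at x)"
        using DERIV_diff[OF DERIV_const[of 1] Phi_derivative[of x]] by simp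
      then have "((\<lambda>x. (1 - Phi \<rho> x) powr (p+1)) has_real_derivative
          (p + 1) * (1 - Phi \<rho> x) powr (p + 1 - 1) * - \<rho> x) (at x)"
        by (rule DERIV_chain2[where f="\<lambda>z. z powr (p+1)", rotated])
          (rule has_real_derivative_powr \<open>0 < 1 - Phi \<rho> x\<close>)+
      from DERIV_minus[OF DERIV_cdivide[OF this, of "p+1"]] p show ?thesis by simp
    qed
    show "isCont (\<lambda>x. (1 - Phi \<rho> x) powr p * \<rho> x) x"
      using \<open>0 < 1 - Phi \<rho> x\<close> by (intro continuous_intros c isCont_Phi) linarith
    have "((\<lambda>x. - ((1 - Phi \<rho> x) powr (p+1) / (p+1))) \<longlongrightarrow> - (1 powr (p+1) / (p+1))) at_bot"
      by (intro tendsto_intros bot') (use p in auto)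
    then show "(((\<lambda>x. - ((1 - Phi \<rho> x) powr (p+1) / (p+1))) \<circ> real_of_ereal) \<longlongrightarrow> - (1 / (p+1))) (at_right (-\<infinity>))"
      by (simp add: ereal_tendsto_simps)
    have "((\<lambda>x. - ((1 - Phi \<rho> x) powr (p+1) / (p+1))) \<longlongrightarrow> - (0 powr (p+1) / (p+1))) at_top"
      by (intro tendsto_intros top') (use p in \<open>auto simp: less_imp_le\<close>)
    then show "(((\<lambda>x. - ((1 - Phi \<rho> x) powr (p+1) / (p+1))) \<circ> real_of_ereal) \<longlongrightarrow> 0) (at_left \<infinity>)"
      by (simp add: ereal_tendsto_simps)
  qed (auto simp: less_imp_le[OF pos])
  then show "integrable lborel (\<lambda>x. (1 - Phi \<rho> x) powr p * \<rho> x)"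
    by (simp add: set_integrable_def)
qed

lemma integrable_tail_powr_rho:
  assumes "-1 < p" shows "integrable lborel (\<lambda>x. tail x powr p * \<rho> x)"
proof (rule Bochner_Integration.integrable_bound)
  show "integrable lborel (\<lambda>x. Phi \<rho> x powr p * \<rho> x + (1 - Phi \<rho> x) powr p * \<rho> x)"
    by (intro Bochner_Integration.integrable_add integrable_Phi_powr assms)
  show "AE x in lborel. norm (tail x powr p * \<rho> x) \<le> norm (Phi \<rho> x powr p * \<rho> x + (1 - Phi \<rho> x) powr p * \<rho> x)"
    using pos by (auto simp: tail_def min_def abs_mult less_imp_le intro!: add_nonneg_nonneg)
qed measurable

text \<open>The bound in (A3) says that \<open>1 / \<rho> x\<close> is at most
  \<open>L' * tail x powr (-1 - B)\<close>. It trades Lebesgue measure for the law with density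
  \<rho>, at the price of lowering the exponent by \<open>1 + B\<close>; it stays above -1 exactly
  when \<open>B < a\<close>.\<close>

lemma integrable_tail_powr:
  assumes L': "0 < L'" "\<forall>u\<in>{0<..<1}. deriv (Phi_inv \<rho>) u \<le> L' * min u (1 - u) powr (- 1 - B)"
    and a: "B < a"
  shows "integrable lborel (\<lambda>x. tail x powr a)"
proof (rule Bochner_Integration.integrable_bound)
  show "integrable lborel (\<lambda>x. L' * (tail x powr (a - 1 - B) * \<rho> x))"
    using a by (intro integrable_mult_right integrable_tail_powr_rho) auto
  have "tail x powr a \<le> L' * (tail x powr (a - 1 - B) * \<rho> x)" for x
  proof -
    have "1 / \<rho> x \<le> L' * tail x powr (-1 - B)"
      using L'(2)[rule_format, of "Phi \<rho> x"] DERIV_imp_deriv[OF Phi_inv_derivative] by (simp add: tail_def)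
    then have "1 \<le> L' * tail x powr (-1 - B) * \<rho> x"
      using pos[of x] by (simp add: field_simps)
    then have "tail x powr a * 1 \<le> tail x powr a * (L' * tail x powr (-1 - B) * \<rho> x)"
      by (intro mult_left_mono) auto
    also have "\<dots> = L' * (tail x powr (a + (-1 - B)) * \<rho> x)"
      by (simp add: powr_add)
    finally show ?thesis by (simp add: algebra_simps)
  qed
  then show "AE x in lborel. norm (tail x powr a) \<le> norm (L' * (tail x powr (a - 1 - B) * \<rho> x))"
    by (auto intro: order_trans[OF _ abs_ge_self])
qed measurable

lemma tail_limits:
  assumes lim: "\<forall>a\<in>{0<..<1}. ((\<lambda>x. q x / (1 - Phi \<rho> x) powr a) \<longlongrightarrow> 0) at_top \<and>
      ((\<lambda>x. q x / (Phi \<rho> x) powr a) \<longlongrightarrow> 0) at_bot"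
    and a: "a < 1"
  shows "((\<lambda>x. q x * tail x powr (- a)) \<longlongrightarrow> 0) at_top" "((\<lambda>x. q x * tail x powr (- a)) \<longlongrightarrow> 0) at_bot"
proof -
  \<comment> \<open>(A3) speaks of exponents in the open unit interval only. Smaller
    \<open>a\<close> are dominated by exponent 1/2, because \<open>tail\<close> is below 1.\<close>
  define a' where "a' = max a (1/2)"
  have a': "a' \<in> {0<..<1}" "a \<le> a'" using a by (auto simp: a'_def)
  have le: "norm (q x * tail x powr (- a)) \<le> \<bar>q x * tail x powr (- a')\<bar>" for x
    unfolding abs_mult real_norm_def using a'(2) by (intro mult_left_mono) (auto intro: tail_powr_mono)
  have top: "\<forall>\<^sub>F x in at_top. 1/2 < Phi \<rho> x" and bot: "\<forall>\<^sub>F x in at_bot. Phi \<rho> x < 1/2"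
    using order_tendstoD(2)[OF law.cdf_lim_at_bot, of "1/2"] order_tendstoD(1)[OF law.cdf_lim_at_top_prob, of "1/2"] by auto
  have "((\<lambda>x. \<bar>q x * tail x powr (- a')\<bar>) \<longlongrightarrow> 0) at_top"
    by (rule tendsto_rabs_zero, rule Lim_transform_eventually[OF conjunct1[OF lim[rule_format, OF a'(1)]]])
      (use top in \<open>eventually_elim, auto simp: tail_def min_def powr_minus field_simps\<close>)
  then show "((\<lambda>x. q x * tail x powr (- a)) \<longlongrightarrow> 0) at_top"
    by (rule Lim_null_comparison[rotated]) (use le in auto)
  have "((\<lambda>x. \<bar>q x * tail x powr (- a')\<bar>) \<longlongrightarrow> 0) at_bot"
    by (rule tendsto_rabs_zero, rule Lim_transform_eventually[OF conjunct2[OF lim[rule_format, OF a'(1)]]])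
      (use bot in \<open>eventually_elim, auto simp: tail_def min_def powr_minus field_simps\<close>)
  then show "((\<lambda>x. q x * tail x powr (- a)) \<longlongrightarrow> 0) at_bot"
    by (rule Lim_null_comparison[rotated]) (use le in auto)
qed

end

subsection \<open>The zero set of the discontinuity\<close>

lemma sign_change_iff:
  fixes v s p :: real
  assumes "s < p \<Longrightarrow> v < 0" "p < s \<Longrightarrow> 0 < v" "s = p \<Longrightarrow> v = 0"
  shows "v < 0 \<longleftrightarrow> s < p" "0 < v \<longleftrightarrow> p < s" "v = 0 \<longleftrightarrow> s = p"
  using assms by (cases s p rule: linorder_cases; simp)+

text \<open>The bounds of (A2) are put in the form in which they are consumed: for words, and for
  reciprocals of powers of D_j \<phi>, which are the denominators of the boundary terms. The bound
  of (A3) on the derivative of \<open>Phi_inv\<close> is added later, for integrals over y.\<close>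

locale preintegration = positive_density \<rho> for \<rho> +
  fixes D :: "nat set" and j r :: nat and g \<phi> :: "(nat \<Rightarrow> real) \<Rightarrow> real" and Bs :: "nat \<Rightarrow> real" and L :: real
  assumes r: "1 \<le> r" and D: "finite D" and j: "j \<in> D"
    and smooth_g: "Cr_on D r g" and smooth_\<phi>: "Cr_on D r \<phi>"
    and Bs: "\<And>i. i \<in> D \<Longrightarrow> 0 < Bs i \<and> Bs i < 1"
    and deriv_j_nz: "\<And>y. y \<in> rspace D \<Longrightarrow> partial_deriv j \<phi> y \<noteq> 0"
    and L: "0 < L"
    and growth_pd: "\<And>w y. set w \<subseteq> D \<Longrightarrow> length w \<le> r \<Longrightarrow> y \<in> rspace D \<Longrightarrow>
      \<bar>pd w g y\<bar> \<le> L * (\<Prod>i\<in>D. tail (y i) powr (- Bs i)) \<and> \<bar>pd w \<phi> y\<bar> \<le> L * (\<Prod>i\<in>D. tail (y i) powr (- Bs i))"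
    and growth_inv: "\<And>b y. 1 \<le> b \<Longrightarrow> b \<le> 2 * r - 1 \<Longrightarrow> y \<in> rspace D \<Longrightarrow>
      \<bar>1 / partial_deriv j \<phi> y ^ b\<bar> \<le> L * (\<Prod>i\<in>D. tail (y i) powr (- Bs i))"
    and smooth_\<rho>: "Cr_real (r - 1) \<rho>"
    and lim_\<rho>: "\<And>c. c \<le> r - 1 \<Longrightarrow> \<forall>a\<in>{0<..<1}.
        ((\<lambda>x. (deriv ^^ c) \<rho> x / (1 - Phi \<rho> x) powr a) \<longlongrightarrow> 0) at_top \<and>
        ((\<lambda>x. (deriv ^^ c) \<rho> x / (Phi \<rho> x) powr a) \<longlongrightarrow> 0) at_bot"
begin

abbreviation "S \<equiv> D - {j}"
abbreviation "\<phi>j \<equiv> partial_deriv j \<phi>"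

definition growth :: "(nat \<Rightarrow> real) \<Rightarrow> real" where
  "growth y = (\<Prod>i\<in>D. tail (y i) powr (- Bs i))"

text \<open>The part of the growth function that remains once x_j is integrated out or set to
  \<psi>.\<close>

definition sgrowth :: "(nat \<Rightarrow> real) \<Rightarrow> real" where
  "sgrowth x = (\<Prod>i\<in>S. tail (x i) powr (- Bs i))"

lemma growth_upd: "growth (x(j := s)) = sgrowth x * tail s powr (- Bs j)"
proof -
  have "growth (x(j := s)) = tail s powr (- Bs j) * (\<Prod>i\<in>S. tail ((x(j := s)) i) powr (- Bs i))"
    unfolding growth_def by (subst prod.remove[OF D j]) simp
  also have "(\<Prod>i\<in>S. tail ((x(j := s)) i) powr (- Bs i)) = sgrowth x"
    unfolding sgrowth_def by (intro prod.cong) auto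
  finally show ?thesis by (simp only: mult.commute)
qed

lemma tail_powr_ge_1: "0 \<le> b \<Longrightarrow> 1 \<le> tail x powr (- b)"
  using tail_powr_mono[of "-b" 0 x] by simp

lemma sgrowth_ge_1: "1 \<le> sgrowth x"
  unfolding sgrowth_def by (intro prod_ge_1 tail_powr_ge_1) (use Bs in \<open>auto simp: less_imp_le\<close>)

lemma growth_ge_1: "1 \<le> growth x"
  unfolding growth_def by (intro prod_ge_1 tail_powr_ge_1) (use Bs in \<open>auto simp: less_imp_le\<close>)

lemma tendsto_sgrowth:
  assumes "(X \<longlongrightarrow> x) F" shows "((\<lambda>n. sgrowth (X n)) \<longlongrightarrow> sgrowth x) F"
proof -
  have "continuous_on UNIV sgrowth" unfolding sgrowth_def
    by (intro continuous_intros) auto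
  then have "isCont sgrowth x" by (simp add: continuous_on_eq_continuous_at)
  then show ?thesis using assms by (rule isCont_tendsto_compose)
qed

lemma in_D [simp]: "x \<in> rspace S \<Longrightarrow> x(j := s) \<in> rspace D"
  using j by (auto simp: rspace_iff)

lemma tendsto_at_upd:
  assumes "continuous_on (rspace D) F" "x \<in> rspace S" "\<forall>\<^sub>F n in E. X n \<in> rspace S"
    "(X \<longlongrightarrow> x) E" "(a \<longlongrightarrow> s) E"
  shows "((\<lambda>n. F ((X n)(j := a n))) \<longlongrightarrow> F (x(j := s))) E"
  by (rule continuous_on_rspace_tendsto[OF assms(1)])
    (use assms(2-) in \<open>auto intro!: tendsto_intros elim: eventually_mono\<close>)

lemma Cr_pd_g: "set w \<subseteq> D \<Longrightarrow> length w \<le> r \<Longrightarrow> Cr_on D (r - length w) (pd w g)"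
  and Cr_pd_\<phi>: "set w \<subseteq> D \<Longrightarrow> length w \<le> r \<Longrightarrow> Cr_on D (r - length w) (pd w \<phi>)"
  using Cr_on_pd smooth_g smooth_\<phi> by auto

lemmas continuous_pd_g = Cr_on_continuous[OF Cr_pd_g]
lemmas continuous_pd_\<phi> = Cr_on_continuous[OF Cr_pd_\<phi>]

lemma continuous_\<phi>: "continuous_on (rspace D) \<phi>" and continuous_\<phi>j: "continuous_on (rspace D) \<phi>j"
  using continuous_pd_\<phi>[of "[]"] continuous_pd_\<phi>[of "[j]"] j r by auto

lemma deriv_\<phi>: "i \<in> D \<Longrightarrow> y \<in> rspace D \<Longrightarrow>
    ((\<lambda>t. \<phi> (y(i := t))) has_real_derivative partial_deriv i \<phi> (y(i := t))) (at t)"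
  using Cr_on_has_partial[OF smooth_\<phi>] r by auto

section \<open>The sign of D_j \<phi> and the zero \<psi> on each line\<close>

definition \<sigma> :: real where "\<sigma> = (if \<forall>y\<in>rspace D. 0 < \<phi>j y then 1 else -1)"

lemma \<sigma>_cases: obtains "\<sigma> = 1" | "\<sigma> = -1"
  by (cases "\<forall>y\<in>rspace D. 0 < \<phi>j y") (auto simp: \<sigma>_def)

text \<open>The space is convex and D_j \<phi> has no zero: on the segment between two points of
  opposite sign the intermediate value theorem would produce one. So a single \<sigma> serves the
  whole space, and \<sigma> \<phi> increases in x_j everywhere.\<close>

lemma \<sigma>_deriv: assumes "y \<in> rspace D" shows "0 < \<sigma> * \<phi>j y"
proof (cases "\<forall>y\<in>rspace D. 0 < \<phi>j y")
  case False
  then obtain z where z: "z \<in> rspace D" "\<phi>j z < 0" using deriv_j_nz by force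
  have "\<phi>j y < 0"
  proof (rule ccontr)
    assume "\<not> \<phi>j y < 0"
    define c where "c t = (\<lambda>i. if i \<in> D then (1 - t) * z i + t * y i else undefined)" for t :: real
    have c: "c t \<in> rspace D" for t by (simp add: c_def rspace_iff)
    have "isCont (\<lambda>t. \<phi>j (c t)) t" for t
      unfolding isCont_def
    proof (rule continuous_on_rspace_tendsto[OF continuous_\<phi>j])
      show "c \<midarrow>t\<rightarrow> c t" unfolding tendsto_fun_iff c_def by (auto intro!: tendsto_intros)
    qed (auto simp: c)
    moreover have "c 0 = z" "c 1 = y" using z(1) assms by (auto simp: c_def rspace_iff)
    ultimately obtain t where "\<phi>j (c t) = 0"
      using IVT[of "\<lambda>t. \<phi>j (c t)" 0 0 1] z(2) \<open>\<not> \<phi>j y < 0\<close> by force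
    then show False using deriv_j_nz[OF c] by simp
  qed
  then show ?thesis using False by (simp add: \<sigma>_def)
qed (auto simp: \<sigma>_def assms)

lemma \<phi>_strict_mono:
  assumes "x \<in> rspace S" "s < s'" shows "\<sigma> * \<phi> (x(j := s)) < \<sigma> * \<phi> (x(j := s'))"
proof (rule DERIV_pos_imp_increasing[OF assms(2)])
  fix t
  have "((\<lambda>t. \<sigma> * \<phi> (x(j := t))) has_real_derivative \<sigma> * \<phi>j (x(j := t))) (at t)"
    using deriv_\<phi>[OF j in_D[OF assms(1)], of t t] by (intro DERIV_cmult) simp
  then show "\<exists>y. ((\<lambda>t. \<sigma> * \<phi> (x(j := t))) has_real_derivative y) (at t) \<and> 0 < y"
    using \<sigma>_deriv[of "x(j := t)"] assms(1) by auto
qed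

definition U :: "(nat \<Rightarrow> real) set" where "U = {x. \<exists>s. \<phi> (x(j := s)) = 0}"
definition \<psi> :: "(nat \<Rightarrow> real) \<Rightarrow> real" where "\<psi> x = (SOME s. \<phi> (x(j := s)) = 0)"

lemma \<psi>_zero: "x \<in> U \<Longrightarrow> \<phi> (x(j := \<psi> x)) = 0"
  unfolding U_def \<psi>_def mem_Collect_eq by (rule someI_ex)

lemma less_\<psi>_iff:
  assumes "x \<in> rspace S" "x \<in> U"
  shows "\<sigma> * \<phi> (x(j := s)) < 0 \<longleftrightarrow> s < \<psi> x" "0 < \<sigma> * \<phi> (x(j := s)) \<longleftrightarrow> \<psi> x < s"
    "\<phi> (x(j := s)) = 0 \<longleftrightarrow> s = \<psi> x"
proof -
  have z: "\<sigma> * \<phi> (x(j := \<psi> x)) = 0" using \<psi>_zero[OF assms(2)] by simp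
  have nz: "\<sigma> \<noteq> 0" by (simp add: \<sigma>_def)
  have lt: "s < \<psi> x \<Longrightarrow> \<sigma> * \<phi> (x(j := s)) < 0" and gt: "\<psi> x < s \<Longrightarrow> 0 < \<sigma> * \<phi> (x(j := s))"
    using \<phi>_strict_mono[OF assms(1), of s "\<psi> x"] \<phi>_strict_mono[OF assms(1), of "\<psi> x" s] z by auto
  have z': "s = \<psi> x \<Longrightarrow> \<sigma> * \<phi> (x(j := s)) = 0" using z by (simp only:)
  show "\<sigma> * \<phi> (x(j := s)) < 0 \<longleftrightarrow> s < \<psi> x" by (rule sign_change_iff(1)[OF lt gt z'])
  show "0 < \<sigma> * \<phi> (x(j := s)) \<longleftrightarrow> \<psi> x < s" by (rule sign_change_iff(2)[OF lt gt z'])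
  have "\<sigma> * \<phi> (x(j := s)) = 0 \<longleftrightarrow> s = \<psi> x" by (rule sign_change_iff(3)[OF lt gt z'])
  then show "\<phi> (x(j := s)) = 0 \<longleftrightarrow> s = \<psi> x" using nz by simp
qed

lemma U_I:
  assumes "x \<in> rspace S" "\<sigma> * \<phi> (x(j := a)) < 0" "0 < \<sigma> * \<phi> (x(j := b))"
  shows "x \<in> U"
proof -
  have ab: "a \<le> b"
  proof (rule ccontr)
    assume "\<not> a \<le> b"
    then have "\<sigma> * \<phi> (x(j := b)) < \<sigma> * \<phi> (x(j := a))" by (intro \<phi>_strict_mono assms(1)) simp
    then show False using assms(2,3) by (meson less_trans less_irrefl)
  qed
  have "isCont (\<lambda>s. \<sigma> * \<phi> (x(j := s))) s" for s
    using continuous_on_rspace_line[OF continuous_\<phi> in_D[OF assms(1), of s] j, of s]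
    by (intro continuous_mult continuous_const) simp
  then have "\<exists>s\<ge>a. s \<le> b \<and> \<sigma> * \<phi> (x(j := s)) = 0"
    by (intro IVT[OF less_imp_le[OF assms(2)] less_imp_le[OF assms(3)] ab] allI impI)
  then obtain s where "\<sigma> * \<phi> (x(j := s)) = 0" by blast
  moreover have "\<sigma> \<noteq> 0" by (simp add: \<sigma>_def)
  ultimately have "\<phi> (x(j := s)) = 0" by simp
  then show ?thesis unfolding U_def by blast
qed

context
  fixes X :: "'n \<Rightarrow> nat \<Rightarrow> real" and x :: "nat \<Rightarrow> real" and E :: "'n filter"
  assumes x: "x \<in> rspace S" and X: "\<forall>\<^sub>F n in E. X n \<in> rspace S" "(X \<longlongrightarrow> x) E"
begin

text \<open>The filter is arbitrary because these facts are applied along coordinate lines, both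
  with and without the limit point, and within \<open>rspace S\<close>.\<close>

lemma eventually_\<phi>_sign:
  "\<sigma> * \<phi> (x(j := s)) < 0 \<Longrightarrow> \<forall>\<^sub>F n in E. \<sigma> * \<phi> ((X n)(j := s)) < 0"
  "0 < \<sigma> * \<phi> (x(j := s)) \<Longrightarrow> \<forall>\<^sub>F n in E. 0 < \<sigma> * \<phi> ((X n)(j := s))"
proof -
  have "((\<lambda>n. \<sigma> * \<phi> ((X n)(j := s))) \<longlongrightarrow> \<sigma> * \<phi> (x(j := s))) E"
    by (intro tendsto_mult_left tendsto_at_upd[OF continuous_\<phi> x X] tendsto_const)
  from order_tendstoD[OF this]
  show "\<sigma> * \<phi> (x(j := s)) < 0 \<Longrightarrow> \<forall>\<^sub>F n in E. \<sigma> * \<phi> ((X n)(j := s)) < 0"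
    "0 < \<sigma> * \<phi> (x(j := s)) \<Longrightarrow> \<forall>\<^sub>F n in E. 0 < \<sigma> * \<phi> ((X n)(j := s))" by auto
qed

text \<open>The strict signs of \<phi> at \<open>\<psi> x - e\<close> and
  \<open>\<psi> x + e\<close> persist nearby and bracket a zero there. This gives at once that
  \<open>U\<close> is relatively open and that \<psi> is continuous on it.\<close>

lemma
  assumes U: "x \<in> U"
  shows eventually_U: "\<forall>\<^sub>F n in E. X n \<in> U" and tendsto_\<psi>: "((\<lambda>n. \<psi> (X n)) \<longlongrightarrow> \<psi> x) E"
proof -
  have *: "\<forall>\<^sub>F n in E. X n \<in> U \<and> \<bar>\<psi> (X n) - \<psi> x\<bar> < e" if "0 < e" for e
  proof -
    have "\<sigma> * \<phi> (x(j := \<psi> x - e)) < 0" "0 < \<sigma> * \<phi> (x(j := \<psi> x + e))"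
      using less_\<psi>_iff[OF x U] that by auto
    from eventually_\<phi>_sign(1)[OF this(1)] eventually_\<phi>_sign(2)[OF this(2)] X(1)
    show ?thesis
    proof eventually_elim
      case (elim n)
      then have "X n \<in> U" by (intro U_I) auto
      moreover have "\<psi> x - e < \<psi> (X n)" "\<psi> (X n) < \<psi> x + e"
        using less_\<psi>_iff(1,2)[OF elim(3) calculation] elim(1,2) by blast+
      ultimately show ?case by (auto simp: abs_less_iff)
    qed
  qed
  show "\<forall>\<^sub>F n in E. X n \<in> U" using *[of 1] by (auto elim: eventually_mono)
  show "((\<lambda>n. \<psi> (X n)) \<longlongrightarrow> \<psi> x) E"
    unfolding tendsto_iff dist_real_def using * by (blast intro: eventually_mono)
qed

text \<open>Off \<open>U\<close> the sign of \<sigma> \<phi> is constant on the line over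
  \<open>x\<close>. If it is negative at \<open>a\<close>, it stays so nearby and any zero lies
  above \<open>a\<close>; if it is positive at \<open>b\<close>, any zero lies below
  \<open>b\<close>. Failure of both would bracket a zero over \<open>x\<close>.\<close>

lemma eventually_\<psi>_large:
  assumes U: "x \<notin> U"
  shows "\<forall>\<^sub>F n in E. X n \<in> U \<longrightarrow> a < \<psi> (X n) \<or> \<psi> (X n) < b"
proof -
  have "\<sigma> \<noteq> 0" by (simp add: \<sigma>_def)
  then have nz: "\<sigma> * \<phi> (x(j := s)) \<noteq> 0" for s using U by (auto simp: U_def)
  consider "\<sigma> * \<phi> (x(j := a)) < 0" | "0 < \<sigma> * \<phi> (x(j := b))"
    using U_I[OF x, of b a] U nz[of a] nz[of b] unfolding neq_iff by blast
  then show ?thesis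
  proof cases
    case 1
    from eventually_\<phi>_sign(1)[OF this] X(1) show ?thesis
      by eventually_elim (blast dest: less_\<psi>_iff(1)[THEN iffD1, rotated 2])
  next
    case 2
    from eventually_\<phi>_sign(2)[OF this] X(1) show ?thesis
      by eventually_elim (blast dest: less_\<psi>_iff(2)[THEN iffD1, rotated 2])
  qed
qed

text \<open>To which end \<psi> escapes depends on the sign of \<phi> over \<open>x\<close>, so
  \<eta> has to vanish at both.\<close>

lemma tendsto_escape:
  assumes U: "x \<notin> U" and \<eta>: "(\<eta> \<longlongrightarrow> 0) at_top" "(\<eta> \<longlongrightarrow> 0) at_bot"
  shows "((\<lambda>n. if X n \<in> U then \<eta> (\<psi> (X n)) else 0) \<longlongrightarrow> (0::real)) E"
proof (rule tendstoI)
  fix e :: real assume e: "0 < e"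
  obtain a b where "\<forall>s\<ge>a. \<bar>\<eta> s\<bar> < e" "\<forall>s\<le>b. \<bar>\<eta> s\<bar> < e"
    using tendstoD[OF \<eta>(1) e] tendstoD[OF \<eta>(2) e]
    unfolding eventually_at_top_linorder eventually_at_bot_linorder by auto
  with eventually_\<psi>_large[OF U, of a b] e
  show "\<forall>\<^sub>F n in E. dist (if X n \<in> U then \<eta> (\<psi> (X n)) else 0) 0 < e"
    by (auto simp: less_imp_le elim!: eventually_mono)
qed

end

end

subsection \<open>Boundary terms\<close>

lemma bounded_if_tendsto_zero:
  fixes \<eta> :: "real \<Rightarrow> real"
  assumes "continuous_on UNIV \<eta>" "(\<eta> \<longlongrightarrow> 0) at_top" "(\<eta> \<longlongrightarrow> 0) at_bot"
  obtains K where "0 \<le> K" "\<And>s. \<bar>\<eta> s\<bar> \<le> K"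
proof -
  obtain a b where ab: "\<forall>s\<ge>a. \<bar>\<eta> s\<bar> < 1" "\<forall>s\<le>b. \<bar>\<eta> s\<bar> < 1"
    using tendstoD[OF assms(2), of 1] tendstoD[OF assms(3), of 1]
    unfolding eventually_at_top_linorder eventually_at_bot_linorder by auto
  have "compact (\<eta> ` {b..a})"
    by (rule compact_continuous_image[OF continuous_on_subset[OF assms(1)]]) auto
  then have "bounded (\<eta> ` {b..a})" by (rule compact_imp_bounded)
  then obtain K where K: "\<forall>s\<in>{b..a}. \<bar>\<eta> s\<bar> \<le> K" unfolding bounded_iff by auto
  show ?thesis
  proof (rule that[of "max 1 K"])
    show "\<bar>\<eta> s\<bar> \<le> max 1 K" for s
      using ab K by (cases "a \<le> s"; cases "s \<le> b") (auto simp: le_max_iff_disj intro: less_imp_le)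
  qed auto
qed

context preintegration
begin

text \<open>Numerators of the boundary terms; \<open>k\<close> bounds the orders of differentiation and \<open>q\<close> the
  number of factors that are derivatives of \<open>\<phi>\<close>.\<close>

inductive num :: "nat \<Rightarrow> nat \<Rightarrow> ((nat \<Rightarrow> real) \<Rightarrow> real) \<Rightarrow> bool" where
  num_base: "length w \<le> k \<Longrightarrow> c \<le> k \<Longrightarrow> set w \<subseteq> D \<Longrightarrow> num k q (\<lambda>y. pd w g y * (deriv ^^ c) \<rho> (y j))"
| num_mult: "num k q F \<Longrightarrow> length w \<le> Suc k \<Longrightarrow> set w \<subseteq> D \<Longrightarrow> num k (Suc q) (\<lambda>y. F y * pd w \<phi> y)"
| num_add: "num k q F \<Longrightarrow> num k q F' \<Longrightarrow> num k q (\<lambda>y. F y + F' y)"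
| num_cmult: "num k q F \<Longrightarrow> num k q (\<lambda>y. c * F y)"

lemma num_Suc_order: "num k q F \<Longrightarrow> num (Suc k) q F"
  by (induction rule: num.induct) (auto intro: num.intros)

lemma num_mult_pow:
  assumes "num k q F" "length w \<le> Suc k" "set w \<subseteq> D" shows "num k (q + n) (\<lambda>y. F y * pd w \<phi> y ^ n)"
proof (induction n)
  case (Suc n)
  from num_mult[OF this assms(2,3)] show ?case by (simp add: ac_simps)
qed (simp add: assms)

lemma rho_derivative:
  assumes "c < r - 1" shows "((deriv ^^ c) \<rho> has_real_derivative (deriv ^^ Suc c) \<rho> s) (at s)"
  using smooth_\<rho> assms by (simp add: Cr_real_def field_differentiable_derivI)

lemma continuous_rho_deriv: "c \<le> r - 1 \<Longrightarrow> continuous_on UNIV ((deriv ^^ c) \<rho>)"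
  using smooth_\<rho> by (simp add: Cr_real_def)

lemma num_continuous: "num k q F \<Longrightarrow> k < r \<Longrightarrow> continuous_on (rspace D) F"
proof (induction rule: num.induct)
  case (num_base w k c q)
  have "continuous_on (rspace D) (\<lambda>y. (deriv ^^ c) \<rho> (y j))"
    by (rule continuous_on_compose2[OF continuous_rho_deriv])
      (use num_base in \<open>auto intro: continuous_on_product_then_coordinatewise\<close>)
  then show ?case using num_base by (intro continuous_intros continuous_pd_g) auto
qed (auto intro!: continuous_intros continuous_pd_\<phi>)

lemma pd_derivative:
  assumes "Cr_on D r h" "set w \<subseteq> D" "length w < r" "i \<in> D" "y \<in> rspace D"
  shows "((\<lambda>t. pd w h (y(i := t))) has_real_derivative pd (i # w) h (y(i := t))) (at t)"
  using Cr_on_has_partial[OF Cr_on_pd[OF assms(1,2)], of i y t] assms(3-5) by simp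

text \<open>The product rule raises the orders by one and keeps the number \<open>q\<close> of
  factors. The strict bound \<open>Suc k < r\<close> leaves room to differentiate once more the
  derivatives of \<phi> of order \<open>Suc k\<close> and of \<rho> of order \<open>k\<close>. The
  density depends on the coordinate \<open>j\<close> alone, hence the \<open>of_bool (i = j)\<close>
  in the base case.\<close>

lemma num_derivative:
  assumes "num k q F" "Suc k < r" "i \<in> D"
  shows "\<exists>F'. num (Suc k) q F' \<and>
    (\<forall>y\<in>rspace D. \<forall>t. ((\<lambda>t. F (y(i := t))) has_real_derivative F' (y(i := t))) (at t))"
  using assms
proof (induction rule: num.induct)
  case (num_base w k c q)
  define F' where "F' = (\<lambda>y. pd (i # w) g y * (deriv ^^ c) \<rho> (y j)
      + of_bool (i = j) * (pd w g y * (deriv ^^ Suc c) \<rho> (y j)))"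
  have "num (Suc k) q F'" unfolding F'_def
    by (intro num_add num_cmult num.num_base) (use num_base in auto)
  moreover have "((\<lambda>t. pd w g (y(i := t)) * (deriv ^^ c) \<rho> ((y(i := t)) j)) has_real_derivative
      F' (y(i := t))) (at t)" if "y \<in> rspace D" for y t
  proof -
    have g': "((\<lambda>t. pd w g (y(i := t))) has_real_derivative pd (i # w) g (y(i := t))) (at t)"
      by (rule pd_derivative[OF smooth_g]) (use num_base that in auto)
    have r': "((\<lambda>t. (deriv ^^ c) \<rho> ((y(i := t)) j)) has_real_derivative
        of_bool (i = j) * (deriv ^^ Suc c) \<rho> ((y(i := t)) j)) (at t)"
      using rho_derivative[of c t] num_base by (cases "i = j") auto
    from DERIV_mult[OF g' r'] show ?thesis by (simp add: F'_def algebra_simps)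
  qed
  ultimately show ?case by blast
next
  case (num_mult k q F w)
  then obtain F' where F': "num (Suc k) q F'"
    "\<forall>y\<in>rspace D. \<forall>t. ((\<lambda>t. F (y(i := t))) has_real_derivative F' (y(i := t))) (at t)" by blast
  have "num (Suc k) (Suc q) (\<lambda>y. F' y * pd w \<phi> y + F y * pd (i # w) \<phi> y)"
    by (intro num_add num.num_mult F' num_Suc_order num_mult.hyps) (use num_mult in auto)
  moreover have "((\<lambda>t. F (y(i := t)) * pd w \<phi> (y(i := t))) has_real_derivative
      F' (y(i := t)) * pd w \<phi> (y(i := t)) + F (y(i := t)) * pd (i # w) \<phi> (y(i := t))) (at t)"
    if "y \<in> rspace D" for y t
  proof -
    have "((\<lambda>t. pd w \<phi> (y(i := t))) has_real_derivative pd (i # w) \<phi> (y(i := t))) (at t)"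
      by (rule pd_derivative[OF smooth_\<phi>]) (use num_mult that in auto)
    from DERIV_mult[OF F'(2)[rule_format, OF that] this] show ?thesis by (simp add: algebra_simps)
  qed
  ultimately show ?case by (intro exI conjI ballI allI) assumption+
next
  case (num_add k q F1 F2)
  then obtain F1' F2' where "num (Suc k) q F1'"
    "\<forall>y\<in>rspace D. \<forall>t. ((\<lambda>t. F1 (y(i := t))) has_real_derivative F1' (y(i := t))) (at t)"
    "num (Suc k) q F2'"
    "\<forall>y\<in>rspace D. \<forall>t. ((\<lambda>t. F2 (y(i := t))) has_real_derivative F2' (y(i := t))) (at t)" by blast
  then show ?case by (intro exI[of _ "\<lambda>y. F1' y + F2' y"] conjI num.num_add ballI allI DERIV_add) blast+
next
  case (num_cmult k q F c)
  then obtain F' where "num (Suc k) q F'"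
    "\<forall>y\<in>rspace D. \<forall>t. ((\<lambda>t. F (y(i := t))) has_real_derivative F' (y(i := t))) (at t)" by blast
  then show ?case by (intro exI[of _ "\<lambda>y. c * F' y"] conjI num.num_cmult ballI allI DERIV_cmult) blast+
qed

definition rho_sum :: "nat \<Rightarrow> real \<Rightarrow> real" where
  "rho_sum k s = (\<Sum>c\<le>k. \<bar>(deriv ^^ c) \<rho> s\<bar>)"

lemma rho_sum_nonneg [simp]: "0 \<le> rho_sum k s"
  by (simp add: rho_sum_def sum_nonneg)

lemma growth_nonneg [simp]: "0 \<le> growth y"
  using growth_ge_1[of y] by linarith

text \<open>One power of the growth function for the derivative of g and one for each derivative of
  \<phi>. Since \<open>q\<close> is only an upper bound in the base case, the missing powers are
  filled up by \<open>growth_ge_1\<close>.\<close>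

lemma num_bound:
  assumes "num k q F" "k < r"
  shows "\<exists>C\<ge>0. \<forall>y\<in>rspace D. \<bar>F y\<bar> \<le> C * (growth y ^ Suc q * rho_sum k (y j))"
  using assms
proof (induction rule: num.induct)
  case (num_base w k c q)
  have "\<bar>pd w g y * (deriv ^^ c) \<rho> (y j)\<bar> \<le> L * (growth y ^ Suc q * rho_sum k (y j))"
    if "y \<in> rspace D" for y
  proof -
    have "\<bar>pd w g y\<bar> \<le> L * growth y"
      using growth_pd[of w y] num_base that by (simp add: growth_def)
    also have "\<dots> \<le> L * growth y ^ Suc q"
      using L growth_ge_1[of y] power_increasing[of 1 "Suc q" "growth y"] by (intro mult_left_mono) auto
    finally have 1: "\<bar>pd w g y\<bar> \<le> L * growth y ^ Suc q" .
    have 2: "\<bar>(deriv ^^ c) \<rho> (y j)\<bar> \<le> rho_sum k (y j)"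
      unfolding rho_sum_def by (rule member_le_sum) (use num_base in auto)
    from mult_mono[OF 1 2] L show ?thesis by (simp add: abs_mult mult.assoc)
  qed
  then show ?case using L by (intro exI[of _ L]) auto
next
  case (num_mult k q F w)
  then obtain C where C: "C \<ge> 0" "\<forall>y\<in>rspace D. \<bar>F y\<bar> \<le> C * (growth y ^ Suc q * rho_sum k (y j))" by auto
  have "\<bar>F y * pd w \<phi> y\<bar> \<le> C * L * (growth y ^ Suc (Suc q) * rho_sum k (y j))" if "y \<in> rspace D" for y
  proof -
    have 2: "\<bar>pd w \<phi> y\<bar> \<le> L * growth y"
      using growth_pd[of w y] num_mult that by (simp add: growth_def)
    from mult_mono[OF C(2)[rule_format, OF that] 2] C(1) show ?thesis by (simp add: abs_mult ac_simps)
  qed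
  then show ?case using L C(1) by (intro exI[of _ "C * L"]) auto
next
  case (num_add k q F1 F2)
  then obtain C1 C2 where C: "C1 \<ge> 0" "\<forall>y\<in>rspace D. \<bar>F1 y\<bar> \<le> C1 * (growth y ^ Suc q * rho_sum k (y j))"
    "C2 \<ge> 0" "\<forall>y\<in>rspace D. \<bar>F2 y\<bar> \<le> C2 * (growth y ^ Suc q * rho_sum k (y j))" by blast
  then show ?case
    by (intro exI[of _ "C1 + C2"]) (auto simp: distrib_right intro!: order_trans[OF abs_triangle_ineq] add_mono)
next
  case (num_cmult k q F c)
  then obtain C where C: "C \<ge> 0" "\<forall>y\<in>rspace D. \<bar>F y\<bar> \<le> C * (growth y ^ Suc q * rho_sum k (y j))" by blast
  then show ?case
    by (intro exI[of _ "\<bar>c\<bar> * C"]) (auto simp: abs_mult mult.assoc intro!: mult_left_mono)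
qed

text \<open>One denominator suffices for each order: differentiation along the zero set, that is
  \<open>D\<^sub>i - (D\<^sub>i \<phi> / D\<^sub>j \<phi>) D\<^sub>j\<close>, raises its exponent by 2 and adds two factors to the numerator.\<close>

fun bdry :: "nat \<Rightarrow> ((nat \<Rightarrow> real) \<Rightarrow> real) \<Rightarrow> bool" where
  "bdry 0 F \<longleftrightarrow> F = (\<lambda>_. 0)"
| "bdry (Suc k) F \<longleftrightarrow> (\<exists>A. num k (2 * k + 1) A \<and> F = (\<lambda>y. A y / \<phi>j y ^ (2 * k + 1)))"

lemma bdry_add: "bdry m F \<Longrightarrow> bdry m F' \<Longrightarrow> bdry m (\<lambda>y. F y + F' y)"
proof (cases m)
  case (Suc k)
  assume "bdry m F" "bdry m F'"
  then obtain A A' where "num k (2 * k + 1) A" "F = (\<lambda>y. A y / \<phi>j y ^ (2 * k + 1))"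
    "num k (2 * k + 1) A'" "F' = (\<lambda>y. A' y / \<phi>j y ^ (2 * k + 1))" unfolding Suc by auto
  then show ?thesis unfolding Suc bdry.simps
    by (intro exI[of _ "\<lambda>y. A y + A' y"] conjI num_add) (auto simp: add_divide_distrib)
qed auto

lemma bdry_continuous:
  assumes "bdry m F" "m \<le> r" shows "continuous_on (rspace D) F"
proof (cases m)
  case (Suc k)
  then obtain A where A: "num k (2 * k + 1) A" "F = (\<lambda>y. A y / \<phi>j y ^ (2 * k + 1))" using assms by auto
  have "continuous_on (rspace D) A" by (rule num_continuous[OF A(1)]) (use assms Suc in simp)
  then show ?thesis unfolding A(2) by (intro continuous_intros continuous_\<phi>j) (auto simp: deriv_j_nz)
qed (use assms in auto)

text \<open>Origin of the constant 2r+1: for \<open>m = Suc k\<close> the numerator contributes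
  \<open>2 * k + 2 = 2 * m\<close> powers, and the whole reciprocal
  \<open>1 / \<phi>j y ^ (2 * k + 1)\<close> just one more by (A2), whose range of exponents ends at
  \<open>2 * r - 1\<close>.\<close>

lemma bdry_bound:
  assumes "bdry m F" "m \<le> r"
  shows "\<exists>C\<ge>0. \<forall>y\<in>rspace D. \<bar>F y\<bar> \<le> C * (growth y ^ (2 * m + 1) * rho_sum (m - 1) (y j))"
proof (cases m)
  case (Suc k)
  then obtain A where A: "num k (2 * k + 1) A" "F = (\<lambda>y. A y / \<phi>j y ^ (2 * k + 1))" using assms by auto
  from num_bound[OF A(1)] Suc assms obtain C where C: "C \<ge> 0"
    "\<forall>y\<in>rspace D. \<bar>A y\<bar> \<le> C * (growth y ^ Suc (2 * k + 1) * rho_sum k (y j))" by auto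
  have "\<bar>F y\<bar> \<le> C * L * (growth y ^ (2 * m + 1) * rho_sum (m - 1) (y j))" if y: "y \<in> rspace D" for y
  proof -
    have 2: "\<bar>1 / \<phi>j y ^ (2 * k + 1)\<bar> \<le> L * growth y"
      using growth_inv[of "2 * k + 1" y] Suc assms y by (simp add: growth_def)
    have "\<bar>F y\<bar> = \<bar>A y\<bar> * \<bar>1 / \<phi>j y ^ (2 * k + 1)\<bar>" by (simp add: A(2) abs_mult[symmetric])
    also have "\<dots> \<le> (C * (growth y ^ Suc (2 * k + 1) * rho_sum k (y j))) * (L * growth y)"
      by (rule mult_mono[OF C(2)[rule_format, OF y] 2]) (use C(1) in auto)
    finally show ?thesis by (simp add: Suc ac_simps)
  qed
  then show ?thesis using C(1) L by (intro exI[of _ "C * L"]) auto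
qed (use assms in \<open>auto intro: exI[of _ 0]\<close>)

lemma bdry_zero: "bdry m (\<lambda>_. 0)"
proof (cases m)
  case (Suc k)
  have "num k (2 * k + 1) (\<lambda>y. 0 * (pd [] g y * (deriv ^^ 0) \<rho> (y j)))"
    by (intro num_cmult num_base) auto
  then show ?thesis unfolding Suc bdry.simps by (intro exI[of _ "\<lambda>_. 0"]) simp
qed simp

section \<open>Differentiation along the zero set\<close>

lemma line_tendsto: "((\<lambda>t. x(i := t)) \<longlongrightarrow> x(i := t0)) (nhds t0)"
  "((\<lambda>t. x(i := t)) \<longlongrightarrow> x(i := t0)) (at t0)" for x :: "nat \<Rightarrow> real"
  by (auto intro!: tendsto_intros filterlim_ident)

lemma isCont_\<psi>_line:
  assumes "x \<in> rspace S" "i \<in> S" "x(i := t) \<in> U"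
  shows "isCont (\<lambda>t. \<psi> (x(i := t))) t"
  unfolding isCont_def
  by (rule tendsto_\<psi>[OF _ _ line_tendsto(2)]) (use assms in auto)

lemma eventually_U_line:
  assumes "x \<in> rspace S" "i \<in> S" "x(i := t) \<in> U"
  shows "\<forall>\<^sub>F t in nhds t. x(i := t) \<in> U"
  by (rule eventually_U[OF _ _ line_tendsto(1)]) (use assms in auto)

lemma isCont_plane:
  assumes "continuous_on (rspace D) F" "x \<in> rspace S" "i \<in> S"
  shows "isCont (\<lambda>z. F (x(i := fst z, j := snd z))) z0"
  unfolding isCont_def
  by (rule tendsto_at_upd[OF assms(1)]) (use assms(2-) in \<open>auto intro!: tendsto_intros\<close>)

lemma derivative_plane:
  assumes "\<forall>y\<in>rspace D. \<forall>t. ((\<lambda>t. F (y(i := t))) has_real_derivative F' (y(i := t))) (at t)"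
    "x \<in> rspace S" "i \<in> S"
  shows "((\<lambda>t. F (x(i := t, j := s))) has_real_derivative F' (x(i := t, j := s))) (at t)"
  using assms(1)[rule_format, OF in_D[OF assms(2)], of s t] assms(3) by (simp add: fun_upd_twist)

lemma \<psi>_derivative:
  assumes "x \<in> rspace S" "x \<in> U" "i \<in> S"
  shows "((\<lambda>t. \<psi> (x(i := t))) has_real_derivative
    - partial_deriv i \<phi> (x(j := \<psi> x)) / \<phi>j (x(j := \<psi> x))) (at (x i))"
proof -
  have i: "i \<in> D" using assms(3) by simp
  have c: "continuous_on (rspace D) (partial_deriv i \<phi>)" using continuous_pd_\<phi>[of "[i]"] i r by simp
  have "((\<lambda>t. \<psi> (x(i := t))) has_real_derivative
    - partial_deriv i \<phi> (x(i := x i, j := \<psi> (x(i := x i)))) / \<phi>j (x(j := \<psi> x))) (at (x i))"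
  proof (rule implicit_derivative[where F="\<lambda>t s. \<phi> (x(i := t, j := s))"])
    show "((\<lambda>t. \<phi> (x(i := t, j := s))) has_real_derivative partial_deriv i \<phi> (x(i := t, j := s))) (at t)" for t s
      by (rule derivative_plane[OF _ assms(1,3)]) (use deriv_\<phi>[OF i] in blast)
    show "isCont (\<lambda>z. partial_deriv i \<phi> (x(i := fst z, j := snd z))) (x i, \<psi> (x(i := x i)))"
      by (rule isCont_plane[OF c assms(1,3)])
    show "((\<lambda>s. \<phi> (x(i := x i, j := s))) has_real_derivative \<phi>j (x(j := \<psi> x))) (at (\<psi> (x(i := x i))))"
      using deriv_\<phi>[OF j in_D[OF assms(1)], of 0 "\<psi> x"] by simp
    show "isCont (\<lambda>t. \<psi> (x(i := t))) (x i)"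
      by (rule isCont_\<psi>_line) (use assms in auto)
    show "\<forall>\<^sub>F t in nhds (x i). \<phi> (x(i := t, j := \<psi> (x(i := t)))) = 0"
      by (rule eventually_mono[OF eventually_U_line \<psi>_zero]) (use assms in auto)
    show "\<phi>j (x(j := \<psi> x)) \<noteq> 0" by (rule deriv_j_nz) (use assms in simp)
  qed
  then show ?thesis by simp
qed

lemma derivative_along_\<psi>:
  assumes x: "x \<in> rspace S" "x \<in> U" "i \<in> S"
    and Fi: "\<forall>y\<in>rspace D. \<forall>t. ((\<lambda>t. F (y(i := t))) has_real_derivative Fi (y(i := t))) (at t)"
    and Fj: "\<forall>y\<in>rspace D. \<forall>t. ((\<lambda>t. F (y(j := t))) has_real_derivative Fj (y(j := t))) (at t)"
    and cont: "continuous_on (rspace D) Fi"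
  defines "y \<equiv> x(j := \<psi> x)"
  shows "((\<lambda>t. F (x(i := t, j := \<psi> (x(i := t))))) has_real_derivative
    Fi y + Fj y * (- partial_deriv i \<phi> y / \<phi>j y)) (at (x i))"
proof -
  have "((\<lambda>t. F (x(i := t, j := \<psi> (x(i := t))))) has_real_derivative
    Fi (x(i := x i, j := \<psi> (x(i := x i)))) + Fj y * (- partial_deriv i \<phi> y / \<phi>j y)) (at (x i))"
  proof (rule has_derivative_along_curve[where F="\<lambda>t s. F (x(i := t, j := s))"])
    show "((\<lambda>t. F (x(i := t, j := s))) has_real_derivative Fi (x(i := t, j := s))) (at t)" for t s
      by (rule derivative_plane[OF Fi x(1,3)])
    show "isCont (\<lambda>z. Fi (x(i := fst z, j := snd z))) (x i, \<psi> (x(i := x i)))"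
      by (rule isCont_plane[OF cont x(1,3)])
    show "((\<lambda>s. F (x(i := x i, j := s))) has_real_derivative Fj y) (at (\<psi> (x(i := x i))))"
      using Fj[rule_format, OF in_D[OF x(1)], of 0 "\<psi> x"] by (simp add: y_def)
    show "((\<lambda>t. \<psi> (x(i := t))) has_real_derivative - partial_deriv i \<phi> y / \<phi>j y) (at (x i))"
      unfolding y_def by (rule \<psi>_derivative[OF x])
  qed
  then show ?thesis by (simp add: y_def)
qed

lemma bdry_derivative:
  assumes "bdry m F" "m < r" "i \<in> S"
  shows "\<exists>F'. bdry (Suc m) F' \<and> (\<forall>x\<in>rspace S. x \<in> U \<longrightarrow>
    ((\<lambda>t. F (x(i := t, j := \<psi> (x(i := t))))) has_real_derivative F' (x(j := \<psi> x))) (at (x i)))"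
proof (cases m)
  case 0
  then show ?thesis using assms(1) by (intro exI[of _ "\<lambda>_. 0"] conjI bdry_zero) simp_all
next
  case (Suc k)
  define b where "b = 2 * k + 1"
  obtain A where A: "num k b A" "F = (\<lambda>y. A y / \<phi>j y ^ b)" using assms Suc by (auto simp: b_def)
  have i: "i \<in> D" and k: "Suc k < r" using assms(2,3) Suc by auto
  have "\<exists>A'. num (Suc k) b A' \<and> (\<forall>y\<in>rspace D. \<forall>t. ((\<lambda>t. A (y(i := t))) has_real_derivative A' (y(i := t))) (at t))"
    if "i \<in> D" for i using num_derivative[OF A(1) k that] .
  then obtain A' where A': "\<And>i. i \<in> D \<Longrightarrow> num (Suc k) b (A' i)"
    "\<And>i. i \<in> D \<Longrightarrow> \<forall>y\<in>rspace D. \<forall>t. ((\<lambda>t. A (y(i := t))) has_real_derivative A' i (y(i := t))) (at t)" by metis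
  define F' where "F' = (\<lambda>i y. (A' i y * \<phi>j y - real b * A y * pd [i, j] \<phi> y) / \<phi>j y ^ (b + 1))"
  have F': "\<forall>y\<in>rspace D. \<forall>t. ((\<lambda>t. F (y(i := t))) has_real_derivative F' i (y(i := t))) (at t)"
    if i: "i \<in> D" for i
  proof (intro ballI allI)
    fix y t assume y: "y \<in> rspace D"
    have nz: "\<phi>j (y(i := t)) \<noteq> 0" using y i by (intro deriv_j_nz) simp
    have "((\<lambda>t. \<phi>j (y(i := t))) has_real_derivative pd [i, j] \<phi> (y(i := t))) (at t)"
      using pd_derivative[OF smooth_\<phi>, of "[j]" i y t] i j y k by simp
    from DERIV_power[OF this, of b] have "((\<lambda>t. \<phi>j (y(i := t)) ^ b) has_real_derivative
      real b * (pd [i, j] \<phi> (y(i := t)) * \<phi>j (y(i := t)) ^ (2 * k))) (at t)" by (simp add: b_def)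
    from DERIV_divide[OF A'(2)[OF i, rule_format, OF y] this] nz
    have d: "((\<lambda>t. F (y(i := t))) has_real_derivative (A' i (y(i := t)) * \<phi>j (y(i := t)) ^ b -
       A (y(i := t)) * (real b * (pd [i, j] \<phi> (y(i := t)) * \<phi>j (y(i := t)) ^ (2 * k)))) /
       (\<phi>j (y(i := t)) ^ b * \<phi>j (y(i := t)) ^ b)) (at t)" by (simp add: A(2))
    \<comment> \<open>Since \<open>b = 2 * k + 1\<close>, the common factor
      \<open>p ^ (2 * k)\<close> cancels, and a plain partial derivative has the denominator
      exponent \<open>b + 1\<close> instead of \<open>2 * b\<close>.\<close>
    have alg: "(a' * p ^ b - a * (real b * (q * p ^ (2 * k)))) / (p ^ b * p ^ b)
      = (a' * p - real b * a * q) / p ^ (b + 1)" if "p \<noteq> 0" for p q a a' :: real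
    proof -
      have "(a' * p ^ b - a * (real b * (q * p ^ (2 * k)))) / (p ^ b * p ^ b)
        = ((a' * p - real b * a * q) * p ^ (2 * k)) / (p ^ (b + 1) * p ^ (2 * k))"
        by (simp add: b_def algebra_simps power_add)
      then show ?thesis using that by simp
    qed
    show "((\<lambda>t. F (y(i := t))) has_real_derivative F' i (y(i := t))) (at t)"
      using d unfolding F'_def alg[OF nz] .
  qed
  have contF': "continuous_on (rspace D) (F' i)"
  proof -
    have "continuous_on (rspace D) (A' i)" "continuous_on (rspace D) A" "continuous_on (rspace D) (pd [i, j] \<phi>)"
      using num_continuous[OF A'(1)[OF i]] num_continuous[OF A(1)] continuous_pd_\<phi>[of "[i, j]"] k i j
      by simp_all
    then show ?thesis unfolding F'_def by (intro continuous_intros continuous_\<phi>j) (auto simp: deriv_j_nz)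
  qed
  \<comment> \<open>Numerator of D_i F - (D_i \<phi> / D_j \<phi>) D_j F over the common denominator
    \<open>\<phi>j ^ (b + 2)\<close>. Each summand carries exactly two derivatives of \<phi> besides
    \<open>A\<close> or a derivative of \<open>A\<close>, and \<open>b + 2 = 2 * Suc k + 1\<close>,
    so the shape of \<open>bdry\<close> is reproduced.\<close>
  define N where "N = (\<lambda>y. A' i y * pd [j] \<phi> y ^ 2
    + ((- real b) * (A y * pd [j] \<phi> y * pd [i, j] \<phi> y)
    + ((- 1) * (A' j y * pd [i] \<phi> y * pd [j] \<phi> y) + real b * (A y * pd [i] \<phi> y * pd [j, j] \<phi> y))))"
  have "num (Suc k) (b + 2) N" unfolding N_def
  proof (intro num_add num_cmult)
    have Ak: "num (Suc k) b A" by (rule num_Suc_order[OF A(1)])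
    show "num (Suc k) (b + 2) (\<lambda>y. A' i y * pd [j] \<phi> y ^ 2)"
      by (rule num_mult_pow[OF A'(1)[OF i]]) (use j in auto)
    show "num (Suc k) (b + 2) (\<lambda>y. A y * pd [j] \<phi> y * pd [i, j] \<phi> y)"
      using num_mult[OF num_mult[OF Ak, of "[j]"], of "[i, j]"] i j by simp
    show "num (Suc k) (b + 2) (\<lambda>y. A' j y * pd [i] \<phi> y * pd [j] \<phi> y)"
      using num_mult[OF num_mult[OF A'(1)[OF j], of "[i]"], of "[j]"] i j by simp
    show "num (Suc k) (b + 2) (\<lambda>y. A y * pd [i] \<phi> y * pd [j, j] \<phi> y)"
      using num_mult[OF num_mult[OF Ak, of "[i]"], of "[j, j]"] i j by simp
  qed
  then have "bdry (Suc m) (\<lambda>y. N y / \<phi>j y ^ (b + 2))"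
    unfolding Suc bdry.simps by (intro exI[of _ N]) (simp add: b_def)
  moreover have "((\<lambda>t. F (x(i := t, j := \<psi> (x(i := t))))) has_real_derivative
      N (x(j := \<psi> x)) / \<phi>j (x(j := \<psi> x)) ^ (b + 2)) (at (x i))" if x: "x \<in> rspace S" "x \<in> U" for x
  proof -
    have nz: "\<phi>j (x(j := \<psi> x)) \<noteq> 0" using x by (intro deriv_j_nz) simp
    have alg: "(a * p - c * q) / p ^ (b + 1) + (a' * p - c * q') / p ^ (b + 1) * (- u / p)
      = (a * p\<^sup>2 + (- c * (p * q)) - (a' * u * p) + c * (u * q')) / p ^ (b + 2)"
      if "p \<noteq> 0" for a a' c p q q' u :: real
      using that by (simp add: field_simps power2_eq_square)
    show ?thesis
      by (rule DERIV_cong[OF derivative_along_\<psi>[OF x assms(3) F'[OF i] F'[OF j] contF']],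
        unfold F'_def alg[OF nz]) (simp add: N_def algebra_simps)
  qed
  ultimately show ?thesis by blast
qed

text \<open>A boundary term as a function on \<open>rspace S\<close>, extended by zero to the points
  whose line misses the zero set.\<close>

definition Ev :: "((nat \<Rightarrow> real) \<Rightarrow> real) \<Rightarrow> (nat \<Rightarrow> real) \<Rightarrow> real" where
  "Ev F x = (if x \<in> U then F (x(j := \<psi> x)) else 0)"

text \<open>The dependence of the bound for a boundary term on the position \<open>s\<close> of the
  zero; by (A3) it vanishes at both infinities as soon as \<open>a < 1\<close>.\<close>

definition \<eta> :: "nat \<Rightarrow> real \<Rightarrow> real \<Rightarrow> real" where
  "\<eta> k a s = rho_sum k s * tail s powr (- a)"

lemma tendsto_\<eta>:
  assumes "k \<le> r - 1" "a < 1"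
  shows "(\<eta> k a \<longlongrightarrow> 0) at_top" "(\<eta> k a \<longlongrightarrow> 0) at_bot"
proof -
  have eq: "\<eta> k a = (\<lambda>s. \<Sum>c\<le>k. \<bar>(deriv ^^ c) \<rho> s * tail s powr (- a)\<bar>)"
    unfolding \<eta>_def rho_sum_def by (intro ext) (simp add: sum_distrib_right abs_mult)
  show "(\<eta> k a \<longlongrightarrow> 0) at_top" "(\<eta> k a \<longlongrightarrow> 0) at_bot"
    unfolding eq by (intro tendsto_null_sum tendsto_rabs_zero tail_limits[OF lim_\<rho>]; use assms in simp)+
qed

lemma \<eta>_bound:
  assumes "k \<le> r - 1" "a < 1"
  obtains K where "0 \<le> K" "\<And>s. \<eta> k a s \<le> K"
proof -
  have "continuous_on UNIV (\<eta> k a)" unfolding \<eta>_def rho_sum_def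
    by (intro continuous_intros continuous_rho_deriv) (use assms in auto)
  from bounded_if_tendsto_zero[OF this tendsto_\<eta>[OF assms]] obtain K
    where "0 \<le> K" "\<And>s. \<bar>\<eta> k a s\<bar> \<le> K" by blast
  then show ?thesis by (intro that[of K]) (auto intro: order_trans[OF abs_ge_self])
qed

lemma growth_pow_upd: "growth (x(j := s)) ^ n = sgrowth x ^ n * tail s powr (- (real n * Bs j))"
  by (simp add: growth_upd power_mult_distrib tail_powr_power)

lemma bdry_bound_upd:
  assumes "bdry m F" "m \<le> r"
  obtains C where "0 \<le> C" "\<And>x s. x \<in> rspace S \<Longrightarrow>
    \<bar>F (x(j := s))\<bar> \<le> C * sgrowth x ^ (2 * m + 1) * \<eta> (m - 1) (real (2 * m + 1) * Bs j) s"
proof -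
  from bdry_bound[OF assms] obtain C where C: "C \<ge> 0"
    "\<forall>y\<in>rspace D. \<bar>F y\<bar> \<le> C * (growth y ^ (2 * m + 1) * rho_sum (m - 1) (y j))" by blast
  show ?thesis
  proof (rule that[OF C(1)])
    fix x s assume "x \<in> rspace S"
    from C(2)[rule_format, OF in_D[OF this], of s]
    show "\<bar>F (x(j := s))\<bar> \<le> C * sgrowth x ^ (2 * m + 1) * \<eta> (m - 1) (real (2 * m + 1) * Bs j) s"
      unfolding growth_pow_upd \<eta>_def by (simp add: ac_simps)
  qed
qed

lemma tendsto_Ev:
  assumes F: "bdry m F" "m \<le> r" "real (2 * m + 1) * Bs j < 1"
    and x: "x \<in> rspace S" and X: "\<forall>\<^sub>F n in E. X n \<in> rspace S" "(X \<longlongrightarrow> x) E"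
  shows "((\<lambda>n. Ev F (X n)) \<longlongrightarrow> Ev F x) E"
proof (cases "x \<in> U")
  case True
  have "((\<lambda>n. F ((X n)(j := \<psi> (X n)))) \<longlongrightarrow> F (x(j := \<psi> x))) E"
    by (rule tendsto_at_upd[OF bdry_continuous[OF F(1,2)] x X tendsto_\<psi>[OF x X True]])
  moreover have "\<forall>\<^sub>F n in E. F ((X n)(j := \<psi> (X n))) = Ev F (X n)"
    using eventually_U[OF x X True] by (auto elim!: eventually_mono simp: Ev_def)
  ultimately show ?thesis using True by (auto intro: Lim_transform_eventually simp: Ev_def)
next
  case False
  let ?a = "real (2 * m + 1) * Bs j"
  obtain C where C: "0 \<le> C" "\<And>x s. x \<in> rspace S \<Longrightarrow>
    \<bar>F (x(j := s))\<bar> \<le> C * sgrowth x ^ (2 * m + 1) * \<eta> (m - 1) ?a s"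
    using bdry_bound_upd[OF F(1,2)] by blast
  have k: "m - 1 \<le> r - 1" using F(2) by simp
  have "((\<lambda>n. C * sgrowth (X n) ^ (2 * m + 1) * (if X n \<in> U then \<eta> (m - 1) ?a (\<psi> (X n)) else 0))
      \<longlongrightarrow> C * sgrowth x ^ (2 * m + 1) * 0) E"
    by (intro tendsto_intros tendsto_sgrowth X tendsto_escape[OF x X False] tendsto_\<eta>[OF k F(3)])
  then have lim: "((\<lambda>n. C * sgrowth (X n) ^ (2 * m + 1) * (if X n \<in> U then \<eta> (m - 1) ?a (\<psi> (X n)) else 0))
      \<longlongrightarrow> 0) E" by simp
  have "\<forall>\<^sub>F n in E. norm (Ev F (X n)) \<le>
      C * sgrowth (X n) ^ (2 * m + 1) * (if X n \<in> U then \<eta> (m - 1) ?a (\<psi> (X n)) else 0)"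
    using X(1) by eventually_elim (use C(2) in \<open>auto simp: Ev_def\<close>)
  from Lim_null_comparison[OF this lim] show ?thesis using False by (simp add: Ev_def)
qed

text \<open>On \<open>U\<close> this is differentiation along the zero set. At a point off
  \<open>U\<close> the function vanishes, wherever it is nonzero the argument lies in
  \<open>U\<close> and the derivative is known, and that derivative tends to zero. Hence the
  smallness condition is imposed for the order \<open>Suc m\<close> of the derivative.\<close>

lemma Ev_derivative:
  assumes F: "bdry m F" "m < r" "real (2 * Suc m + 1) * Bs j < 1" and i: "i \<in> S"
  shows "\<exists>F'. bdry (Suc m) F' \<and>
    (\<forall>x\<in>rspace S. ((\<lambda>t. Ev F (x(i := t))) has_real_derivative Ev F' x) (at (x i)))"
proof -
  from bdry_derivative[OF F(1,2) i] obtain F' where F': "bdry (Suc m) F'"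
    "\<And>x. x \<in> rspace S \<Longrightarrow> x \<in> U \<Longrightarrow>
      ((\<lambda>t. F (x(i := t, j := \<psi> (x(i := t))))) has_real_derivative F' (x(j := \<psi> x))) (at (x i))" by blast
  have m: "real (2 * m + 1) * Bs j < 1"
    using F(3) Bs[OF j] by (auto simp: algebra_simps)
  have onU: "((\<lambda>t. Ev F (x(i := t))) has_real_derivative Ev F' x) (at (x i))"
    if x: "x \<in> rspace S" "x \<in> U" for x
  proof (rule DERIV_cong_ev[OF refl _ refl, THEN iffD2])
    show "\<forall>\<^sub>F t in nhds (x i). Ev F (x(i := t)) = F (x(i := t, j := \<psi> (x(i := t))))"
      by (rule eventually_mono[OF eventually_U_line]) (use x i in \<open>auto simp: Ev_def\<close>)
    show "((\<lambda>t. F (x(i := t, j := \<psi> (x(i := t))))) has_real_derivative Ev F' x) (at (x i))"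
      using F'(2)[OF x] x by (simp add: Ev_def)
  qed
  have "((\<lambda>t. Ev F (x(i := t))) has_real_derivative Ev F' x) (at (x i))" if x: "x \<in> rspace S" for x
  proof (cases "x \<in> U")
    case False
    have line: "((\<lambda>t. Ev G (x(i := t))) \<longlongrightarrow> Ev G (x(i := t0))) (at t0)"
      if "bdry n G" "n \<le> r" "real (2 * n + 1) * Bs j < 1" for n G t0
      by (rule tendsto_Ev[OF that _ _ line_tendsto(2)]) (use x i in auto)
    have "((\<lambda>t. Ev F (x(i := t))) has_real_derivative 0) (at (x i))"
    proof (rule has_derivative_zero_flat[of UNIV])
      show "continuous_on UNIV (\<lambda>t. Ev F (x(i := t)))"
        using line[OF F(1) _ m] F(2) by (auto intro!: continuous_at_imp_continuous_on simp: isCont_def)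
      show "Ev F (x(i := x i)) = 0" using False by (simp add: Ev_def)
      show "((\<lambda>t. Ev F (x(i := t))) has_real_derivative Ev F' (x(i := t))) (at t)"
        if "Ev F (x(i := t)) \<noteq> 0" for t
        using onU[of "x(i := t)"] x i that by (auto simp: Ev_def split: if_splits)
      show "((\<lambda>t. Ev F' (x(i := t))) \<longlongrightarrow> 0) (at (x i))"
        using line[OF F'(1) _ F(3), of "x i"] F(2) False by (simp add: Ev_def)
    qed auto
    then show ?thesis using False by (simp add: Ev_def)
  qed (use onU x in auto)
  with F'(1) show ?thesis by blast
qed

text \<open>The bound is uniform in the position of the zero, because \<open>\<eta>\<close> is
  continuous with limit zero at both ends.\<close>

lemma Ev_bound:
  assumes F: "bdry m F" "m \<le> r" "real (2 * m + 1) * Bs j < 1"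
  shows "\<exists>C. \<forall>x\<in>rspace S. \<bar>Ev F x\<bar> \<le> C * sgrowth x ^ (2 * m + 1)"
proof -
  obtain C where C: "0 \<le> C" "\<And>x s. x \<in> rspace S \<Longrightarrow>
    \<bar>F (x(j := s))\<bar> \<le> C * sgrowth x ^ (2 * m + 1) * \<eta> (m - 1) (real (2 * m + 1) * Bs j) s"
    using bdry_bound_upd[OF F(1,2)] by blast
  obtain K where K: "0 \<le> K" "\<And>s. \<eta> (m - 1) (real (2 * m + 1) * Bs j) s \<le> K"
    using \<eta>_bound[OF diff_le_mono[OF F(2)] F(3)] by blast
  have "\<bar>Ev F x\<bar> \<le> (C * K) * sgrowth x ^ (2 * m + 1)" if x: "x \<in> rspace S" for x
  proof -
    have nn: "0 \<le> C * sgrowth x ^ (2 * m + 1)" using C(1) sgrowth_ge_1[of x] by simp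
    have "\<bar>F (x(j := \<psi> x))\<bar> \<le> C * sgrowth x ^ (2 * m + 1) * K"
      by (rule order_trans[OF C(2)[OF x] mult_left_mono[OF K(2) nn]])
    then show ?thesis using nn K(1) by (auto simp: Ev_def ac_simps)
  qed
  then show ?thesis by blast
qed

end

subsection \<open>Differentiation of the preintegrated function\<close>

context preintegration
begin

definition \<theta> :: "(nat \<Rightarrow> real) \<Rightarrow> real \<Rightarrow> real" where
  "\<theta> x s = of_bool (0 \<le> \<phi> (x(j := s)))"

definition preint :: "((nat \<Rightarrow> real) \<Rightarrow> real) \<Rightarrow> (nat \<Rightarrow> real) \<Rightarrow> real" where
  "preint G x = (\<integral>s. G (x(j := s)) * \<theta> x s * \<rho> s \<partial>lborel)"

section \<open>Measurability, domination and continuity of preintegrals\<close>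

lemma continuous_section:
  assumes "continuous_on (rspace D) F" "x \<in> rspace S"
  shows "continuous_on UNIV (\<lambda>s. F (x(j := s)))"
  unfolding continuous_on_def
  by (intro ballI tendsto_at_upd[OF assms]) (use assms in auto)

lemma measurable_section [measurable]:
  assumes "continuous_on (rspace D) F" "x \<in> rspace S"
  shows "(\<lambda>s. F (x(j := s))) \<in> borel_measurable borel"
  by (rule borel_measurable_continuous_onI[OF continuous_section[OF assms]])

lemma measurable_\<theta> [measurable]:
  assumes "x \<in> rspace S" shows "\<theta> x \<in> borel_measurable borel"
  unfolding \<theta>_def using measurable_section[OF continuous_\<phi> assms] by measurable

lemma abs_\<theta>_le: "\<bar>\<theta> x s\<bar> \<le> 1"
  by (simp add: \<theta>_def)

lemma tendsto_\<theta>: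
  assumes "x \<in> rspace S" "\<forall>\<^sub>F n in E. X n \<in> rspace S" "(X \<longlongrightarrow> x) E" "\<phi> (x(j := s)) \<noteq> 0"
  shows "((\<lambda>n. \<theta> (X n) s) \<longlongrightarrow> \<theta> x s) E"
proof -
  have lim: "((\<lambda>n. \<phi> ((X n)(j := s))) \<longlongrightarrow> \<phi> (x(j := s))) E"
    by (rule tendsto_at_upd[OF continuous_\<phi> assms(1-3) tendsto_const])
  have "\<forall>\<^sub>F n in E. \<theta> (X n) s = \<theta> x s"
  proof (cases "0 < \<phi> (x(j := s))")
    case True
    from order_tendstoD(1)[OF lim this] True show ?thesis
      by (auto elim!: eventually_mono simp: \<theta>_def)
  next
    case False
    then have "\<phi> (x(j := s)) < 0" using assms(4) by simp
    from order_tendstoD(2)[OF lim this] this show ?thesis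
      by (auto elim!: eventually_mono simp: \<theta>_def)
  qed
  then show ?thesis by (rule tendsto_eventually)
qed

lemma AE_\<phi>_nz:
  assumes "x \<in> rspace S" shows "AE s in lborel. \<phi> (x(j := s)) \<noteq> 0"
proof (cases "x \<in> U")
  case True
  have "AE s in lborel. s \<noteq> \<psi> x" by (rule AE_lborel_singleton)
  then show ?thesis by eventually_elim (use less_\<psi>_iff(3)[OF assms True] in blast)
qed (auto simp: U_def)

lemma integrable_dom: "integrable lborel (\<lambda>s. K * (tail s powr (- Bs j) * \<rho> s))"
  using integrable_tail_powr_rho[of "- Bs j"] Bs[OF j] by (intro integrable_mult_right) simp

lemma dom_bound:
  assumes "\<bar>q\<bar> \<le> K * tail s powr (- Bs j)"
  shows "norm (q * \<theta> x s * \<rho> s) \<le> K * (tail s powr (- Bs j) * \<rho> s)"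
proof -
  have "\<bar>q\<bar> * \<bar>\<theta> x s\<bar> \<le> (K * tail s powr (- Bs j)) * 1"
    by (rule mult_mono[OF assms abs_\<theta>_le]) (use assms in auto)
  then have "\<bar>q\<bar> * \<bar>\<theta> x s\<bar> * \<rho> s \<le> (K * tail s powr (- Bs j)) * 1 * \<rho> s"
    by (rule mult_right_mono) (simp add: pos less_imp_le)
  then show ?thesis using pos[of s] by (simp add: abs_mult ac_simps)
qed

lemma integrable_preint:
  assumes x: "x \<in> rspace S" and q: "q \<in> borel_measurable borel" "\<And>s. \<bar>q s\<bar> \<le> K * tail s powr (- Bs j)"
  shows "integrable lborel (\<lambda>s. q s * \<theta> x s * \<rho> s)"
proof (rule Bochner_Integration.integrable_bound[OF integrable_dom])
  show "AE s in lborel. norm (q s * \<theta> x s * \<rho> s) \<le> norm (K * (tail s powr (- Bs j) * \<rho> s))"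
    by (intro AE_I2 order_trans[OF dom_bound[OF q(2)]]) simp
  note q(1)[measurable] measurable_\<theta>[OF x, measurable]
  show "(\<lambda>s. q s * \<theta> x s * \<rho> s) \<in> borel_measurable lborel" by measurable
qed

text \<open>The indicators converge except where \<phi> vanishes over \<open>x\<close>, which is at
  most one point of the line; the common majorant is integrable since
  \<open>Bs j < 1\<close>.\<close>

lemma preint_dominated_convergence:
  fixes X :: "nat \<Rightarrow> nat \<Rightarrow> real"
  assumes x: "x \<in> rspace S" and X: "\<And>n. X n \<in> rspace S" "X \<longlonglongrightarrow> x"
    and q: "\<And>n. q n \<in> borel_measurable borel" "q' \<in> borel_measurable borel"
    and lim: "\<And>s. (\<lambda>n. q n s) \<longlonglongrightarrow> q' s"
    and bnd: "\<And>n s. \<bar>q n s\<bar> \<le> K * tail s powr (- Bs j)"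
  shows "(\<lambda>n. \<integral>s. q n s * \<theta> (X n) s * \<rho> s \<partial>lborel) \<longlonglongrightarrow> (\<integral>s. q' s * \<theta> x s * \<rho> s \<partial>lborel)"
proof (rule integral_dominated_convergence[OF _ _ integrable_dom[of K]])
  note q[measurable] measurable_\<theta>[OF x, measurable] measurable_\<theta>[OF X(1), measurable]
  show "(\<lambda>s. q' s * \<theta> x s * \<rho> s) \<in> borel_measurable lborel"
    "(\<lambda>s. q n s * \<theta> (X n) s * \<rho> s) \<in> borel_measurable lborel" for n by measurable
  show "AE s in lborel. (\<lambda>n. q n s * \<theta> (X n) s * \<rho> s) \<longlonglongrightarrow> q' s * \<theta> x s * \<rho> s"
    using AE_\<phi>_nz[OF x]
    by eventually_elim (intro tendsto_mult lim tendsto_const tendsto_\<theta>[OF x _ X(2)], auto simp: X(1))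
  show "AE s in lborel. norm (q n s * \<theta> (X n) s * \<rho> s) \<le> K * (tail s powr (- Bs j) * \<rho> s)" for n
    by (intro AE_I2 dom_bound bnd)
qed

lemma pd_g_bound:
  assumes "set w \<subseteq> D" "length w \<le> r" "x \<in> rspace S"
  shows "\<bar>pd w g (x(j := s))\<bar> \<le> L * sgrowth x * tail s powr (- Bs j)"
  using growth_pd[OF assms(1,2) in_D[OF assms(3)], of s] growth_upd[of x s] by (simp add: growth_def ac_simps)

lemma sgrowth_seq_bounded:
  assumes "X \<longlonglongrightarrow> x" obtains K where "\<And>n. sgrowth (X n) \<le> K"
proof -
  have "Bseq (\<lambda>n. sgrowth (X n))"
    by (rule convergent_imp_Bseq, rule convergentI, rule tendsto_sgrowth[OF assms])
  from BseqE[OF this] obtain K where "\<forall>n. norm (sgrowth (X n)) \<le> K" by blast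
  then show ?thesis by (intro that[of K]) (auto simp: abs_le_iff)
qed

lemma preint_continuous:
  assumes w: "set w \<subseteq> D" "length w \<le> r"
  shows "continuous_on (rspace S) (preint (pd w g))"
  unfolding continuous_on_sequentially
proof (intro allI ballI impI, elim conjE)
  fix X x assume x: "x \<in> rspace S" and X: "\<forall>n. X n \<in> rspace S" "X \<longlonglongrightarrow> x"
  obtain K where K: "\<And>n. sgrowth (X n) \<le> K" using sgrowth_seq_bounded[OF X(2)] by blast
  show "(preint (pd w g) \<circ> X) \<longlonglongrightarrow> preint (pd w g) x"
    unfolding o_def preint_def
  proof (rule preint_dominated_convergence[OF x _ X(2)])
    show "(\<lambda>s. pd w g ((X n)(j := s))) \<in> borel_measurable borel" for n
      using measurable_section[OF continuous_pd_g[OF w]] X(1) by blast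
    show "(\<lambda>s. pd w g (x(j := s))) \<in> borel_measurable borel"
      using measurable_section[OF continuous_pd_g[OF w]] x by blast
    show "(\<lambda>n. pd w g ((X n)(j := s))) \<longlonglongrightarrow> pd w g (x(j := s))" for s
      by (rule tendsto_at_upd[OF continuous_pd_g[OF w] x _ X(2)]) (use X(1) in auto)
    show "\<bar>pd w g ((X n)(j := s))\<bar> \<le> L * K * tail s powr (- Bs j)" for n s
      using X(1) L by (intro order_trans[OF pd_g_bound[OF w]] mult_right_mono mult_left_mono K) auto
  qed (use X(1) in auto)
qed

lemma preint_bound:
  assumes w: "set w \<subseteq> D" "length w \<le> r"
  shows "\<exists>C. \<forall>x\<in>rspace S. \<bar>preint (pd w g) x\<bar> \<le> C * sgrowth x"
proof (intro exI ballI)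
  fix x assume x: "x \<in> rspace S"
  have "norm (preint (pd w g) x) \<le> (\<integral>s. (L * sgrowth x) * (tail s powr (- Bs j) * \<rho> s) \<partial>lborel)"
    unfolding preint_def
  proof (rule Bochner_Integration.integral_norm_bound_integral)
    show "integrable lborel (\<lambda>s. pd w g (x(j := s)) * \<theta> x s * \<rho> s)"
      by (rule integrable_preint[OF x measurable_section[OF continuous_pd_g[OF w] x] pd_g_bound[OF w x]])
  qed (rule integrable_dom dom_bound[OF pd_g_bound[OF w x]])+
  then show "\<bar>preint (pd w g) x\<bar> \<le> (L * (\<integral>s. tail s powr (- Bs j) * \<rho> s \<partial>lborel)) * sgrowth x"
    unfolding Bochner_Integration.integral_mult_right_zero real_norm_def by (simp only: ac_simps)
qed

text \<open>Without a zero on the line, \<phi> cannot change sign there.\<close>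

lemma not_U_sign:
  assumes "x \<in> rspace S" "x \<notin> U"
  shows "\<theta> x s = \<theta> x 0"
proof -
  have nz: "\<sigma> * \<phi> (x(j := s)) \<noteq> 0" for s using assms(2) \<sigma>_cases by (fastforce simp: U_def)
  have "0 < \<sigma> * \<phi> (x(j := s)) \<longleftrightarrow> 0 < \<sigma> * \<phi> (x(j := 0))"
    using U_I[OF assms(1), of s 0] U_I[OF assms(1), of 0 s] nz[of s] nz[of 0] assms(2)
    by (meson linorder_less_linear)
  with nz[of s] nz[of 0] show ?thesis
    by (cases rule: \<sigma>_cases) (auto simp: \<theta>_def)
qed

text \<open>One formula for both orientations: the half-line above \<psi> for \<sigma> = 1, the
  half-line up to \<psi> for \<sigma> = -1. In the first case it fails at the point \<psi> itself,
  hence almost everywhere.\<close>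

lemma AE_\<theta>_U:
  assumes "x \<in> rspace S" "x \<in> U"
  shows "AE s in lborel. \<theta> x s = of_bool (\<sigma> = 1) - \<sigma> * indicator {..\<psi> x} s"
  using AE_lborel_singleton[of "\<psi> x"]
proof eventually_elim
  case (elim s)
  show ?case using less_\<psi>_iff[OF assms, of s] elim
    by (cases rule: \<sigma>_cases) (auto simp: \<theta>_def indicator_def)
qed

lemma preint_derivative:
  assumes w: "set w \<subseteq> D" "length w < r" "real (2 * Suc (length w) + 1) * Bs j < 1" and i: "i \<in> S"
  shows "\<exists>F'. bdry (Suc (length w)) F' \<and> (\<forall>x\<in>rspace S.
    ((\<lambda>t. preint (pd w g) (x(i := t))) has_real_derivative preint (pd (i # w) g) x + Ev F' x) (at (x i)))"
proof -
  define m where "m = length w"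
  define G where "G = pd w g"
  define G' where "G' = pd (i # w) g"
  have w': "set (i # w) \<subseteq> D" "length (i # w) \<le> r" "length w \<le> r" and iD: "i \<in> D" using w i by auto
  have contG: "continuous_on (rspace D) G" and contG': "continuous_on (rspace D) G'"
    unfolding G_def G'_def by (rule continuous_pd_g[OF w(1) w'(3)], rule continuous_pd_g[OF w'(1,2)])
  have bG: "\<bar>G (x(j := s))\<bar> \<le> L * sgrowth x * tail s powr (- Bs j)"
    and bG': "\<bar>G' (x(j := s))\<bar> \<le> L * sgrowth x * tail s powr (- Bs j)" if "x \<in> rspace S" for x s
    using pd_g_bound[OF w(1) w'(3) that] pd_g_bound[OF w'(1,2) that] by (auto simp: G_def G'_def)
  \<comment> \<open>The boundary term is \<sigma> G \<rho> D_i \<phi> / D_j \<phi>. It is expanded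
    by \<open>\<phi>j ^ (2 * m)\<close> to have the denominator that \<open>bdry (Suc m)\<close>
    prescribes.\<close>
  define A where "A = (\<lambda>y. \<sigma> * (pd w g y * (deriv ^^ 0) \<rho> (y j) * pd [i] \<phi> y * pd [j] \<phi> y ^ (2 * m)))"
  define F' where "F' = (\<lambda>y. A y / \<phi>j y ^ (2 * m + 1))"
  have "num m (0 + 1 + 2 * m) A" unfolding A_def
    by (intro num_cmult num_mult_pow)
      (use num_mult[OF num_base[of w m 0 0], of "[i]"] w iD j in \<open>auto simp: m_def\<close>)
  then have F': "bdry (Suc m) F'" unfolding bdry.simps F'_def by (intro exI[of _ A]) simp
  have "((\<lambda>t. preint G (x(i := t))) has_real_derivative preint G' x + Ev F' x) (at (x i))"
    if x: "x \<in> rspace S" for x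
  proof -
    define X where "X = (\<lambda>t. x(i := t))"
    have XS: "X t \<in> rspace S" for t using x i by (simp add: X_def)
    have X0: "X (x i) = x" by (simp add: X_def)
    have Xlim: "(X \<longlongrightarrow> X t) (at t)" "(X \<longlongrightarrow> X t) (nhds t)" for t
      unfolding X_def by (rule line_tendsto)+
    have mG: "(\<lambda>s. G (z(j := s))) \<in> borel_measurable borel" if "z \<in> rspace S" for z
      by (rule measurable_section[OF contG that])
    define a where "a t = (\<integral>s. (G ((X t)(j := s)) - G (x(j := s))) * \<theta> (X t) s * \<rho> s \<partial>lborel)" for t
    define h where "h t = (\<integral>s. G (x(j := s)) * \<theta> (X t) s * \<rho> s \<partial>lborel)" for t
    have split: "preint G (X t) = a t + h t" for t
    proof -
      have "integrable lborel (\<lambda>s. G ((X t)(j := s)) * \<theta> (X t) s * \<rho> s)"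
        "integrable lborel (\<lambda>s. G (x(j := s)) * \<theta> (X t) s * \<rho> s)"
        by (rule integrable_preint[OF XS mG bG]; use x XS in simp)+
      from Bochner_Integration.integral_diff[OF this]
      show ?thesis by (simp add: preint_def a_def h_def algebra_simps)
    qed
    have DG: "((\<lambda>t. G ((X t)(j := s))) has_real_derivative G' ((X t)(j := s))) (at t)" for t s
      unfolding X_def G_def G'_def
      by (rule derivative_plane[OF _ x i]) (use pd_derivative[OF smooth_g w(1,2) iD] in blast)
    have a': "(a has_real_derivative preint G' x) (at (x i))"
      unfolding has_field_derivative_iff tendsto_at_iff_sequentially
    proof (intro allI impI)
      fix t :: "nat \<Rightarrow> real" assume t: "\<forall>n. t n \<in> UNIV - {x i}" "t \<longlonglongrightarrow> x i"
      \<comment> \<open>A convergent sequence stays within some distance \<open>M\<close> of its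
        limit, so all mean value points lie in a compact interval on which \<open>sgrowth\<close>
        has a single bound \<open>K\<close>. This gives the majorant for the difference
        quotients.\<close>
      have "Bseq (\<lambda>n. t n - x i)"
        by (rule convergent_imp_Bseq, rule convergentI, rule LIM_zero[OF t(2)])
      from BseqE[OF this] obtain M where "\<forall>n. norm (t n - x i) \<le> M" by blast
      then have M: "\<And>n. \<bar>t n - x i\<bar> \<le> M" by simp
      have "continuous_on {x i - M..x i + M} (\<lambda>t. sgrowth (X t))"
        using tendsto_sgrowth[OF Xlim(1)] by (intro continuous_at_imp_continuous_on) (simp add: isCont_def)
      from compact_continuous_image[OF this compact_Icc]
      have "bounded ((\<lambda>t. sgrowth (X t)) ` {x i - M..x i + M})" by (rule compact_imp_bounded)
      then obtain K where "\<forall>z\<in>(\<lambda>t. sgrowth (X t)) ` {x i - M..x i + M}. norm z \<le> K"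
        unfolding bounded_iff by blast
      then have K: "sgrowth (X u) \<le> K" if "u \<in> {x i - M..x i + M}" for u
        using imageI[OF that, of "\<lambda>t. sgrowth (X t)"] by (fastforce simp: abs_le_iff)
      define q where "q n s = (G ((X (t n))(j := s)) - G (x(j := s))) / (t n - x i)" for n s
      have "\<bar>q n s\<bar> \<le> L * K * tail s powr (- Bs j)" for n s
      proof -
        have "\<exists>u. \<bar>u - x i\<bar> \<le> \<bar>t n - x i\<bar> \<and> q n s = G' ((X u)(j := s))"
        proof (cases "t n < x i")
          case True
          from MVT2[OF this, of "\<lambda>u. G ((X u)(j := s))" "\<lambda>u. G' ((X u)(j := s))"] DG X0 obtain u
            where "t n < u" "u < x i" "G (x(j := s)) - G ((X (t n))(j := s)) = (x i - t n) * G' ((X u)(j := s))"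
            by metis
          then show ?thesis by (intro exI[of _ u]) (auto simp: q_def field_simps)
        next
          case False
          then have "x i < t n" using t(1) by (auto simp: less_le)
          from MVT2[OF this, of "\<lambda>u. G ((X u)(j := s))" "\<lambda>u. G' ((X u)(j := s))"] DG X0 obtain u
            where "x i < u" "u < t n" "G ((X (t n))(j := s)) - G (x(j := s)) = (t n - x i) * G' ((X u)(j := s))"
            by metis
          then show ?thesis by (intro exI[of _ u]) (auto simp: q_def field_simps)
        qed
        then obtain u where u: "\<bar>u - x i\<bar> \<le> M" "q n s = G' ((X u)(j := s))" using M order_trans by blast
        have "u \<in> {x i - M..x i + M}" using u(1) by (auto simp: abs_le_iff)
        from K[OF this] show ?thesis unfolding u(2) using L
          by (intro order_trans[OF bG'[OF XS]] mult_right_mono mult_left_mono) auto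
      qed
      moreover have "(\<lambda>n. q n s) \<longlonglongrightarrow> G' (x(j := s))" for s
        using DG[of s "x i"] t
        unfolding has_field_derivative_iff tendsto_at_iff_sequentially X0 by (auto simp: o_def q_def)
      moreover have "X (t n) \<in> rspace S" for n by (rule XS)
      moreover have "(\<lambda>n. X (t n)) \<longlonglongrightarrow> x"
        using filterlim_compose[OF Xlim(2)[of "x i"] t(2)] by (simp add: X0)
      moreover have "q n \<in> borel_measurable borel" for n
        unfolding q_def using mG[OF XS, measurable] mG[OF x, measurable] by measurable
      ultimately have "(\<lambda>n. \<integral>s. q n s * \<theta> (X (t n)) s * \<rho> s \<partial>lborel)
          \<longlonglongrightarrow> (\<integral>s. G' (x(j := s)) * \<theta> x s * \<rho> s \<partial>lborel)"
        by (intro preint_dominated_convergence[OF x] measurable_section[OF contG' x])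
      moreover have "(\<integral>s. q n s * \<theta> (X (t n)) s * \<rho> s \<partial>lborel) = (a (t n) - a (x i)) / (t n - x i)" for n
      proof -
        have "a (x i) = 0" by (simp add: a_def X0)
        moreover have "(\<integral>s. q n s * \<theta> (X (t n)) s * \<rho> s \<partial>lborel)
          = (\<integral>s. (G ((X (t n))(j := s)) - G (x(j := s))) * \<theta> (X (t n)) s * \<rho> s / (t n - x i) \<partial>lborel)"
          by (rule Bochner_Integration.integral_cong) (auto simp: q_def)
        ultimately show ?thesis by (simp add: a_def)
      qed
      ultimately show "((\<lambda>y. (a y - a (x i)) / (y - x i)) \<circ> t) \<longlonglongrightarrow> preint G' x"
        by (simp add: o_def preint_def)
    qed
    \<comment> \<open>With the integrand frozen, \<open>h\<close> depends on \<open>t\<close> only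
      through \<psi>: up to sign and a constant it is this primitive at
      \<open>\<psi> (X t)\<close>.\<close>
    define \<Gamma> where "\<Gamma> v = (\<integral>s. G (x(j := s)) * \<rho> s * indicator {..v} s \<partial>lborel)" for v
    have intG: "integrable lborel (\<lambda>s. G (x(j := s)) * \<rho> s)"
    proof (rule Bochner_Integration.integrable_bound[OF integrable_dom[of "L * sgrowth x"]])
      note mG[OF x, measurable]
      show "(\<lambda>s. G (x(j := s)) * \<rho> s) \<in> borel_measurable lborel" by measurable
      show "AE s in lborel. norm (G (x(j := s)) * \<rho> s) \<le> norm (L * sgrowth x * (tail s powr (- Bs j) * \<rho> s))"
      proof (rule AE_I2)
        fix s
        have "\<bar>G (x(j := s))\<bar> * \<rho> s \<le> L * sgrowth x * tail s powr (- Bs j) * \<rho> s"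
          by (intro mult_right_mono bG x) (simp add: less_imp_le pos)
        then have "norm (G (x(j := s)) * \<rho> s) \<le> L * sgrowth x * (tail s powr (- Bs j) * \<rho> s)"
          using pos[of s] by (simp add: abs_mult mult.assoc)
        also have "\<dots> \<le> norm (L * sgrowth x * (tail s powr (- Bs j) * \<rho> s))"
          by (simp only: real_norm_def abs_ge_self)
        finally show "norm (G (x(j := s)) * \<rho> s) \<le> norm (L * sgrowth x * (tail s powr (- Bs j) * \<rho> s))" .
      qed
    qed
    have \<Gamma>': "(\<Gamma> has_real_derivative G (x(j := v)) * \<rho> v) (at v)" for v
      unfolding \<Gamma>_def
      by (rule has_derivative_indefinite_integral[OF intG])
        (intro continuous_intros continuous_section[OF contG x] cont)
    define c where "c = (if \<sigma> = 1 then \<integral>s. G (x(j := s)) * \<rho> s \<partial>lborel else 0)"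
    have hU: "h t = c - \<sigma> * \<Gamma> (\<psi> (X t))" if "X t \<in> U" for t
    proof -
      have ind: "integrable lborel (\<lambda>s. G (x(j := s)) * \<rho> s * indicator {..v} s)" for v :: real
        using integrable_mult_indicator[OF _ intG, of "{..v}"] by (simp add: ac_simps)
      have "h t = (\<integral>s. of_bool (\<sigma> = 1) * (G (x(j := s)) * \<rho> s)
          - \<sigma> * (G (x(j := s)) * \<rho> s * indicator {..\<psi> (X t)} s) \<partial>lborel)"
        unfolding h_def
      proof (rule integral_cong_AE)
        note mG[OF x, measurable] measurable_\<theta>[OF XS, measurable]
        show "(\<lambda>s. G (x(j := s)) * \<theta> (X t) s * \<rho> s) \<in> borel_measurable lborel"
          "(\<lambda>s. of_bool (\<sigma> = 1) * (G (x(j := s)) * \<rho> s)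
            - \<sigma> * (G (x(j := s)) * \<rho> s * indicator {..\<psi> (X t)} s)) \<in> borel_measurable lborel" by measurable
        show "AE s in lborel. G (x(j := s)) * \<theta> (X t) s * \<rho> s = of_bool (\<sigma> = 1) * (G (x(j := s)) * \<rho> s)
            - \<sigma> * (G (x(j := s)) * \<rho> s * indicator {..\<psi> (X t)} s)"
          using AE_\<theta>_U[OF XS that]
        proof eventually_elim
          case (elim s)
          show ?case unfolding elim by (simp add: algebra_simps)
        qed
      qed
      also have "\<dots> = c - \<sigma> * \<Gamma> (\<psi> (X t))"
        using Bochner_Integration.integral_diff[OF integrable_mult_right[OF intG] integrable_mult_right[OF ind]]
        by (simp add: c_def \<Gamma>_def)
      finally show ?thesis .
    qed
    \<comment> \<open>\<open>G\<close> stays frozen at \<open>x\<close>, whereas \<psi> and the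
      derivatives of \<phi> belong to \<open>X t\<close>.\<close>
    define k where "k t = (let y = (X t)(j := \<psi> (X t)) in
      \<sigma> * (G (x(j := \<psi> (X t))) * \<rho> (\<psi> (X t))) * (partial_deriv i \<phi> y / \<phi>j y))" for t
    have h'U: "(h has_real_derivative k t) (at t)" if U: "X t \<in> U" for t
    proof (rule DERIV_cong_ev[OF refl _ refl, THEN iffD2])
      show "\<forall>\<^sub>F u in nhds t. h u = c - \<sigma> * \<Gamma> (\<psi> (X u))"
        using eventually_U_line[OF x i, of t] U by (auto simp: X_def[symmetric] hU elim!: eventually_mono)
      have "((\<lambda>u. \<psi> ((X t)(i := u))) has_real_derivative
          - partial_deriv i \<phi> ((X t)(j := \<psi> (X t))) / \<phi>j ((X t)(j := \<psi> (X t)))) (at ((X t) i))"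
        by (rule \<psi>_derivative[OF XS U i])
      then have "((\<lambda>u. \<psi> (X u)) has_real_derivative
          - partial_deriv i \<phi> ((X t)(j := \<psi> (X t))) / \<phi>j ((X t)(j := \<psi> (X t)))) (at t)"
        by (simp add: X_def)
      from DERIV_diff[OF DERIV_const[of c] DERIV_cmult[OF DERIV_chain2[OF \<Gamma>' this], of \<sigma>]]
      show "((\<lambda>u. c - \<sigma> * \<Gamma> (\<psi> (X u))) has_real_derivative k t) (at t)"
        by (simp add: k_def Let_def mult.assoc)
    qed
    have h': "(h has_real_derivative Ev F' x) (at (x i))"
    proof (cases "x \<in> U")
      case True
      have "k (x i) = F' (x(j := \<psi> x))"
        using deriv_j_nz[OF in_D[OF x], of "\<psi> x"]
        by (simp add: k_def F'_def A_def X0 G_def Let_def)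
      with h'U[of "x i"] True show ?thesis by (simp add: X0 Ev_def)
    next
      case False
      define k0 where "k0 t = (if X t \<in> U then k t else 0)" for t
      have conth: "continuous_on UNIV h"
        unfolding continuous_on_sequentially
      proof (intro allI ballI impI, elim conjE)
        fix t :: "nat \<Rightarrow> real" and u assume "t \<longlonglongrightarrow> u"
        then have "(\<lambda>n. X (t n)) \<longlonglongrightarrow> X u" by (rule filterlim_compose[OF Xlim(2)])
        then show "(h \<circ> t) \<longlonglongrightarrow> h u" unfolding o_def h_def
          by (rule preint_dominated_convergence[OF XS XS _ mG[OF x] mG[OF x] tendsto_const bG[OF x]])
      qed
      \<comment> \<open>Off \<open>U\<close> the indicator is constant on the line, and near
        \<open>x i\<close> it is the same constant as over \<open>x\<close>. So \<open>h\<close>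
        differs from \<open>h (x i)\<close> only where \<open>X t\<close> lies in \<open>U\<close>
        and the derivative is known, as \<open>has_derivative_zero_flat\<close> demands.\<close>
      have evI: "\<forall>\<^sub>F t in nhds (x i). X t \<notin> U \<longrightarrow> h t = h (x i)"
      proof -
        have eq: "h t = h (x i)" if "X t \<notin> U" "\<theta> (X t) 0 = \<theta> x 0" for t
        proof -
          have "\<theta> (X t) s = \<theta> x s" for s
            by (rule trans[OF not_U_sign[OF XS that(1)] trans[OF that(2) not_U_sign[OF x False, symmetric]]])
          then show ?thesis by (simp add: h_def X0)
        qed
        have "\<phi> (x(j := 0)) \<noteq> 0" using False by (auto simp: U_def)
        then have "((\<lambda>t. \<theta> (X t) 0) \<longlongrightarrow> \<theta> (X (x i)) 0) (nhds (x i))"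
          using Xlim(2)[of "x i"] XS by (intro tendsto_\<theta>) (auto simp: X0 x)
        then have "\<forall>\<^sub>F t in nhds (x i). \<bar>\<theta> (X t) 0 - \<theta> x 0\<bar> < 1"
          unfolding tendsto_iff dist_real_def X0 by (meson zero_less_one)
        then have "\<forall>\<^sub>F t in nhds (x i). \<theta> (X t) 0 = \<theta> x 0"
          by (rule eventually_mono) (auto simp: \<theta>_def split: if_splits)
        then show ?thesis by (rule eventually_mono) (use eq in blast)
      qed
      then obtain I where I: "open I" "x i \<in> I" "\<And>t. t \<in> I \<Longrightarrow> X t \<notin> U \<Longrightarrow> h t = h (x i)"
        unfolding eventually_nhds by blast
      have "((\<lambda>t. h t - h (x i)) has_real_derivative 0) (at (x i))"
      proof (rule has_derivative_zero_flat[OF I(1,2), where k=k0])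
        show "continuous_on I (\<lambda>t. h t - h (x i))"
          by (intro continuous_intros continuous_on_subset[OF conth]) auto
        show "((\<lambda>t. h t - h (x i)) has_real_derivative k0 t) (at t)" if "t \<in> I" "h t - h (x i) \<noteq> 0" for t
        proof -
          have U: "X t \<in> U" using I(3) that by force
          from DERIV_diff[OF h'U[OF U] DERIV_const] U show ?thesis by (simp add: k0_def)
        qed
        have 3: "3 * Bs j < 1"
        proof -
          have "3 * Bs j \<le> real (2 * Suc (length w) + 1) * Bs j" using Bs[OF j] by (intro mult_right_mono) auto
          then show ?thesis using w(3) by linarith
        qed
        \<comment> \<open>One growth factor each from \<open>G\<close>, D_i \<phi> and 1 / D_j
          \<phi>, hence the exponent \<open>3 * Bs j\<close>.\<close>
        have bk: "\<bar>k t\<bar> \<le> L ^ 3 * sgrowth x * sgrowth (X t) ^ 2 * \<eta> 0 (3 * Bs j) (\<psi> (X t))" for t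
        proof -
          define s where "s = \<psi> (X t)"
          define u where "u = tail s powr (- Bs j)"
          have [simp]: "0 \<le> u" "0 \<le> L" using L by (auto simp: u_def)
          have y: "(X t)(j := s) \<in> rspace D" by (rule in_D[OF XS])
          have b2: "\<bar>partial_deriv i \<phi> ((X t)(j := s))\<bar> \<le> L * (sgrowth (X t) * u)"
            using growth_pd[of "[i]", OF _ _ y] growth_upd[of "X t" s] iD r by (auto simp: growth_def u_def)
          have b3: "\<bar>1 / \<phi>j ((X t)(j := s))\<bar> \<le> L * (sgrowth (X t) * u)"
            using growth_inv[of 1, OF _ _ y] growth_upd[of "X t" s] r by (auto simp: growth_def u_def)
          have s1: "\<bar>\<sigma>\<bar> = 1" by (cases rule: \<sigma>_cases) auto
          have "\<bar>k t\<bar> = \<bar>G (x(j := s))\<bar> * \<rho> s * (\<bar>partial_deriv i \<phi> ((X t)(j := s))\<bar> * \<bar>1 / \<phi>j ((X t)(j := s))\<bar>)"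
            using pos[of s] s1 by (simp add: k_def Let_def abs_mult s_def[symmetric])
          also have "\<dots> \<le> (L * sgrowth x * u) * \<rho> s * ((L * (sgrowth (X t) * u)) * (L * (sgrowth (X t) * u)))"
            using sgrowth_ge_1[of "X t"] sgrowth_ge_1[of x] pos[of s]
            by (intro mult_mono b2 b3 bG[OF x, of s, folded u_def] order_refl mult_nonneg_nonneg) auto
          also have "\<dots> = L ^ 3 * sgrowth x * sgrowth (X t) ^ 2 * (\<rho> s * (u * u * u))"
            by (simp add: power2_eq_square power3_eq_cube ac_simps)
          also have "u * u * u = tail s powr (- (3 * Bs j))"
            unfolding u_def by (simp add: powr_add[symmetric])
          also have "\<rho> s * tail s powr (- (3 * Bs j)) = \<eta> 0 (3 * Bs j) s"
            using pos[of s] by (simp add: \<eta>_def rho_sum_def)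
          finally show ?thesis by (simp add: s_def)
        qed
        have "((\<lambda>t. L ^ 3 * sgrowth x * sgrowth (X t) ^ 2 * (if X t \<in> U then \<eta> 0 (3 * Bs j) (\<psi> (X t)) else 0))
          \<longlongrightarrow> L ^ 3 * sgrowth x * sgrowth x ^ 2 * 0) (at (x i))"
          using Xlim(1)[of "x i"] unfolding X0
          by (intro tendsto_intros tendsto_sgrowth tendsto_escape[OF x _ _ False] tendsto_\<eta> 3)
            (auto simp: XS)
        then have "((\<lambda>t. L ^ 3 * sgrowth x * sgrowth (X t) ^ 2 * (if X t \<in> U then \<eta> 0 (3 * Bs j) (\<psi> (X t)) else 0))
          \<longlongrightarrow> 0) (at (x i))" by (simp only: mult_zero_right)
        then show "(k0 \<longlongrightarrow> 0) (at (x i))"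
          by (rule Lim_null_comparison[rotated]) (use bk in \<open>auto simp: k0_def\<close>)
      qed simp
      then have "((\<lambda>t. (h t - h (x i)) + h (x i)) has_real_derivative 0 + 0) (at (x i))"
        by (intro DERIV_add) auto
      then show ?thesis using False by (simp add: Ev_def)
    qed
    show ?thesis using DERIV_add[OF a' h'] unfolding X_def[symmetric] split .
  qed
  with F' show ?thesis unfolding G_def G'_def m_def by blast
qed

section \<open>Iterated derivatives of the preintegrated function\<close>

context
  fixes R :: nat
  assumes R: "R \<le> r" "real (2 * R + 1) * Bs j < 1"
begin

text \<open>\<open>R\<close> is the order up to which derivatives are taken: \<open>r\<close> for
  the smoothness claim and \<open>card S\<close> for quadrature, which accounts for the two
  different bounds on B_j.\<close>

lemma order_bound: "m \<le> R \<Longrightarrow> real (2 * m + 1) * Bs j < 1"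
proof -
  assume "m \<le> R"
  then have "real (2 * m + 1) * Bs j \<le> real (2 * R + 1) * Bs j"
    using Bs[OF j] by (intro mult_right_mono) auto
  then show ?thesis using R by linarith
qed

text \<open>The old boundary term is differentiated to \<open>F1\<close>, and the preintegral sheds
  a new one, \<open>F2\<close>. Both have order \<open>Suc (length w)\<close> and the same
  denominator, so their sum is again a single boundary term.\<close>

lemma pd_preint_step:
  assumes w: "set w \<subseteq> S" "length w < R" and i: "i \<in> S"
    and F: "bdry (length w) F" "\<And>x. x \<in> rspace S \<Longrightarrow> pd w (preint g) x = preint (pd w g) x + Ev F x"
  shows "\<exists>F'. bdry (Suc (length w)) F' \<and> (\<forall>x\<in>rspace S.
    ((\<lambda>t. pd w (preint g) (x(i := t))) has_real_derivative preint (pd (i # w) g) x + Ev F' x) (at (x i)))"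
proof -
  have wD: "set w \<subseteq> D" and l: "length w < r" using w R by auto
  have B: "real (2 * Suc (length w) + 1) * Bs j < 1" using order_bound[of "Suc (length w)"] w by simp
  obtain F1 where F1: "bdry (Suc (length w)) F1"
    "\<And>x. x \<in> rspace S \<Longrightarrow> ((\<lambda>t. Ev F (x(i := t))) has_real_derivative Ev F1 x) (at (x i))"
    using Ev_derivative[OF F(1) l B i] by blast
  obtain F2 where F2: "bdry (Suc (length w)) F2" "\<And>x. x \<in> rspace S \<Longrightarrow>
    ((\<lambda>t. preint (pd w g) (x(i := t))) has_real_derivative preint (pd (i # w) g) x + Ev F2 x) (at (x i))"
    using preint_derivative[OF wD l B i] by blast
  have "((\<lambda>t. pd w (preint g) (x(i := t))) has_real_derivative
      preint (pd (i # w) g) x + Ev (\<lambda>y. F2 y + F1 y) x) (at (x i))" if x: "x \<in> rspace S" for x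
  proof -
    have "(\<lambda>t. pd w (preint g) (x(i := t))) = (\<lambda>t. preint (pd w g) (x(i := t)) + Ev F (x(i := t)))"
      using F(2) x i by auto
    moreover have "Ev (\<lambda>y. F2 y + F1 y) x = Ev F2 x + Ev F1 x" by (simp add: Ev_def)
    ultimately show ?thesis
      using DERIV_add[OF F2(2)[OF x] F1(2)[OF x]] by (simp add: add.assoc)
  qed
  with bdry_add[OF F2(1) F1(1)] show ?thesis by blast
qed

lemma pd_preint:
  assumes w: "set w \<subseteq> S" "length w \<le> R"
  shows "\<exists>F. bdry (length w) F \<and> (\<forall>x\<in>rspace S. pd w (preint g) x = preint (pd w g) x + Ev F x)"
  using w
proof (induction w)
  case Nil
  show ?case by (intro exI[of _ "\<lambda>_. 0"]) (simp add: Ev_def)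
next
  case (Cons i w)
  then obtain F where F: "bdry (length w) F" "\<And>x. x \<in> rspace S \<Longrightarrow> pd w (preint g) x = preint (pd w g) x + Ev F x"
    by auto
  have i: "i \<in> S" "set w \<subseteq> S" "length w < R" using Cons.prems by auto
  obtain F' where F': "bdry (Suc (length w)) F'" "\<forall>x\<in>rspace S.
    ((\<lambda>t. pd w (preint g) (x(i := t))) has_real_derivative preint (pd (i # w) g) x + Ev F' x) (at (x i))"
    using pd_preint_step[OF i(2,3,1) F] by blast
  have "pd (i # w) (preint g) x = preint (pd (i # w) g) x + Ev F' x" if x: "x \<in> rspace S" for x
    using F'(2)[rule_format, OF x, THEN DERIV_imp_deriv] by (simp add: partial_deriv_def[of i "pd w (preint g)"])
  with F'(1) show ?case by (intro exI[of _ F']) simp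
qed

text \<open>Generalised over \<open>w\<close> because \<open>Cr_on\<close> recurses into partial
  derivatives; \<open>n + length w\<close> is the invariant order budget.\<close>

lemma Cr_on_pd_preint:
  assumes "set w \<subseteq> S" "n + length w \<le> R"
  shows "Cr_on S n (pd w (preint g))"
  using assms
proof (induction n arbitrary: w)
  case 0
  then obtain F where F: "bdry (length w) F" "\<And>x. x \<in> rspace S \<Longrightarrow> pd w (preint g) x = preint (pd w g) x + Ev F x"
    using pd_preint[of w] by auto
  have w: "set w \<subseteq> D" "length w \<le> r" using 0 R by auto
  have "continuous_on (rspace S) (Ev F)" unfolding continuous_on_def
  proof
    fix x assume x: "x \<in> rspace S"
    have l: "length w \<le> R" using 0 by simp
    show "(Ev F \<longlongrightarrow> Ev F x) (at x within rspace S)"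
      by (rule tendsto_Ev[OF F(1) w(2) order_bound[OF l] x _ tendsto_ident_at])
        (simp add: eventually_at_filter)
  qed
  then have "continuous_on (rspace S) (\<lambda>x. preint (pd w g) x + Ev F x)"
    by (intro continuous_on_add preint_continuous w)
  then show ?case using F(2) by (simp cong: continuous_on_cong)
next
  case (Suc n)
  obtain F where F: "bdry (length w) F" "\<And>x. x \<in> rspace S \<Longrightarrow> pd w (preint g) x = preint (pd w g) x + Ev F x"
    using pd_preint[of w] Suc.prems by auto
  have "has_partial_on S i (pd w (preint g))" if "i \<in> S" for i
    using pd_preint_step[OF Suc.prems(1) _ that F] Suc.prems(2)
    unfolding has_partial_on_def field_differentiable_def by fastforce
  moreover have "Cr_on S n (pd (i # w) (preint g))" if "i \<in> S" for i
    by (rule Suc.IH) (use that Suc.prems in auto)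
  moreover have "continuous_on (rspace S) (pd w (preint g))"
    by (rule Cr_on_continuous, rule Suc.IH) (use Suc.prems in auto)
  ultimately show ?case by simp
qed

text \<open>Lower orders are raised to the common power by \<open>sgrowth_ge_1\<close>, so that one
  exponent per coordinate serves all mixed derivatives.\<close>

lemma pd_preint_bound:
  assumes "set w \<subseteq> S" "length w \<le> R"
  shows "\<exists>C. \<forall>x\<in>rspace S. \<bar>pd w (preint g) x\<bar> \<le> C * sgrowth x ^ (2 * R + 1)"
proof -
  obtain F where F: "bdry (length w) F" "\<And>x. x \<in> rspace S \<Longrightarrow> pd w (preint g) x = preint (pd w g) x + Ev F x"
    using pd_preint[of w] assms by auto
  have w: "set w \<subseteq> D" "length w \<le> r" using assms R by auto
  obtain C1 where C1: "\<And>x. x \<in> rspace S \<Longrightarrow> \<bar>preint (pd w g) x\<bar> \<le> C1 * sgrowth x"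
    using preint_bound[OF w] by blast
  obtain C2 where C2: "\<And>x. x \<in> rspace S \<Longrightarrow> \<bar>Ev F x\<bar> \<le> C2 * sgrowth x ^ (2 * length w + 1)"
    using Ev_bound[OF F(1) w(2) order_bound[OF assms(2)]] by blast
  have "\<bar>pd w (preint g) x\<bar> \<le> (\<bar>C1\<bar> + \<bar>C2\<bar>) * sgrowth x ^ (2 * R + 1)" if x: "x \<in> rspace S" for x
  proof -
    have p: "sgrowth x ^ m \<le> sgrowth x ^ (2 * R + 1)" if "m \<le> 2 * R + 1" for m
      using sgrowth_ge_1 that by (intro power_increasing)
    have nn: "0 \<le> sgrowth x ^ m" for m using sgrowth_ge_1[of x] by simp
    have "\<bar>preint (pd w g) x\<bar> \<le> \<bar>C1\<bar> * sgrowth x ^ 1"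
      using C1[OF x] nn[of 1] by (auto intro: order_trans[OF _ mult_right_mono[OF abs_ge_self]])
    also have "\<dots> \<le> \<bar>C1\<bar> * sgrowth x ^ (2 * R + 1)" by (intro mult_left_mono p) auto
    finally have 1: "\<bar>preint (pd w g) x\<bar> \<le> \<bar>C1\<bar> * sgrowth x ^ (2 * R + 1)" .
    have "\<bar>Ev F x\<bar> \<le> \<bar>C2\<bar> * sgrowth x ^ (2 * length w + 1)"
      by (rule order_trans[OF C2[OF x] mult_right_mono[OF abs_ge_self nn]])
    also have "\<dots> \<le> \<bar>C2\<bar> * sgrowth x ^ (2 * R + 1)" using assms by (intro mult_left_mono p) auto
    finally have 2: "\<bar>Ev F x\<bar> \<le> \<bar>C2\<bar> * sgrowth x ^ (2 * R + 1)" .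
    show ?thesis unfolding F(2)[OF x] distrib_right using 1 2 by linarith
  qed
  then show ?thesis by blast
qed

end

end

subsection \<open>Discrepancy of digital sequences\<close>

text \<open>Signed, and with half-open boxes, so that it is additive in the box and in the set of
  indices. Pieces of zero error can then be peeled off.\<close>

definition box_error ::
    "nat set \<Rightarrow> (nat \<Rightarrow> nat \<Rightarrow> real) \<Rightarrow> nat set \<Rightarrow> (nat \<Rightarrow> real) \<Rightarrow> (nat \<Rightarrow> real) \<Rightarrow> real" where
  "box_error J p S lo hi = real (card {i\<in>J. \<forall>k\<in>S. lo k \<le> p i k \<and> p i k < hi k})
     - real (card J) * (\<Prod>k\<in>S. hi k - lo k)"

lemma box_error_split:
  assumes "finite S" "k \<in> S" "finite J" "lo k \<le> c" "c \<le> hi k"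
  shows "box_error J p S lo hi = box_error J p S lo (hi(k := c)) + box_error J p S (lo(k := c)) hi"
proof -
  let ?A = "{i\<in>J. \<forall>k\<in>S. lo k \<le> p i k \<and> p i k < hi k}"
  let ?B = "{i\<in>J. \<forall>l\<in>S. lo l \<le> p i l \<and> p i l < (hi(k := c)) l}"
  let ?C = "{i\<in>J. \<forall>l\<in>S. (lo(k := c)) l \<le> p i l \<and> p i l < hi l}"
  have "?A = ?B \<union> ?C"
  proof (intro equalityI subsetI)
    fix i assume "i \<in> ?A" then show "i \<in> ?B \<union> ?C" using assms by (cases "p i k < c") auto
  next
    fix i assume i: "i \<in> ?B \<union> ?C"
    have "lo l \<le> p i l \<and> p i l < hi l" if "l \<in> S" for l
      using i that assms(2,4,5) by (cases "l = k") fastforce+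
    with i show "i \<in> ?A" by auto
  qed
  moreover have "?B \<inter> ?C = {}" using assms(2) by fastforce
  ultimately have "card ?A = card ?B + card ?C" using assms(3) by (simp add: card_Un_disjoint)
  moreover have "(\<Prod>l\<in>S. hi l - lo l) = (\<Prod>l\<in>S. (hi(k := c)) l - lo l) + (\<Prod>l\<in>S. hi l - (lo(k := c)) l)"
  proof -
    have "(\<Prod>l\<in>S - {k}. (hi(k := c)) l - lo l) = (\<Prod>l\<in>S - {k}. hi l - lo l)"
      "(\<Prod>l\<in>S - {k}. hi l - (lo(k := c)) l) = (\<Prod>l\<in>S - {k}. hi l - lo l)"
      by (auto intro: prod.cong)
    then show ?thesis by (simp add: prod.remove[OF assms(1,2)] distrib_right[symmetric])
  qed
  ultimately show ?thesis by (simp add: box_error_def algebra_simps)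
qed

lemma box_error_empty:
  assumes "finite S" "k \<in> S" "hi k = lo k" shows "box_error J p S lo hi = 0"
proof -
  have "{i\<in>J. \<forall>k\<in>S. lo k \<le> p i k \<and> p i k < hi k} = {}" using assms(2,3) by fastforce
  moreover have "(\<Prod>k\<in>S. hi k - lo k) = 0" using assms by (intro prod_zero) auto
  ultimately show ?thesis
    by (simp only: box_error_def card.empty of_nat_0 mult_zero_right diff_zero)
qed

lemma box_error_split_sum:
  assumes "finite S" "k \<in> S" "finite J" "\<And>e. e < n \<Longrightarrow> c e \<le> c (Suc e)"
  shows "box_error J p S (lo(k := c 0)) (hi(k := c n))
    = (\<Sum>e<n. box_error J p S (lo(k := c e)) (hi(k := c (Suc e))))"
  using assms(4)
proof (induction n)
  case 0
  then show ?case using box_error_empty[OF assms(1,2)] by simp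
next
  case (Suc n)
  have "c 0 \<le> c n'" if "n' \<le> n" for n'
    using that by (induction n') (auto intro: order_trans[OF _ Suc.prems])
  then have "c 0 \<le> c n" by simp
  then have "box_error J p S (lo(k := c 0)) (hi(k := c (Suc n)))
    = box_error J p S (lo(k := c 0)) (hi(k := c n)) + box_error J p S (lo(k := c n)) (hi(k := c (Suc n)))"
    using box_error_split[OF assms(1-3), of "lo(k := c 0)" "c n" "hi(k := c (Suc n))"] Suc.prems[of n] by simp
  moreover have "box_error J p S (lo(k := c 0)) (hi(k := c n))
    = (\<Sum>e<n. box_error J p S (lo(k := c e)) (hi(k := c (Suc e))))"
    by (rule Suc.IH) (use Suc.prems in simp)
  ultimately show ?case by (simp only: sum.lessThan_Suc)
qed

text \<open>Count and scaled volume are both nonnegative and monotone in the box, so a common bound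
  for the larger box bounds their difference on the smaller one.\<close>

lemma box_error_bound:
  assumes "finite S" "finite J" "\<And>k. k \<in> S \<Longrightarrow> lo k \<le> hi k"
    and sub: "\<And>k. k \<in> S \<Longrightarrow> lo' k \<le> lo k \<and> hi k \<le> hi' k"
    and c: "real (card {i\<in>J. \<forall>k\<in>S. lo' k \<le> p i k \<and> p i k < hi' k}) \<le> c"
      "real (card J) * (\<Prod>k\<in>S. hi' k - lo' k) \<le> c"
  shows "\<bar>box_error J p S lo hi\<bar> \<le> c"
proof -
  have "card {i\<in>J. \<forall>k\<in>S. lo k \<le> p i k \<and> p i k < hi k} \<le> card {i\<in>J. \<forall>k\<in>S. lo' k \<le> p i k \<and> p i k < hi' k}"
    using sub assms(2) by (intro card_mono) (auto intro: order_trans order_less_le_trans)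
  moreover have "real (card J) * (\<Prod>k\<in>S. hi k - lo k) \<le> real (card J) * (\<Prod>k\<in>S. hi' k - lo' k)"
    using sub assms(3) by (intro mult_left_mono prod_mono) (force simp: diff_mono)+
  moreover have "0 \<le> real (card J) * (\<Prod>k\<in>S. hi k - lo k)"
    using assms(3) by (intro mult_nonneg_nonneg prod_nonneg) auto
  ultimately show ?thesis using c unfolding box_error_def by linarith
qed

lemma box_error_Un:
  assumes "finite J" "finite J'" "J \<inter> J' = {}"
  shows "box_error (J \<union> J') p S lo hi = box_error J p S lo hi + box_error J' p S lo hi"
proof -
  have "{i\<in>J \<union> J'. \<forall>k\<in>S. lo k \<le> p i k \<and> p i k < hi k}
      = {i\<in>J. \<forall>k\<in>S. lo k \<le> p i k \<and> p i k < hi k} \<union> {i\<in>J'. \<forall>k\<in>S. lo k \<le> p i k \<and> p i k < hi k}"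
    by blast
  moreover have "{i\<in>J. \<forall>k\<in>S. lo k \<le> p i k \<and> p i k < hi k} \<inter> {i\<in>J'. \<forall>k\<in>S. lo k \<le> p i k \<and> p i k < hi k} = {}"
    using assms(3) by blast
  ultimately show ?thesis
    using assms by (simp add: box_error_def card_Un_disjoint algebra_simps)
qed

section \<open>Anchored boxes and a single net\<close>

locale net =
  fixes b t m :: nat and S J :: "nat set" and p :: "nat \<Rightarrow> nat \<Rightarrow> real"
  assumes b: "2 \<le> b" and S: "finite S" and tm: "t \<le> m" and net: "tms_net b t m S J p"
begin

lemma finite_J: "finite J" and card_J: "card J = b ^ m"
  using net by (auto simp: tms_net_def)

lemma volume_eq: "(\<Prod>k\<in>S. 1 / real b ^ l k) = 1 / real b ^ (\<Sum>k\<in>S. l k)"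
  by (simp add: prod_dividef power_sum)

lemma elementary_count:
  assumes "\<And>k. k \<in> S \<Longrightarrow> a k < b ^ l k" "(\<Sum>k\<in>S. l k) = m - t"
  shows "card {i\<in>J. \<forall>k\<in>S. real (a k) / real b ^ l k \<le> p i k \<and> p i k < (real (a k) + 1) / real b ^ l k} = b ^ t"
proof -
  have "(\<Prod>k\<in>S. 1 / real b ^ l k) = real b powi (int t - int m)"
    unfolding volume_eq assms(2) using tm b
    by (simp add: power_int_def nat_diff_distrib divide_inverse power_inverse)
  then have "card {i\<in>J. p i \<in> elementary_box b S l a} = b ^ t"
    using net assms(1) unfolding tms_net_def by blast
  then show ?thesis by (simp add: elementary_box_def)
qed

text \<open>A \<open>b\<close>-adic box larger than those in the definition of a net is cut into
  \<open>b\<close> children along one coordinate until the volume is \<open>b^(t - m)\<close>; the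
  zero errors add up.\<close>

lemma elementary_error:
  assumes "\<And>k. k \<in> S \<Longrightarrow> a k < b ^ l k" "(\<Sum>k\<in>S. l k) \<le> m - t"
  shows "box_error J p S (\<lambda>k. real (a k) / real b ^ l k) (\<lambda>k. (real (a k) + 1) / real b ^ l k) = 0"
  using assms
proof (induction "m - t - (\<Sum>k\<in>S. l k)" arbitrary: l a)
  case 0
  then have s: "(\<Sum>k\<in>S. l k) = m - t" by simp
  have "(\<Prod>k\<in>S. (real (a k) + 1) / real b ^ l k - real (a k) / real b ^ l k) = (\<Prod>k\<in>S. 1 / real b ^ l k)"
    by (intro prod.cong) (auto simp: diff_divide_distrib[symmetric])
  then show ?case using elementary_count[OF 0(2) s] tm b unfolding box_error_def volume_eq s card_J
    by (simp add: power_diff)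
next
  case (Suc N)
  show ?case
  proof (cases "S = {}")
    case False
    then obtain k where k: "k \<in> S" by blast
    \<comment> \<open>End points of the \<open>b\<close> children of the interval in coordinate
      \<open>k\<close>.\<close>
    define c where "c e = real (b * a k + e) / real b ^ Suc (l k)" for e
    let ?lo = "\<lambda>k. real (a k) / real b ^ l k" and ?hi = "\<lambda>k. (real (a k) + 1) / real b ^ l k"
    have "box_error J p S (?lo(k := c 0)) (?hi(k := c b))
      = (\<Sum>e<b. box_error J p S (?lo(k := c e)) (?hi(k := c (Suc e))))"
      by (rule box_error_split_sum[OF S k finite_J]) (use b in \<open>auto simp: c_def divide_right_mono\<close>)
    moreover have "?lo(k := c 0) = ?lo" "?hi(k := c b) = ?hi"
      using b by (auto simp: c_def field_simps)
    moreover have "box_error J p S (?lo(k := c e)) (?hi(k := c (Suc e))) = 0" if e: "e < b" for e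
    proof -
      have sum: "(\<Sum>i\<in>S. (l(k := Suc (l k))) i) = Suc (\<Sum>i\<in>S. l i)"
      proof -
        have "(\<Sum>i\<in>S - {k}. (l(k := Suc (l k))) i) = (\<Sum>i\<in>S - {k}. l i)" by (intro sum.cong) auto
        then show ?thesis by (simp add: sum.remove[OF S k])
      qed
      have lt: "b * a k + e < b ^ Suc (l k)"
      proof -
        have "b * a k + e < b * Suc (a k)" using e by simp
        also have "\<dots> \<le> b * b ^ l k" using Suc.prems(1)[OF k] by (intro mult_le_mono2) simp
        finally show ?thesis by simp
      qed
      let ?l = "l(k := Suc (l k))" and ?a = "a(k := b * a k + e)"
      have "box_error J p S (\<lambda>i. real (?a i) / real b ^ ?l i) (\<lambda>i. (real (?a i) + 1) / real b ^ ?l i) = 0"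
      proof (rule Suc.hyps(1))
        show "N = m - t - (\<Sum>i\<in>S. ?l i)" "(\<Sum>i\<in>S. ?l i) \<le> m - t" unfolding sum using Suc.hyps(2) by auto
        show "?a i < b ^ ?l i" if "i \<in> S" for i using Suc.prems(1) that lt by (cases "i = k") auto
      qed
      moreover have "(\<lambda>i. real (?a i) / real b ^ ?l i) = ?lo(k := c e)"
        "(\<lambda>i. (real (?a i) + 1) / real b ^ ?l i) = ?hi(k := c (Suc e))"
        by (auto simp: c_def ac_simps)
      ultimately show ?thesis by simp
    qed
    ultimately show ?thesis by simp
  qed (simp add: box_error_def)
qed

text \<open>Coordinate by coordinate, an anchored interval is peeled into \<open>b\<close>-adic intervals until
  the volume has dropped to \<open>b^(t - m)\<close>; only the last remainders contribute to the error.\<close>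

lemma mixed_box_error:
  assumes "finite Q" "Q \<subseteq> S" "\<And>k. k \<in> Q \<Longrightarrow> 0 \<le> z k \<and> z k < 1"
    and "\<And>k. k \<in> S - Q \<Longrightarrow> a k < b ^ l k" "(\<Sum>k\<in>S - Q. l k) \<le> m - t"
  shows "\<bar>box_error J p S (\<lambda>k. if k \<in> Q then 0 else real (a k) / real b ^ l k)
      (\<lambda>k. if k \<in> Q then z k else (real (a k) + 1) / real b ^ l k)\<bar> \<le> real (b ^ t * (b * m + 1) ^ card Q)"
  using assms
proof (induction Q arbitrary: a l rule: finite_induct)
  case empty
  then show ?case using elementary_error[of a l] by simp
next
  case (insert k Q)
  have kS: "k \<in> S" using insert by auto
  define E where "E = real (b ^ t * (b * m + 1) ^ card Q)"
  define s where "s = (\<Sum>i\<in>S - insert k Q. l i)"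
  \<comment> \<open>Index of the \<open>b\<close>-adic interval of level \<open>n\<close> that
    contains \<open>z k\<close>.\<close>
  define fl where "fl n = nat \<lfloor>z k * real b ^ n\<rfloor>" for n
  define lo where "lo = (\<lambda>i. if i \<in> insert k Q then 0 else real (a i) / real b ^ l i)"
  define hi where "hi = (\<lambda>i. if i \<in> insert k Q then z i else (real (a i) + 1) / real b ^ l i)"
  have z: "0 \<le> z k" "z k < 1" using insert.prems(2)[of k] by auto
  have bpos: "0 < real b" using b by simp
  have fl: "real (fl n) \<le> z k * real b ^ n" "z k * real b ^ n < real (fl n) + 1" for n
    using z by (auto simp: fl_def of_nat_nat)
  have fl_le: "real (fl n) / real b ^ n \<le> z k" "z k < (real (fl n) + 1) / real b ^ n" for n
    using fl[of n] bpos by (auto simp: field_simps)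
  have fl_lt: "fl n < b ^ n" for n
  proof -
    have "z k * real b ^ n < 1 * real b ^ n" using z bpos by (intro mult_strict_right_mono) auto
    then have "real (fl n) < real b ^ n" using fl(1)[of n] by linarith
    then show ?thesis by simp
  qed
  have fl_Suc: "b * fl n \<le> fl (Suc n)" "fl (Suc n) < b * fl n + b" for n
  proof -
    have "real b * real (fl n) \<le> z k * real b ^ Suc n" using fl(1)[of n] bpos by (simp add: ac_simps)
    also have "\<dots> < real (fl (Suc n)) + 1" by (rule fl(2))
    finally have "real (b * fl n) < real (Suc (fl (Suc n)))" by simp
    then show "b * fl n \<le> fl (Suc n)" unfolding of_nat_less_iff by simp
    have "real (fl (Suc n)) \<le> real b * (z k * real b ^ n)" using fl(1)[of "Suc n"] by (simp add: ac_simps)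
    also have "\<dots> < real b * (real (fl n) + 1)" using fl(2)[of n] bpos by (intro mult_strict_left_mono)
    also have "\<dots> = real (b * fl n + b)" by (simp add: algebra_simps)
    finally show "fl (Suc n) < b * fl n + b" unfolding of_nat_less_iff .
  qed
  have SQ: "S - Q = insert k (S - insert k Q)" using kS insert.hyps by auto
  have sumQ: "(\<Sum>i\<in>S - Q. (l(k := n)) i) = n + s" for n
  proof -
    have "(\<Sum>i\<in>S - insert k Q. (l(k := n)) i) = s" unfolding s_def by (intro sum.cong) auto
    then show ?thesis unfolding SQ using S by (subst sum.insert) auto
  qed
  \<comment> \<open>Error of what is left of the anchored interval once its \<open>b\<close>-adic
    part of level \<open>n\<close> is removed. Passing to the next level peels off fewer than
    \<open>b\<close> intervals, each of error at most \<open>E\<close>.\<close>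
  have tail: "\<bar>box_error J p S (lo(k := real (fl n) / real b ^ n)) hi\<bar> \<le> real (m - t - s - n) * real b * E + real (b ^ t)"
    if "n \<le> m - t - s" for n
    using that
  proof (induction "m - t - s - n" arbitrary: n)
    case 0
    then have n: "n = m - t - s" by simp
    \<comment> \<open>At the finest level the remainder is enclosed in an elementary box: level 0,
      the full unit interval, in the coordinates of \<open>Q\<close>, and level \<open>n\<close> in
      \<open>k\<close>. Its volume is exactly \<open>b^(t - m)\<close>, so both its count and its
      scaled volume are \<open>b ^ t\<close>.\<close>
    define l' where "l' = (\<lambda>i. if i \<in> Q then 0 else (l(k := n)) i)"
    define a' where "a' = (\<lambda>i. if i \<in> Q then 0 else (a(k := fl n)) i)"
    have "(\<Sum>i\<in>S. l' i) = (\<Sum>i\<in>S - Q. (l(k := n)) i)"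
      unfolding l'_def using S by (intro sum.mono_neutral_cong_right) auto
    then have sum: "(\<Sum>i\<in>S. l' i) = m - t" using sumQ[of n] n insert.prems(4) by (simp add: s_def)
    have "\<bar>box_error J p S (lo(k := real (fl n) / real b ^ n)) hi\<bar> \<le> real (b ^ t)"
    proof (rule box_error_bound[OF S finite_J, where lo'="\<lambda>i. real (a' i) / real b ^ l' i"
          and hi'="\<lambda>i. (real (a' i) + 1) / real b ^ l' i"])
      show "(lo(k := real (fl n) / real b ^ n)) i \<le> hi i" if "i \<in> S" for i
        using insert.prems(2)[of i] fl_le[of n] b by (auto simp: lo_def hi_def divide_right_mono)
      show "real (a' i) / real b ^ l' i \<le> (lo(k := real (fl n) / real b ^ n)) i \<and> hi i \<le> (real (a' i) + 1) / real b ^ l' i"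
        if "i \<in> S" for i
        using insert.prems(2)[of i] fl_le(2)[of n] insert.hyps(2) by (auto simp: lo_def hi_def a'_def l'_def less_imp_le)
      have "a' i < b ^ l' i" if "i \<in> S" for i
        using that insert.prems(3)[of i] fl_lt[of n] by (auto simp: a'_def l'_def)
      from elementary_count[OF this sum]
      show "real (card {i\<in>J. \<forall>k\<in>S. real (a' k) / real b ^ l' k \<le> p i k \<and> p i k < (real (a' k) + 1) / real b ^ l' k}) \<le> real (b ^ t)"
        by simp
      have "(\<Prod>k\<in>S. (real (a' k) + 1) / real b ^ l' k - real (a' k) / real b ^ l' k) = 1 / real b ^ (m - t)"
        unfolding sum[symmetric] volume_eq[symmetric] by (intro prod.cong) (auto simp: diff_divide_distrib[symmetric])
      then show "real (card J) * (\<Prod>k\<in>S. (real (a' k) + 1) / real b ^ l' k - real (a' k) / real b ^ l' k) \<le> real (b ^ t)"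
        using tm b by (simp add: card_J power_diff)
    qed
    moreover have "real (m - t - s - n) = 0" using 0 by simp
    ultimately show ?case by (simp only: mult_zero_left add_0)
  next
    case (Suc N)
    define c where "c e = real (b * fl n + e) / real b ^ Suc n" for e
    define dg where "dg = fl (Suc n) - b * fl n"
    have dg: "dg < b" "b * fl n + dg = fl (Suc n)" using fl_Suc[of n] by (auto simp: dg_def)
    have c0: "c 0 = real (fl n) / real b ^ n" using bpos by (simp add: c_def)
    have cdg: "c dg = real (fl (Suc n)) / real b ^ Suc n" unfolding c_def dg(2) ..
    have cmono: "c e \<le> c (Suc e)" for e using bpos by (simp add: c_def divide_right_mono)
    have "c 0 \<le> c dg" unfolding c_def using bpos by (intro divide_right_mono) auto
    moreover have "c dg \<le> hi k" using fl_le(1)[of "Suc n"] by (simp add: hi_def cdg)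
    ultimately have "box_error J p S (lo(k := c 0)) hi
      = box_error J p S (lo(k := c 0)) (hi(k := c dg)) + box_error J p S (lo(k := c dg)) hi"
      using box_error_split[OF S kS finite_J, of "lo(k := c 0)" "c dg" hi] by simp
    also have "box_error J p S (lo(k := c 0)) (hi(k := c dg))
      = (\<Sum>e<dg. box_error J p S (lo(k := c e)) (hi(k := c (Suc e))))"
      by (rule box_error_split_sum[OF S kS finite_J, of dg c, OF cmono])
    finally have eq: "box_error J p S (lo(k := c 0)) hi
      = (\<Sum>e<dg. box_error J p S (lo(k := c e)) (hi(k := c (Suc e)))) + box_error J p S (lo(k := c dg)) hi" .
    \<comment> \<open>Coordinate \<open>k\<close> is now confined to a \<open>b\<close>-adic
      interval of level \<open>Suc n\<close>, and the total level is still at most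
      \<open>m - t\<close>: the induction hypothesis for \<open>Q\<close> applies.\<close>
    have piece: "\<bar>box_error J p S (lo(k := c e)) (hi(k := c (Suc e)))\<bar> \<le> E" if "e < dg" for e
    proof -
      let ?l = "l(k := Suc n)" and ?a = "a(k := b * fl n + e)"
      have "\<bar>box_error J p S (\<lambda>i. if i \<in> Q then 0 else real (?a i) / real b ^ ?l i)
        (\<lambda>i. if i \<in> Q then z i else (real (?a i) + 1) / real b ^ ?l i)\<bar> \<le> real (b ^ t * (b * m + 1) ^ card Q)"
      proof (rule insert.IH)
        show "?a i < b ^ ?l i" if "i \<in> S - Q" for i
          using that insert.prems(3)[of i] \<open>e < dg\<close> dg(2) fl_lt[of "Suc n"] by (cases "i = k") auto
        show "(\<Sum>i\<in>S - Q. ?l i) \<le> m - t" unfolding sumQ using Suc.hyps(2) by simp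
      qed (use insert.prems in auto)
      moreover have "(\<lambda>i. if i \<in> Q then 0 else real (?a i) / real b ^ ?l i) = lo(k := c e)"
        "(\<lambda>i. if i \<in> Q then z i else (real (?a i) + 1) / real b ^ ?l i) = hi(k := c (Suc e))"
        using insert.hyps(2) by (auto simp: lo_def hi_def c_def ac_simps)
      ultimately show ?thesis by (simp add: E_def)
    qed
    have "\<bar>box_error J p S (lo(k := c dg)) hi\<bar> \<le> real (m - t - s - Suc n) * real b * E + real (b ^ t)"
      unfolding cdg by (rule Suc.hyps(1)) (use Suc.hyps(2) in auto)
    moreover have "\<bar>\<Sum>e<dg. box_error J p S (lo(k := c e)) (hi(k := c (Suc e)))\<bar> \<le> (\<Sum>e<dg. E)"
      by (rule order_trans[OF sum_abs]) (intro sum_mono piece, simp)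
    moreover have "(\<Sum>e<dg. E) \<le> real b * E" using dg(1) by (auto simp: E_def intro!: mult_right_mono)
    moreover have "real (m - t - s - n) = real (m - t - s - Suc n) + 1" using Suc.hyps(2) by simp
    ultimately show ?case unfolding c0[symmetric] eq by (simp add: algebra_simps)
  qed
  have "fl 0 = 0" using z by (simp add: fl_def floor_eq_iff)
  then have "\<bar>box_error J p S lo hi\<bar> \<le> real (m - t - s) * real b * E + real (b ^ t)"
    using tail[of 0] by (simp add: lo_def fun_upd_idem)
  also have "\<dots> \<le> real m * real b * E + E"
  proof (intro add_mono mult_right_mono)
    show "real (b ^ t) \<le> E" unfolding E_def of_nat_le_iff by simp
  qed (auto simp: E_def)
  also have "\<dots> = real (b ^ t * (b * m + 1) ^ card (insert k Q))"
    using insert.hyps by (simp add: E_def algebra_simps)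
  finally show ?case by (simp add: lo_def hi_def)
qed

text \<open>Coordinates outside \<open>Q\<close> run over the full unit interval, which is the
  \<open>b\<close>-adic interval of level 0.\<close>

lemma anchored_box_error:
  assumes "Q \<subseteq> S" "\<And>k. k \<in> Q \<Longrightarrow> 0 \<le> z k \<and> z k < 1"
  shows "\<bar>box_error J p S (\<lambda>_. 0) (\<lambda>k. if k \<in> Q then z k else 1)\<bar> \<le> real (b ^ t * (b * m + 1) ^ card S)"
proof -
  have "\<bar>box_error J p S (\<lambda>_. 0) (\<lambda>k. if k \<in> Q then z k else 1)\<bar> \<le> real (b ^ t * (b * m + 1) ^ card Q)"
  proof -
    have "(\<lambda>k. if k \<in> Q then 0 else real 0 / real b ^ 0) = (\<lambda>_. 0)"
      "(\<lambda>k. if k \<in> Q then z k else (real 0 + 1) / real b ^ 0) = (\<lambda>k. if k \<in> Q then z k else 1)" by auto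
    then show ?thesis
      using mixed_box_error[of Q z "\<lambda>_. 0" "\<lambda>_. 0"] assms finite_subset[OF assms(1) S] by (simp only:) simp
  qed
  also have "\<dots> \<le> real (b ^ t * (b * m + 1) ^ card S)"
    unfolding of_nat_le_iff using assms(1) S by (intro mult_le_mono2 power_increasing card_mono) auto
  finally show ?thesis .
qed

end

section \<open>From nets to initial segments of a sequence\<close>

lemma box_error_trivial_bound:
  assumes "finite S" "finite J" "\<And>k. k \<in> S \<Longrightarrow> 0 \<le> lo k \<and> lo k \<le> hi k \<and> hi k \<le> 1"
  shows "\<bar>box_error J p S lo hi\<bar> \<le> real (card J)"
proof -
  have "card {i\<in>J. \<forall>k\<in>S. lo k \<le> p i k \<and> p i k < hi k} \<le> card J"
    using assms(2) by (intro card_mono) auto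
  moreover have "0 \<le> (\<Prod>k\<in>S. hi k - lo k)" "(\<Prod>k\<in>S. hi k - lo k) \<le> 1"
    using assms(3) by (auto intro!: prod_nonneg prod_le_1) (smt (verit))
  then have "0 \<le> real (card J) * (\<Prod>k\<in>S. hi k - lo k)" "real (card J) * (\<Prod>k\<in>S. hi k - lo k) \<le> real (card J)"
    by (auto simp: mult_left_le)
  ultimately show ?thesis unfolding box_error_def by linarith
qed

text \<open>The base-\<open>b\<close> expansion of \<open>n\<close> cuts the segment into fewer than
  \<open>b\<close> blocks of each length b^i. A block is a net if its length is at least b^t and is
  estimated trivially otherwise. \<open>M\<close> is kept apart from the induction variable to have
  one error bound for all levels.\<close>

lemma sequence_block_error:
  assumes seq: "ts_sequence b t S p" and b: "2 \<le> b" and S: "finite S"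
    and Q: "Q \<subseteq> S" "\<And>k. k \<in> Q \<Longrightarrow> 0 \<le> z k \<and> z k < 1"
    and m: "m \<le> M" "n < b ^ m"
  shows "\<bar>box_error {c * b ^ m + 1..c * b ^ m + n} p S (\<lambda>_. 0) (\<lambda>k. if k \<in> Q then z k else 1)\<bar>
    \<le> real m * real b * real (b ^ t * (b * M + 1) ^ card S)"
  using m
proof (induction m arbitrary: c n)
  case 0
  then show ?case by (simp add: box_error_def)
next
  case (Suc m)
  let ?err = "\<lambda>J. box_error J p S (\<lambda>_. 0) (\<lambda>k. if k \<in> Q then z k else 1)"
  define E where "E = real (b ^ t * (b * M + 1) ^ card S)"
  have E: "0 \<le> E" by (simp add: E_def)
  have block: "\<bar>?err {k * b ^ m + 1..(k + 1) * b ^ m}\<bar> \<le> E" for k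
  proof (cases "t \<le> m")
    case True
    then interpret net b t m S "{k * b ^ m + 1..(k + 1) * b ^ m}" p
      using seq b S by unfold_locales (auto simp: ts_sequence_def)
    have "\<bar>?err {k * b ^ m + 1..(k + 1) * b ^ m}\<bar> \<le> real (b ^ t * (b * m + 1) ^ card S)"
      by (rule anchored_box_error[OF Q])
    also have "\<dots> \<le> E" unfolding E_def of_nat_le_iff using Suc.prems(1) by (intro mult_le_mono2 power_mono) auto
    finally show ?thesis .
  next
    case False
    have "\<bar>?err {k * b ^ m + 1..(k + 1) * b ^ m}\<bar> \<le> real (card {k * b ^ m + 1..(k + 1) * b ^ m})"
      by (rule box_error_trivial_bound[OF S]) (use Q in \<open>auto simp: less_imp_le\<close>)
    also have "\<dots> = real (b ^ m)" by simp
    also have "\<dots> \<le> real (b ^ t * 1)" unfolding of_nat_le_iff using False b by (simp add: power_increasing)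
    also have "\<dots> \<le> E" unfolding E_def of_nat_le_iff by (intro mult_le_mono2) simp
    finally show ?thesis .
  qed
  define q where "q = n div b ^ m"
  define n' where "n' = n mod b ^ m"
  have n: "n = q * b ^ m + n'" unfolding q_def n'_def by (rule div_mult_mod_eq[symmetric])
  have q: "q < b" unfolding q_def using Suc.prems(2) by (simp add: less_mult_imp_div_less)
  have n': "n' < b ^ m" unfolding n'_def using b by simp
  have blocks: "\<bar>?err {a * b ^ m + 1..(a + e) * b ^ m}\<bar> \<le> real e * E" for a e
  proof (induction e)
    case 0
    show ?case by (simp add: box_error_def)
  next
    case (Suc e)
    have "{a * b ^ m + 1..(a + Suc e) * b ^ m}
      = {a * b ^ m + 1..(a + e) * b ^ m} \<union> {(a + e) * b ^ m + 1..((a + e) + 1) * b ^ m}"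
      by (auto simp: algebra_simps)
    then have "?err {a * b ^ m + 1..(a + Suc e) * b ^ m}
      = ?err {a * b ^ m + 1..(a + e) * b ^ m} + ?err {(a + e) * b ^ m + 1..((a + e) + 1) * b ^ m}"
      by (simp only:) (rule box_error_Un, auto)
    then show ?case using Suc block[of "a + e"] by (simp add: distrib_right)
  qed
  have "{c * b ^ Suc m + 1..c * b ^ Suc m + n}
    = {(c * b) * b ^ m + 1..(c * b + q) * b ^ m} \<union> {(c * b + q) * b ^ m + 1..(c * b + q) * b ^ m + n'}"
    unfolding n by (auto simp: algebra_simps)
  then have "?err {c * b ^ Suc m + 1..c * b ^ Suc m + n}
    = ?err {(c * b) * b ^ m + 1..(c * b + q) * b ^ m} + ?err {(c * b + q) * b ^ m + 1..(c * b + q) * b ^ m + n'}"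
    by (simp only:) (rule box_error_Un, auto)
  moreover have "\<bar>?err {(c * b) * b ^ m + 1..(c * b + q) * b ^ m}\<bar> \<le> real q * E" by (rule blocks)
  moreover have "real q * E \<le> real b * E" using q E by (intro mult_right_mono) auto
  moreover have "\<bar>?err {(c * b + q) * b ^ m + 1..(c * b + q) * b ^ m + n'}\<bar> \<le> real m * real b * E"
    unfolding E_def by (rule Suc.IH) (use Suc.prems n' in auto)
  ultimately show ?case unfolding E_def[symmetric] by (simp add: algebra_simps)
qed

lemma ln_power_bound:
  fixes \<epsilon> :: real
  assumes \<epsilon>: "0 < \<epsilon>" and b: "2 \<le> (b::nat)"
  obtains C where "0 \<le> C"
    "\<And>n. 1 \<le> n \<Longrightarrow> \<exists>m. n < b ^ m \<and> real ((b * m + 1) ^ s) \<le> C * real n powr \<epsilon>"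
proof -
  \<comment> \<open>Each of the \<open>s\<close> factors may grow like
    \<open>n powr \<delta>\<close>; dividing by \<open>s + 1\<close> covers \<open>s = 0\<close>
    too.\<close>
  define \<delta> where "\<delta> = \<epsilon> / real (s + 1)"
  define K where "K = real b * (1 + 1 / (\<delta> * ln (real b))) + 1"
  have \<delta>: "0 < \<delta>" using \<epsilon> by (simp add: \<delta>_def)
  have lnb: "0 < ln (real b)" using b by simp
  have K: "1 \<le> K" using \<delta> lnb by (simp add: K_def)
  show ?thesis
  proof (rule that)
    show "0 \<le> K ^ s" using K by simp
    fix n :: nat assume n: "1 \<le> n"
    define m where "m = Suc (nat \<lfloor>log (real b) (real n)\<rfloor>)"
    have l0: "0 \<le> log (real b) (real n)" using n b by simp
    have "log (real b) (real n) < real m"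
      unfolding m_def using l0 by (simp add: of_nat_nat) linarith
    then have nb: "n < b ^ m"
    proof -
      have "real n < real b powr real m"
        using \<open>log (real b) (real n) < real m\<close> n b by (subst (asm) log_less_iff) auto
      then have "real n < real (b ^ m)" using b by (simp add: powr_realpow)
      then show ?thesis unfolding of_nat_less_iff .
    qed
    have "real m \<le> 1 + log (real b) (real n)" unfolding m_def using l0 by (simp add: of_nat_nat)
    also have "log (real b) (real n) \<le> (real n powr \<delta> / \<delta>) / ln (real b)"
      unfolding log_def using lnb n \<delta> by (intro divide_right_mono ln_powr_bound) auto
    finally have m: "real m \<le> 1 + (1 / (\<delta> * ln (real b))) * real n powr \<delta>" by simp
    have n1: "1 \<le> real n powr \<delta>" using n \<delta> by (simp add: ge_one_powr_ge_zero)
    have "real (b * m + 1) \<le> real b * (1 + (1 / (\<delta> * ln (real b))) * real n powr \<delta>) + 1"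
      using m by (simp add: mult_left_mono)
    also have "\<dots> \<le> real b * (1 * real n powr \<delta> + (1 / (\<delta> * ln (real b))) * real n powr \<delta>) + 1 * real n powr \<delta>"
      using n1 \<delta> lnb by (intro add_mono mult_left_mono) auto
    also have "\<dots> = K * real n powr \<delta>" by (simp add: K_def algebra_simps)
    finally have "real ((b * m + 1) ^ s) \<le> (K * real n powr \<delta>) ^ s"
      unfolding of_nat_power by (intro power_mono) auto
    also have "\<dots> = K ^ s * real n powr (\<delta> * real s)"
      using n by (simp add: power_mult_distrib powr_powr[symmetric] powr_realpow)
    also have "\<dots> \<le> K ^ s * real n powr \<epsilon>"
      using n K \<epsilon> by (intro mult_left_mono powr_mono) (auto simp: \<delta>_def field_simps)
    finally show "\<exists>m. n < b ^ m \<and> real ((b * m + 1) ^ s) \<le> K ^ s * real n powr \<epsilon>" using nb by blast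
  qed
qed

text \<open>The constant is fixed before the sequence \<open>p\<close>. This uniformity is what
  allows the bound to be applied to a scrambled sequence, which varies with the random
  outcome.\<close>

lemma sequence_discrepancy:
  fixes \<epsilon> :: real and b t :: nat and S :: "nat set"
  assumes b: "2 \<le> b" and S: "finite S" and \<epsilon>: "0 < \<epsilon>"
  obtains C :: real where "0 \<le> C"
    "\<And>(p :: nat \<Rightarrow> nat \<Rightarrow> real) (n :: nat) (Q :: nat set) (z :: nat \<Rightarrow> real). \<lbrakk>ts_sequence b t S p; 1 \<le> n; Q \<subseteq> S; \<And>k. k \<in> Q \<Longrightarrow> 0 \<le> z k \<and> z k < 1\<rbrakk> \<Longrightarrow>
      \<bar>real (card {i\<in>{1..n}. \<forall>k\<in>Q. p i k < z k}) - real n * (\<Prod>k\<in>Q. z k)\<bar> \<le> C * real n powr \<epsilon>"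
proof -
  obtain C where C: "0 \<le> C"
    "\<And>n. 1 \<le> n \<Longrightarrow> \<exists>m. n < b ^ m \<and> real ((b * m + 1) ^ Suc (card S)) \<le> C * real n powr \<epsilon>"
    using ln_power_bound[OF \<epsilon> b] by blast
  show ?thesis
  proof (rule that)
    show "0 \<le> real (b ^ t) * C" using C(1) by simp
    fix p :: "nat \<Rightarrow> nat \<Rightarrow> real" and n :: nat and Q :: "nat set" and z :: "nat \<Rightarrow> real"
    assume seq: "ts_sequence b t S p" and n: "1 \<le> n" and Q: "Q \<subseteq> S" "\<And>k. k \<in> Q \<Longrightarrow> 0 \<le> z k \<and> z k < (1::real)"
    obtain m where m: "n < b ^ m" "real ((b * m + 1) ^ Suc (card S)) \<le> C * real n powr \<epsilon>" using C(2)[OF n] by blast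
    \<comment> \<open>The first \<open>n\<close> points belong to the initial net of size
      \<open>b ^ (m + t)\<close>, hence lie in the unit cube; the extra \<open>t\<close> meets the
      minimal size of nets.\<close>
    have pts: "0 \<le> p i k \<and> p i k < 1" if "i \<in> {1..n}" "k \<in> S" for i k
    proof -
      have "n < b ^ (m + t)" using m(1) b by (auto intro: order_less_le_trans[OF _ power_increasing])
      then have "i \<in> {0 * b ^ (m + t) + 1..(0 + 1) * b ^ (m + t)}" using that(1) by simp
      moreover have "tms_net b t (m + t) S {0 * b ^ (m + t) + 1..(0 + 1) * b ^ (m + t)} p"
        using seq unfolding ts_sequence_def by (meson le_add2)
      ultimately show ?thesis using that(2) unfolding tms_net_def by (meson atLeastLessThan_iff)
    qed
    have "{i\<in>{1..n}. \<forall>k\<in>Q. p i k < z k}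
      = {i\<in>{1..n}. \<forall>k\<in>S. 0 \<le> p i k \<and> p i k < (if k \<in> Q then z k else 1)}"
      using pts Q(1) by (auto split: if_splits)
    moreover have "(\<Prod>k\<in>S. (if k \<in> Q then z k else 1) - 0) = (\<Prod>k\<in>Q. z k)"
      using S Q(1) by (intro prod.mono_neutral_cong_right) auto
    ultimately have "real (card {i\<in>{1..n}. \<forall>k\<in>Q. p i k < z k}) - real n * (\<Prod>k\<in>Q. z k)
      = box_error {1..n} p S (\<lambda>_. 0) (\<lambda>k. if k \<in> Q then z k else 1)"
      unfolding box_error_def by simp
    also have "\<bar>\<dots>\<bar> \<le> real m * real b * real (b ^ t * (b * m + 1) ^ card S)"
      using sequence_block_error[OF seq b S Q order_refl m(1), where c=0] by simp
    also have "\<dots> \<le> real (b ^ t) * real ((b * m + 1) ^ Suc (card S))"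
      unfolding of_nat_mult[symmetric] of_nat_le_iff by (simp add: algebra_simps)
    also have "\<dots> \<le> real (b ^ t) * (C * real n powr \<epsilon>)" by (intro mult_left_mono m(2)) simp
    finally show "\<bar>real (card {i\<in>{1..n}. \<forall>k\<in>Q. p i k < z k}) - real n * (\<Prod>k\<in>Q. z k)\<bar> \<le> real (b ^ t) * C * real n powr \<epsilon>"
      by (simp add: ac_simps)
  qed
qed

subsection \<open>Scrambling\<close>

text \<open>Composition with the transposition of \<open>e\<close> and \<open>e'\<close> maps the
  permutations taking \<open>a\<close> to \<open>e\<close> injectively into those taking
  \<open>a\<close> to \<open>e'\<close>, and these classes are disjoint for the \<open>b\<close>
  values of \<open>e'\<close>.\<close>

lemma card_permutations_fixed_value_le:
  assumes "a < b" shows "b * card {\<sigma>. \<sigma> permutes {..<b} \<and> \<sigma> a = e} \<le> card (digit_perms b)"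
proof (cases "e < b")
  case False
  have "\<sigma> a \<noteq> e" if "\<sigma> permutes {..<b}" for \<sigma>
    using permutes_in_image[OF that, of a] assms False by auto
  then have "{\<sigma>. \<sigma> permutes {..<b} \<and> \<sigma> a = e} = {}" by auto
  then show ?thesis by (simp only: card.empty)
next
  case True
  define P where "P e' = {\<sigma>. \<sigma> permutes {..<b} \<and> \<sigma> a = e'}" for e'
  have fin: "finite (P e')" for e'
    by (rule finite_subset[OF _ finite_permutations[of "{..<b}"]]) (auto simp: P_def)
  have "card (P e) \<le> card (P e')" if "e' < b" for e'
  proof (rule card_inj_on_le[OF _ _ fin])
    have "inj ((\<circ>) (Transposition.transpose e e'))" by (rule fun.inj_map) simp
    then show "inj_on (\<lambda>\<sigma>. Transposition.transpose e e' \<circ> \<sigma>) (P e)" by (rule inj_on_subset) simp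
    show "(\<lambda>\<sigma>. Transposition.transpose e e' \<circ> \<sigma>) ` P e \<subseteq> P e'"
      using True that by (auto simp: P_def intro!: permutes_compose permutes_swap_id)
  qed
  then have "b * card (P e) \<le> (\<Sum>e'<b. card (P e'))"
    using sum_bounded_below[of "{..<b}" "card (P e)" "\<lambda>e'. card (P e')"] by simp
  also have "\<dots> = card (\<Union>e'<b. P e')"
    by (rule card_UN_disjoint[symmetric]) (auto simp: fin, auto simp: P_def)
  also have "\<dots> \<le> card (digit_perms b)"
    by (intro card_mono finite_permutations) (auto simp: P_def)
  finally show ?thesis by (simp add: P_def)
qed

section \<open>Digits, cells and their scrambled counterparts\<close>

definition prefix_digits :: "nat \<Rightarrow> real \<Rightarrow> nat \<Rightarrow> nat list" where
  "prefix_digits b x q = map (digit b x) [1..<Suc q]"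

text \<open>Counted from 0: the digit at place \<open>q + 1\<close>, permuted according to the
  \<open>q\<close> digits before it.\<close>

definition scrambled_digit :: "nat \<Rightarrow> (nat list \<Rightarrow> nat \<Rightarrow> nat) \<Rightarrow> real \<Rightarrow> nat \<Rightarrow> nat" where
  "scrambled_digit b \<tau> x q = \<tau> (prefix_digits b x q) (digit b x (Suc q))"

definition cell :: "nat \<Rightarrow> real \<Rightarrow> nat \<Rightarrow> nat" where
  "cell b x l = nat \<lfloor>x * real b ^ l\<rfloor>"

text \<open>Built from the scrambled digits, not from the scrambled real, since the two disagree
  when the digits end in \<open>b - 1\<close> for ever.\<close>

fun scrambled_cell :: "nat \<Rightarrow> (nat list \<Rightarrow> nat \<Rightarrow> nat) \<Rightarrow> real \<Rightarrow> nat \<Rightarrow> nat" where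
  "scrambled_cell b \<tau> x 0 = 0"
| "scrambled_cell b \<tau> x (Suc l) = b * scrambled_cell b \<tau> x l + scrambled_digit b \<tau> x l"

lemma scramble_eq: "scramble b \<tau> x = (\<Sum>q. real (scrambled_digit b \<tau> x q) / real b ^ Suc q)"
  by (simp add: scramble_def scrambled_digit_def prefix_digits_def)

lemma length_prefix_digits [simp]: "length (prefix_digits b x q) = q"
  by (simp add: prefix_digits_def)

lemma prefix_digits_Suc: "prefix_digits b x (Suc q) = prefix_digits b x q @ [digit b x (Suc q)]"
  by (simp add: prefix_digits_def)

lemma base_digit_eq_iff:
  fixes a a' b A A' :: nat
  assumes "a < b" "a' < b" shows "b * A + a = b * A' + a' \<longleftrightarrow> A = A' \<and> a = a'"
proof
  assume *: "b * A + a = b * A' + a'"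
  have "(b * A + a) div b = A" "(b * A' + a') div b = A'" "(b * A + a) mod b = a" "(b * A' + a') mod b = a'"
    using assms by auto
  with * show "A = A' \<and> a = a'" by metis
qed auto

locale base =
  fixes b :: nat
  assumes b: "2 \<le> b"
begin

lemma b_pos [simp]: "0 < b" "0 < real b" "b \<noteq> 0" using b by auto

lemma digit_less [simp]: "digit b x k < b"
proof -
  have "\<lfloor>x * real b ^ k\<rfloor> mod int b < int b" by (rule pos_mod_bound) simp
  then show ?thesis by (simp add: digit_def nat_less_iff)
qed

lemma prefix_digits_in [simp]: "prefix_digits b x q \<in> lists {..<b}"
  by (auto simp: prefix_digits_def)

lemma prefix_digits_less: "a \<in> set (prefix_digits b x q) \<Longrightarrow> a < b"
  by (auto simp: prefix_digits_def)

lemma cell_Suc: assumes "0 \<le> x" shows "cell b x (Suc l) = b * cell b x l + digit b x (Suc l)"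
proof -
  define y where "y = \<lfloor>x * real b ^ Suc l\<rfloor>"
  have y: "0 \<le> y" using assms by (simp add: y_def)
  have "\<lfloor>x * real b ^ l\<rfloor> = \<lfloor>(x * real b ^ Suc l) / real_of_int (int b)\<rfloor>" by simp
  also have "\<dots> = y div int b" unfolding y_def by (rule floor_divide_real_eq_div) simp
  finally have "cell b x l = nat (y div int b)" by (simp add: cell_def)
  moreover have "nat y = b * nat (y div int b) + nat (y mod int b)"
    using y by (simp add: nat_div_distrib nat_mod_distrib)
  ultimately show ?thesis by (simp add: cell_def digit_def y_def)
qed

lemma cell_0: "0 \<le> x \<Longrightarrow> x < 1 \<Longrightarrow> cell b x 0 = 0"
  by (simp add: cell_def floor_eq_iff)

lemma cell_eq_iff:
  assumes "0 \<le> x" shows "cell b x l = a \<longleftrightarrow> real a / real b ^ l \<le> x \<and> x < (real a + 1) / real b ^ l"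
proof -
  have "cell b x l = a \<longleftrightarrow> \<lfloor>x * real b ^ l\<rfloor> = int a" using assms by (auto simp: cell_def)
  also have "\<dots> \<longleftrightarrow> real a \<le> x * real b ^ l \<and> x * real b ^ l < real a + 1" by (simp add: floor_eq_iff)
  also have "\<dots> \<longleftrightarrow> real a / real b ^ l \<le> x \<and> x < (real a + 1) / real b ^ l"
    by (simp add: pos_divide_le_eq pos_less_divide_eq)
  finally show ?thesis .
qed

end

locale digit_scrambling = base b for b +
  fixes \<tau> :: "nat list \<Rightarrow> nat \<Rightarrow> nat"
  assumes \<tau>: "\<And>w. w \<in> lists {..<b} \<Longrightarrow> \<tau> w permutes {..<b}"
begin

abbreviation "sdig \<equiv> scrambled_digit b \<tau>"
abbreviation "scell \<equiv> scrambled_cell b \<tau>"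

lemma sdig_less [simp]: "sdig x q < b"
  using permutes_in_image[OF \<tau>[OF prefix_digits_in[of x q]], of "digit b x (Suc q)"]
  by (simp add: scrambled_digit_def)

lemma scell_less: "scell x l < b ^ l"
proof (induction l)
  case (Suc l)
  have "scell x (Suc l) < b * (scell x l + 1)" by simp
  also have "\<dots> \<le> b * b ^ l" using Suc by (intro mult_le_mono2) simp
  finally show ?case by simp
qed simp

text \<open>The second conjunct carries the induction: the permutation of the next digit depends on
  the prefix, so its injectivity is of use only once the prefixes are known to agree.\<close>

lemma scell_eq_iff:
  assumes "0 \<le> x" "x < 1" "0 \<le> y" "y < 1"
  shows "(scell x l = scell y l \<longleftrightarrow> cell b x l = cell b y l) \<and>
    (cell b x l = cell b y l \<longrightarrow> prefix_digits b x l = prefix_digits b y l)"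
proof (induction l)
  case 0
  then show ?case using assms by (simp add: cell_0 prefix_digits_def)
next
  case (Suc l)
  have inj: "\<tau> w a = \<tau> w a' \<longleftrightarrow> a = a'" if "w \<in> lists {..<b}" for w a a'
    using permutes_inj[OF \<tau>[OF that]] by (auto dest: injD)
  have c: "cell b x (Suc l) = cell b y (Suc l) \<longleftrightarrow> cell b x l = cell b y l \<and> digit b x (Suc l) = digit b y (Suc l)"
    using assms by (simp add: cell_Suc base_digit_eq_iff)
  have s: "scell x (Suc l) = scell y (Suc l) \<longleftrightarrow> scell x l = scell y l \<and> sdig x l = sdig y l"
    by (simp add: base_digit_eq_iff)
  show ?case unfolding c s
    using Suc inj[OF prefix_digits_in[of y l]] by (auto simp: prefix_digits_Suc scrambled_digit_def)
qed

text \<open>At each level scrambling acts injectively on the finitely many cells, hence permutes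
  them.\<close>

lemma scell_surj:
  assumes "a < b ^ l"
  obtains a' where "a' < b ^ l" "\<And>x. 0 \<le> x \<Longrightarrow> x < 1 \<Longrightarrow> scell x l = a \<longleftrightarrow> cell b x l = a'"
proof -
  define f where "f c = scell (real c / real b ^ l) l" for c
  have r: "0 \<le> real c / real b ^ l \<and> real c / real b ^ l < 1" if "c < b ^ l" for c
  proof -
    have "real c < real (b ^ l)" using that by (simp only: of_nat_less_iff)
    then show ?thesis by simp
  qed
  have cell: "cell b (real c / real b ^ l) l = c" for c
    by (simp add: cell_eq_iff divide_strict_right_mono)
  have "inj_on f {..<b ^ l}"
  proof (rule inj_onI)
    fix c c' assume "c \<in> {..<b ^ l}" "c' \<in> {..<b ^ l}" "f c = f c'"
    then show "c = c'" using scell_eq_iff r cell unfolding f_def by (metis lessThan_iff)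
  qed
  moreover have "f ` {..<b ^ l} \<subseteq> {..<b ^ l}" by (auto simp: f_def scell_less)
  ultimately have "f ` {..<b ^ l} = {..<b ^ l}" by (intro endo_inj_surj) auto
  then obtain c where c: "c < b ^ l" "f c = a" using assms by (metis imageE lessThan_iff)
  show ?thesis
  proof (rule that[OF c(1)])
    fix x :: real assume "0 \<le> x" "x < 1"
    then show "scell x l = a \<longleftrightarrow> cell b x l = c"
      using scell_eq_iff[of x "real c / real b ^ l" l] r[OF c(1)] c(2) by (simp add: f_def cell)
  qed
qed

lemma partial_sum_scell: "(\<Sum>q<l. real (sdig x q) / real b ^ Suc q) = real (scell x l) / real b ^ l"
  by (induction l) (auto simp: field_simps)

lemma scell_growth: "l \<le> n \<Longrightarrow> (real (scell x n) + 1) / real b ^ n \<le> (real (scell x l) + 1) / real b ^ l"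
proof (induction n)
  case (Suc n)
  show ?case
  proof (cases "l \<le> n")
    case True
    have "real (sdig x n) + 1 \<le> real b" using sdig_less[of x n] by linarith
    then have "(real (scell x (Suc n)) + 1) / real b ^ Suc n \<le> (real b * (real (scell x n) + 1)) / real b ^ Suc n"
      by (intro divide_right_mono) (auto simp: algebra_simps)
    also have "\<dots> = (real (scell x n) + 1) / real b ^ n" by simp
    finally show ?thesis using Suc.IH[OF True] by linarith
  qed (use Suc in \<open>simp add: le_Suc_eq\<close>)
qed simp

lemma partial_sum_le: "(\<Sum>q<n. real (sdig x q) / real b ^ Suc q) \<le> (real (scell x l) + 1) / real b ^ l"
proof (cases "l \<le> n")
  case True
  have "(\<Sum>q<n. real (sdig x q) / real b ^ Suc q) \<le> (real (scell x n) + 1) / real b ^ n"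
    unfolding partial_sum_scell by (intro divide_right_mono) auto
  also have "\<dots> \<le> (real (scell x l) + 1) / real b ^ l" by (rule scell_growth[OF True])
  finally show ?thesis .
next
  case False
  have "(\<Sum>q<n. real (sdig x q) / real b ^ Suc q) \<le> (\<Sum>q<l. real (sdig x q) / real b ^ Suc q)"
    using False by (intro sum_mono2) auto
  also have "\<dots> \<le> (real (scell x l) + 1) / real b ^ l"
    unfolding partial_sum_scell by (intro divide_right_mono) auto
  finally show ?thesis .
qed

lemma summable_scramble: "summable (\<lambda>q. real (sdig x q) / real b ^ Suc q)"
  by (rule summableI_nonneg_bounded[OF _ partial_sum_le[of _ _ 0]]) simp

lemma scramble_bounds:
  "real (scell x l) / real b ^ l \<le> scramble b \<tau> x" "scramble b \<tau> x \<le> (real (scell x l) + 1) / real b ^ l"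
proof -
  show "real (scell x l) / real b ^ l \<le> scramble b \<tau> x"
    unfolding scramble_eq partial_sum_scell[symmetric]
    by (rule sum_le_suminf[OF summable_scramble]) auto
  show "scramble b \<tau> x \<le> (real (scell x l) + 1) / real b ^ l"
    unfolding scramble_eq by (rule suminf_le_const[OF summable_scramble partial_sum_le])
qed

text \<open>A single later digit other than \<open>b - 1\<close> keeps the value off the right end
  of the cell.\<close>

lemma scramble_less:
  assumes "l \<le> q" "sdig x q \<noteq> b - 1"
  shows "scramble b \<tau> x < (real (scell x l) + 1) / real b ^ l"
proof -
  have "real (sdig x q) + 2 \<le> real b" using sdig_less[of x q] assms(2) by linarith
  then have "(real (scell x (Suc q)) + 1) / real b ^ Suc q \<le> (real b * (real (scell x q) + 1) - 1) / real b ^ Suc q"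
    by (intro divide_right_mono) (auto simp: algebra_simps)
  also have "\<dots> < (real b * (real (scell x q) + 1)) / real b ^ Suc q"
    by (intro divide_strict_right_mono) auto
  also have "\<dots> = (real (scell x q) + 1) / real b ^ q" by simp
  also have "\<dots> \<le> (real (scell x l) + 1) / real b ^ l" by (rule scell_growth[OF assms(1)])
  finally show ?thesis using scramble_bounds(2)[of x "Suc q"] by linarith
qed

lemma scramble_pos: assumes "sdig x q \<noteq> 0" shows "0 < scramble b \<tau> x"
proof -
  have "0 < scell x (Suc q)" using assms by simp
  then have "0 < real (scell x (Suc q)) / real b ^ Suc q"
    by (intro divide_pos_pos) (simp_all only: of_nat_0_less_iff zero_less_power b_pos)
  then show ?thesis using scramble_bounds(1)[of x "Suc q"] by linarith
qed

lemma scell_zero_digits: "scell x l = 0 \<Longrightarrow> q < l \<Longrightarrow> sdig x q = 0"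
  by (induction l) (auto simp: less_Suc_eq)

lemma scell_max_digits: "scell x l + 1 = b ^ l \<Longrightarrow> q < l \<Longrightarrow> sdig x q = b - 1"
proof (induction l)
  case (Suc l)
  have "b * (scell x l + 1) \<le> b * b ^ l" using scell_less[of x l] by (intro mult_le_mono2) simp
  then have *: "b * scell x l + b \<le> b ^ Suc l" by simp
  have eq: "b * scell x l + sdig x l + 1 = b ^ Suc l" using Suc.prems(1) by simp
  then have d: "sdig x l = b - 1" using sdig_less[of x l] * by linarith
  then have "b * (scell x l + 1) = b * b ^ l" using eq b by simp
  then have "scell x l + 1 = b ^ l" by (simp del: add_Suc_right One_nat_def)
  then show ?case using Suc d by (auto simp: less_Suc_eq)
qed simp

end

section \<open>Random scrambling\<close>

locale owen_scrambling = base b for b +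
  fixes M :: "'w measure" and S :: "nat set" and \<pi> :: "nat \<Rightarrow> nat list \<Rightarrow> 'w \<Rightarrow> nat \<Rightarrow> nat"
  assumes S: "finite S" and owen: "owen_permutations M b S \<pi>"
begin

sublocale prob_space M
  using owen by (simp add: owen_permutations_def)

lemma indep: "indep_vars (\<lambda>_. count_space (digit_perms b)) (\<lambda>(k, w). \<pi> k w) (S \<times> lists {..<b})"
  and uniform: "k \<in> S \<Longrightarrow> w \<in> lists {..<b} \<Longrightarrow>
    distr M (count_space (digit_perms b)) (\<pi> k w) = uniform_count_measure (digit_perms b)"
  using owen by (auto simp: owen_permutations_def)

lemma measurable_\<pi> [measurable]:
  "k \<in> S \<Longrightarrow> w \<in> lists {..<b} \<Longrightarrow> \<pi> k w \<in> measurable M (count_space (digit_perms b))"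
  using indep unfolding indep_vars_def by fastforce

lemma scrambling: assumes "k \<in> S" "\<omega> \<in> space M" shows "digit_scrambling b (\<lambda>w. \<pi> k w \<omega>)"
proof
  fix w assume "w \<in> lists {..<b}"
  from measurable_space[OF measurable_\<pi>[OF assms(1) this] assms(2)] show "\<pi> k w \<omega> permutes {..<b}" by simp
qed

abbreviation sdigit :: "nat \<Rightarrow> real \<Rightarrow> nat \<Rightarrow> 'w \<Rightarrow> nat" where
  "sdigit k x q \<omega> \<equiv> scrambled_digit b (\<lambda>w. \<pi> k w \<omega>) x q"

lemma measurable_sdigit [measurable]:
  assumes "k \<in> S" shows "(\<lambda>\<omega>. sdigit k x q \<omega>) \<in> measurable M (count_space UNIV)"
proof -
  have "(\<lambda>\<sigma>. \<sigma> (digit b x (Suc q))) \<circ> \<pi> k (prefix_digits b x q) \<in> measurable M (count_space UNIV)"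
    by (rule measurable_comp[OF measurable_\<pi>[OF assms prefix_digits_in]]) simp
  then show ?thesis by (simp add: scrambled_digit_def o_def)
qed

lemma measurable_scramble [measurable]:
  assumes "k \<in> S" shows "(\<lambda>\<omega>. scramble b (\<lambda>w. \<pi> k w \<omega>) x) \<in> borel_measurable M"
  unfolding scramble_eq using measurable_sdigit[OF assms] by measurable

text \<open>Digits in different coordinates or at different depths are produced by different
  permutations, the prefixes having different lengths. Independence therefore gives a product, and
  each factor is at most 1/b.\<close>

lemma prob_digits_le:
  assumes K: "K \<subseteq> S" and fin: "\<And>k. k \<in> K \<Longrightarrow> finite (A k)"
  shows "prob {\<omega>\<in>space M. \<forall>k\<in>K. \<forall>q\<in>A k. sdigit k (y k) q \<omega> = e k q} \<le> (\<Prod>k\<in>K. (1 / real b) ^ card (A k))"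
proof -
  have finK: "finite K" using K S by (rule finite_subset)
  define N where "N = (\<lambda>(k, q). (k, prefix_digits b (y k) q))"
  define J where "J = N ` (SIGMA k:K. A k)"
  have "inj N" by (rule injI) (auto simp: N_def dest: arg_cong[where f=length])
  then have cardJ: "card J = (\<Sum>k\<in>K. card (A k))"
    unfolding J_def using fin finK by (simp add: card_image inj_on_subset card_SigmaI)
  have J: "J \<subseteq> S \<times> lists {..<b}" "finite J"
    unfolding J_def using K fin finK by (auto simp: N_def prefix_digits_less)
  \<comment> \<open>The depth \<open>q\<close> is recovered from the index as the length of the
    prefix.\<close>
  define T where "T = (\<lambda>(k, w :: nat list). {\<sigma>\<in>digit_perms b. \<sigma> (digit b (y k) (Suc (length w))) = e k (length w)})"
  have pT: "prob ((case i of (k, w) \<Rightarrow> \<pi> k w) -` T i \<inter> space M) \<le> 1 / real b" if "i \<in> J" for i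
  proof -
    obtain k w where i: "i = (k, w)" "k \<in> S" "w \<in> lists {..<b}"
      using subsetD[OF J(1) \<open>i \<in> J\<close>] by (elim SigmaE) blast
    let ?P = "{\<sigma>. \<sigma> permutes {..<b} \<and> \<sigma> (digit b (y k) (Suc (length w))) = e k (length w)}"
    have fin: "finite (digit_perms b)" by (simp add: finite_permutations)
    have "prob (\<pi> k w -` T i \<inter> space M) = measure (distr M (count_space (digit_perms b)) (\<pi> k w)) (T i)"
      by (rule measure_distr[symmetric]) (auto simp: T_def i)
    also have "\<dots> = real (card ?P) / real (card (digit_perms b))"
      unfolding uniform[OF i(2,3)] using fin
      by (subst measure_uniform_count_measure) (auto simp: T_def i)
    also have "\<dots> \<le> 1 / real b"
    proof -
      have "b * card ?P \<le> card (digit_perms b)" by (rule card_permutations_fixed_value_le) simp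
      then have "real b * real (card ?P) \<le> real (card (digit_perms b))"
        unfolding of_nat_mult[symmetric] of_nat_le_iff .
      moreover have "0 < card (digit_perms b)" by (simp add: card_permutations[of _ b])
      ultimately show ?thesis by (simp add: field_simps)
    qed
    finally show ?thesis by (simp add: i)
  qed
  show ?thesis
  proof (cases "J = {}")
    \<comment> \<open>Separate case because \<open>indep_varsD\<close> takes a nonempty index
      set.\<close>
    case True
    then have "A k = {}" if "k \<in> K" for k using that by (auto simp: J_def)
    then show ?thesis by simp
  next
    case False
    have "{\<omega>\<in>space M. \<forall>k\<in>K. \<forall>q\<in>A k. sdigit k (y k) q \<omega> = e k q}
      = (\<Inter>i\<in>J. (case i of (k, w) \<Rightarrow> \<pi> k w) -` T i \<inter> space M)"
    proof (intro equalityI subsetI)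
      fix \<omega> assume \<omega>: "\<omega> \<in> {\<omega>\<in>space M. \<forall>k\<in>K. \<forall>q\<in>A k. sdigit k (y k) q \<omega> = e k q}"
      show "\<omega> \<in> (\<Inter>i\<in>J. (case i of (k, w) \<Rightarrow> \<pi> k w) -` T i \<inter> space M)"
      proof
        fix i assume "i \<in> J"
        then obtain k q where i: "i = (k, prefix_digits b (y k) q)" "k \<in> K" "q \<in> A k"
          by (auto simp: J_def N_def)
        have "\<pi> k (prefix_digits b (y k) q) \<omega> permutes {..<b}"
          using digit_scrambling.\<tau>[OF scrambling] \<omega> i(2) K by auto
        then show "\<omega> \<in> (case i of (k, w) \<Rightarrow> \<pi> k w) -` T i \<inter> space M"
          using \<omega> i(2,3) by (auto simp: i(1) T_def scrambled_digit_def)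
      qed
    next
      fix \<omega> assume \<omega>: "\<omega> \<in> (\<Inter>i\<in>J. (case i of (k, w) \<Rightarrow> \<pi> k w) -` T i \<inter> space M)"
      have "sdigit k (y k) q \<omega> = e k q" if "k \<in> K" "q \<in> A k" for k q
      proof -
        have "N (k, q) \<in> J" using that by (auto simp: J_def)
        from INT_D[OF \<omega> this] show ?thesis by (simp add: N_def T_def scrambled_digit_def)
      qed
      moreover have "\<omega> \<in> space M" using \<omega> False by blast
      ultimately show "\<omega> \<in> {\<omega>\<in>space M. \<forall>k\<in>K. \<forall>q\<in>A k. sdigit k (y k) q \<omega> = e k q}" by blast
    qed
    then have "prob {\<omega>\<in>space M. \<forall>k\<in>K. \<forall>q\<in>A k. sdigit k (y k) q \<omega> = e k q}
      = (\<Prod>i\<in>J. prob ((case i of (k, w) \<Rightarrow> \<pi> k w) -` T i \<inter> space M))"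
    proof (simp only:)
      have "T i \<in> sets (count_space (digit_perms b))" for i by (cases i) (auto simp: T_def)
      then show "prob (\<Inter>i\<in>J. (case i of (k, w) \<Rightarrow> \<pi> k w) -` T i \<inter> space M)
        = (\<Prod>i\<in>J. prob ((case i of (k, w) \<Rightarrow> \<pi> k w) -` T i \<inter> space M))"
        by (intro indep_varsD[OF indep False J(2,1)])
    qed
    also have "\<dots> \<le> (\<Prod>i\<in>J. 1 / real b)" by (intro prod_mono) (auto simp: pT)
    also have "\<dots> = (\<Prod>k\<in>K. (1 / real b) ^ card (A k))" by (simp add: cardJ power_sum)
    finally show ?thesis .
  qed
qed

text \<open>Being constant over \<open>n\<close> places has probability at most
  \<open>(1 / b) ^ n\<close>.\<close>

lemma AE_sdigit_not_constant:
  assumes k: "k \<in> S"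
  shows "AE \<omega> in M. \<exists>q\<ge>l. sdigit k x q \<omega> \<noteq> c"
proof -
  let ?N = "{\<omega>\<in>space M. \<forall>q\<ge>l. sdigit k x q \<omega> = c}"
  have N [measurable]: "?N \<in> events" using measurable_sdigit[OF k] by measurable
  have "prob ?N \<le> (1 / real b) ^ n" for n
  proof -
    let ?N' = "{\<omega>\<in>space M. \<forall>k'\<in>{k}. \<forall>q\<in>{l..<l+n}. sdigit k' x q \<omega> = c}"
    have "{\<omega>\<in>space M. \<forall>q\<in>{l..<l+n}. sdigit k x q \<omega> = c} \<in> events" using measurable_sdigit[OF k] by measurable
    then have "?N' \<in> events" by simp
    then have "prob ?N \<le> prob ?N'" by (intro finite_measure_mono) auto
    also have "\<dots> \<le> (\<Prod>k'\<in>{k}. (1 / real b) ^ card {l..<l+n})"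
      by (rule prob_digits_le) (use k in auto)
    finally show ?thesis by simp
  qed
  moreover have "(\<lambda>n. (1 / real b) ^ n) \<longlonglongrightarrow> 0" using b by (intro LIMSEQ_realpow_zero) auto
  ultimately have "prob ?N \<le> 0" by (intro LIMSEQ_le_const) auto
  then have "prob ?N = 0" by (simp add: measure_le_0_iff)
  then have "AE \<omega> in M. \<omega> \<notin> ?N" unfolding prob_eq_0[OF N] .
  with AE_space show ?thesis by eventually_elim blast
qed

text \<open>Excludes the null set of scrambles that produce a digit sequence ending in \<open>b - 1\<close>, for
  which the scrambled digits are not the \<open>b\<close>-adic digits of the scrambled value.\<close>

definition regular :: "(nat \<Rightarrow> nat \<Rightarrow> real) \<Rightarrow> 'w \<Rightarrow> bool" where
  "regular p \<omega> \<longleftrightarrow> \<omega> \<in> space M \<and> (\<forall>i. \<forall>k\<in>S.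
    (\<exists>q. sdigit k (p i k) q \<omega> \<noteq> 0) \<and> (\<forall>l. \<exists>q\<ge>l. sdigit k (p i k) q \<omega> \<noteq> b - 1))"

lemma AE_regular: "AE \<omega> in M. regular p \<omega>"
proof -
  have 1: "AE \<omega> in M. \<exists>q. sdigit k (p i k) q \<omega> \<noteq> 0" if "k \<in> S" for i k
    using AE_sdigit_not_constant[OF that, of 0 "p i k" 0] by simp
  have 2: "AE \<omega> in M. \<forall>l. \<exists>q\<ge>l. sdigit k (p i k) q \<omega> \<noteq> b - 1" if "k \<in> S" for i k
    unfolding AE_all_countable using AE_sdigit_not_constant[OF that] by blast
  have "AE \<omega> in M. \<forall>i. \<forall>k\<in>S. (\<exists>q. sdigit k (p i k) q \<omega> \<noteq> 0) \<and> (\<forall>l. \<exists>q\<ge>l. sdigit k (p i k) q \<omega> \<noteq> b - 1)"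
    unfolding AE_all_countable by (intro allI AE_finite_allI[OF S] AE_conjI 1 2)
  with AE_space show ?thesis unfolding regular_def by eventually_elim blast
qed

abbreviation "point p i \<equiv> scrambled_point b S \<pi> p i"

lemma point_apply: "k \<in> S \<Longrightarrow> point p i \<omega> k = scramble b (\<lambda>w. \<pi> k w \<omega>) (p i k)"
  by (simp add: scrambled_point_def)

text \<open>Strictly inside the unit interval, where \<open>Phi_inv\<close> inverts
  \<open>Phi\<close>: a nonzero digit excludes 0, a digit other than \<open>b - 1\<close> excludes
  1.\<close>

lemma point_bounds:
  assumes "regular p \<omega>" "k \<in> S" shows "0 < point p i \<omega> k" "point p i \<omega> k < 1"
proof -
  interpret digit_scrambling b "\<lambda>w. \<pi> k w \<omega>" using scrambling assms by (simp add: regular_def)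
  obtain q q' where q: "sdigit k (p i k) q \<omega> \<noteq> 0" "sdigit k (p i k) q' \<omega> \<noteq> b - 1"
    using assms unfolding regular_def by blast
  show "0 < point p i \<omega> k" unfolding point_apply[OF assms(2)] by (rule scramble_pos[OF q(1)])
  show "point p i \<omega> k < 1" unfolding point_apply[OF assms(2)]
    using scramble_less[of 0 q' "p i k"] q(2) by simp
qed

text \<open>Regularity makes the upper bound for the value strict, so it lies in the half-open cell
  that its scrambled digits announce.\<close>

lemma point_cell:
  assumes "regular p \<omega>" "k \<in> S"
  shows "cell b (point p i \<omega> k) l = scrambled_cell b (\<lambda>w. \<pi> k w \<omega>) (p i k) l"
proof -
  interpret digit_scrambling b "\<lambda>w. \<pi> k w \<omega>" using scrambling assms by (simp add: regular_def)
  obtain q where q: "l \<le> q" "sdigit k (p i k) q \<omega> \<noteq> b - 1"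
    using assms unfolding regular_def by blast
  show ?thesis
    using scramble_less[OF q] scramble_bounds(1) point_bounds(1)[OF assms, of i]
    by (subst cell_eq_iff) (auto simp: point_apply[OF assms(2)])
qed

text \<open>Scrambling permutes the cells of each level in each coordinate, so membership of a
  scrambled point in an elementary box is membership of the original point in another box of the
  same shape.\<close>

lemma ts_sequence_scrambled:
  assumes seq: "ts_sequence b t S p" and \<omega>: "regular p \<omega>"
  shows "ts_sequence b t S (\<lambda>i. point p i \<omega>)"
  unfolding ts_sequence_def
proof (intro allI impI)
  fix c m assume m: "t \<le> m"
  define J where "J = {c * b ^ m + 1..(c + 1) * b ^ m}"
  have net: "tms_net b t m S J p" using seq m unfolding ts_sequence_def J_def by blast
  have "card {i\<in>J. point p i \<omega> \<in> elementary_box b S l a} = b ^ t"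
    if a: "\<forall>k\<in>S. a k < b ^ l k" and vol: "(\<Prod>k\<in>S. 1 / real b ^ l k) = real b powi (int t - int m)" for l a
  proof -
    have "\<exists>a'<b ^ l k. \<forall>x. 0 \<le> x \<longrightarrow> x < 1 \<longrightarrow>
        (scrambled_cell b (\<lambda>w. \<pi> k w \<omega>) x (l k) = a k \<longleftrightarrow> cell b x (l k) = a')" if k: "k \<in> S" for k
    proof -
      interpret digit_scrambling b "\<lambda>w. \<pi> k w \<omega>" using scrambling \<omega> k by (simp add: regular_def)
      show ?thesis using scell_surj[of "a k" "l k"] a k by metis
    qed
    then obtain a' where a': "\<And>k. k \<in> S \<Longrightarrow> a' k < b ^ l k"
      "\<And>k x. k \<in> S \<Longrightarrow> 0 \<le> x \<Longrightarrow> x < 1 \<Longrightarrow>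
        scrambled_cell b (\<lambda>w. \<pi> k w \<omega>) x (l k) = a k \<longleftrightarrow> cell b x (l k) = a' k" by metis
    have "point p i \<omega> \<in> elementary_box b S l a \<longleftrightarrow> p i \<in> elementary_box b S l a'" if i: "i \<in> J" for i
    proof -
      have "(real (a k) / real b ^ l k \<le> point p i \<omega> k \<and> point p i \<omega> k < (real (a k) + 1) / real b ^ l k)
        \<longleftrightarrow> (real (a' k) / real b ^ l k \<le> p i k \<and> p i k < (real (a' k) + 1) / real b ^ l k)" if k: "k \<in> S" for k
      proof -
        have pik: "0 \<le> p i k" "p i k < 1" using net i k by (auto simp: tms_net_def)
        show ?thesis
          using cell_eq_iff[OF less_imp_le[OF point_bounds(1)[OF \<omega> k]], of i "l k" "a k"]
            cell_eq_iff[OF pik(1), of "l k" "a' k"] point_cell[OF \<omega> k, of i "l k"] a'(2)[OF k pik] by simp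
      qed
      then show ?thesis by (auto simp: elementary_box_def)
    qed
    then have "{i\<in>J. point p i \<omega> \<in> elementary_box b S l a} = {i\<in>J. p i \<in> elementary_box b S l a'}" by blast
    then show ?thesis using net a'(1) vol unfolding tms_net_def by auto
  qed
  moreover have "finite J" "card J = b ^ m" using net by (auto simp: tms_net_def)
  moreover have "point p i \<omega> k \<in> {0..<1}" if "k \<in> S" for i k
    using point_bounds[OF \<omega> that, of i] by simp
  ultimately show "tms_net b t m S {c * b ^ m + 1..(c + 1) * b ^ m} (\<lambda>i. point p i \<omega>)"
    unfolding tms_net_def J_def[symmetric] by blast
qed

lemma adic_scale:
  assumes "0 < v" "v < 1"
  obtains l where "v < 1 / real b ^ l" "1 / real b ^ l \<le> real b * v"
proof -
  obtain n where "(1 / real b) ^ n < v" using real_arch_pow_inv[of v "1 / real b"] assms b by auto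
  then have ex: "\<exists>n. 1 / real b ^ n \<le> v" by (intro exI[of _ n]) (simp add: power_one_over)
  define n where "n = (LEAST n. 1 / real b ^ n \<le> v)"
  have n: "1 / real b ^ n \<le> v" unfolding n_def by (rule LeastI_ex[OF ex])
  then obtain l where l: "n = Suc l" using assms(2) by (cases n) auto
  have "\<not> 1 / real b ^ l \<le> v" using not_less_Least[of l "\<lambda>n. 1 / real b ^ n \<le> v"] l by (simp add: n_def)
  moreover have "1 / real b ^ l \<le> real b * v" using n unfolding l by (simp add: field_simps)
  ultimately show ?thesis by (intro that[of l]) auto
qed

text \<open>Stands in for the uniform distribution of a point. With b^(-l) just above
  \<open>v k\<close>, lying in the corner forces the first \<open>l\<close> digits to be all 0 or
  all \<open>b - 1\<close>; the rounding to a power of \<open>b\<close> loses at most a factor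
  \<open>b\<close> per coordinate.\<close>

lemma prob_corner_le:
  assumes K: "K \<subseteq> S" and v: "\<And>k. k \<in> K \<Longrightarrow> 0 < v k \<and> v k < 1"
  shows "prob {\<omega>\<in>space M. \<forall>k\<in>K. if up k then 1 - v k \<le> point p i \<omega> k else point p i \<omega> k < v k}
    \<le> real b ^ card K * (\<Prod>k\<in>K. v k)"
proof -
  have "\<forall>k\<in>K. \<exists>l. v k < 1 / real b ^ l \<and> 1 / real b ^ l \<le> real b * v k"
    using adic_scale v by metis
  then obtain l where l: "\<And>k. k \<in> K \<Longrightarrow> v k < 1 / real b ^ l k" "\<And>k. k \<in> K \<Longrightarrow> 1 / real b ^ l k \<le> real b * v k"
    by metis
  let ?E = "{\<omega>\<in>space M. \<forall>k\<in>K. \<forall>q\<in>{..<l k}. sdigit k (p i k) q \<omega> = (if up k then b - 1 else 0)}"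
  have finK: "finite K" using K S by (rule finite_subset)
  have "{\<omega>\<in>space M. \<forall>k\<in>K. if up k then 1 - v k \<le> point p i \<omega> k else point p i \<omega> k < v k} \<subseteq> ?E"
  proof (intro subsetI CollectI conjI ballI)
    fix \<omega> k q
    assume \<omega>: "\<omega> \<in> {\<omega>\<in>space M. \<forall>k\<in>K. if up k then 1 - v k \<le> point p i \<omega> k else point p i \<omega> k < v k}"
      and k: "k \<in> K" and q: "q \<in> {..<l k}"
    interpret digit_scrambling b "\<lambda>w. \<pi> k w \<omega>" using scrambling \<omega> k K by auto
    have kS: "k \<in> S" using k K by auto
    have pw: "0 < real b ^ l k" by simp
    show "sdigit k (p i k) q \<omega> = (if up k then b - 1 else 0)"
    proof (cases "up k")
      case True
      then have "1 - v k \<le> scramble b (\<lambda>w. \<pi> k w \<omega>) (p i k)" using \<omega> k by (auto simp: point_apply[OF kS])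
      \<comment> \<open>The scrambled value may equal the right end of its cell, so the strict
        inequality has to come from the choice of \<open>l\<close>. It leaves only the last cell,
        whose digits are all \<open>b - 1\<close>.\<close>
      then have "1 - 1 / real b ^ l k < (real (scell (p i k) (l k)) + 1) / real b ^ l k"
        using scramble_bounds(2)[of "p i k" "l k"] l(1)[OF k] by linarith
      then have "(real b ^ l k - 1) / real b ^ l k < (real (scell (p i k) (l k)) + 1) / real b ^ l k"
        by (simp add: diff_divide_distrib)
      then have "real b ^ l k - 1 < real (scell (p i k) (l k)) + 1" by (simp add: divide_less_cancel)
      then have "real (b ^ l k) < real (scell (p i k) (l k) + 2)" by simp
      then have "b ^ l k < scell (p i k) (l k) + 2" unfolding of_nat_less_iff .
      then have "scell (p i k) (l k) + 1 = b ^ l k" using scell_less[of "p i k" "l k"] by linarith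
      then show ?thesis using scell_max_digits q True by simp
    next
      case False
      then have "scramble b (\<lambda>w. \<pi> k w \<omega>) (p i k) < v k" using \<omega> k by (auto simp: point_apply[OF kS])
      then have "real (scell (p i k) (l k)) / real b ^ l k < 1 / real b ^ l k"
        using scramble_bounds(1)[of "p i k" "l k"] l(1)[OF k] by linarith
      then have "scell (p i k) (l k) = 0" by (simp add: divide_less_cancel)
      then show ?thesis using scell_zero_digits q False by simp
    qed
  qed auto
  moreover have "?E \<in> events"
  proof (intro sets.sets_Collect_finite_All finK finite_lessThan)
    fix k q assume "k \<in> K"
    then have "k \<in> S" using K by blast
    from measurable_sdigit[OF this]
    show "{\<omega>\<in>space M. sdigit k (p i k) q \<omega> = (if up k then b - 1 else 0)} \<in> events" by measurable
  qed
  ultimately have "prob {\<omega>\<in>space M. \<forall>k\<in>K. if up k then 1 - v k \<le> point p i \<omega> k else point p i \<omega> k < v k} \<le> prob ?E"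
    by (intro finite_measure_mono)
  also have "\<dots> \<le> (\<Prod>k\<in>K. (1 / real b) ^ card {..<l k})" by (rule prob_digits_le[OF K]) simp
  also have "\<dots> \<le> (\<Prod>k\<in>K. real b * v k)" using l(2) by (intro prod_mono) (auto simp: power_one_over)
  also have "\<dots> = real b ^ card K * (\<Prod>k\<in>K. v k)" by (simp add: prod.distrib)
  finally show ?thesis .
qed

end

subsection \<open>Anchored decomposition\<close>

lemma measurable_continuous_on_rspace:
  fixes T :: "'a \<Rightarrow> nat \<Rightarrow> real"
  assumes F: "continuous_on (rspace S) F" and T: "\<And>k. (\<lambda>a. T a k) \<in> borel_measurable M"
    and sp: "\<And>a. a \<in> space M \<Longrightarrow> T a \<in> rspace S"
  shows "(\<lambda>a. F (T a)) \<in> borel_measurable M"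
proof -
  have "T \<in> measurable M (restrict_space borel (rspace S))"
    by (rule measurable_restrict_space2) (use sp in auto, rule measurable_coordinatewise_then_product[OF T])
  from measurable_compose[OF this borel_measurable_continuous_on_restrict[OF F]]
  show ?thesis .
qed

text \<open>As a function of \<open>y\<close>, the signed indicator of the interval between
  \<open>c\<close> and \<open>x\<close>, which makes the integral below an oriented one. As a
  function of \<open>x\<close>, a constant minus the indicator of a half-line, so that averaging
  over nodes is a counting problem.\<close>

definition ftc_kernel :: "real \<Rightarrow> real \<Rightarrow> real \<Rightarrow> real" where
  "ftc_kernel c y x = of_bool (c < y) - of_bool (x < y)"

lemma kernel_measurable [measurable]: "case_prod (ftc_kernel c) \<in> borel_measurable (borel \<Otimes>\<^sub>M borel)"
  "(\<lambda>y. ftc_kernel c y x) \<in> borel_measurable borel" "ftc_kernel c y \<in> borel_measurable borel"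
  unfolding ftc_kernel_def case_prod_beta' of_bool_def by measurable

lemma abs_kernel_le: "\<bar>ftc_kernel c y x\<bar> \<le> 1"
  by (simp add: ftc_kernel_def)

lemma kernel_support: "ftc_kernel c y x = 0" if "y \<notin> {min c x..max c x}"
  using that by (auto simp: ftc_kernel_def)

lemma fundamental_theorem_kernel:
  fixes h h' :: "real \<Rightarrow> real"
  assumes h: "\<And>y. (h has_real_derivative h' y) (at y)" and c: "continuous_on UNIV h'"
  shows "h x = h c + (\<integral>y. h' y * ftc_kernel c y x \<partial>lborel)"
proof -
  have m [measurable]: "h' \<in> borel_measurable borel" by (rule borel_measurable_continuous_onI[OF c])
  have ic: "isCont h' y" for y using c by (simp add: continuous_on_eq_continuous_at)
  show ?thesis
  proof (cases "c \<le> x")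
    case True
    have "AE y in lborel. h' y * ftc_kernel c y x = h' y * indicator {c..x} y"
      using AE_lborel_singleton[of c] by eventually_elim (use True in \<open>auto simp: ftc_kernel_def indicator_def\<close>)
    then have "(\<integral>y. h' y * ftc_kernel c y x \<partial>lborel) = (\<integral>y. h' y * indicator {c..x} y \<partial>lborel)"
      by (intro integral_cong_AE) measurable
    then show ?thesis using integral_FTC_Icc_real[OF True, of h h'] h ic by simp
  next
    case False
    have "AE y in lborel. h' y * ftc_kernel c y x = - (h' y * indicator {x..c} y)"
      using AE_lborel_singleton[of x] by eventually_elim (use False in \<open>auto simp: ftc_kernel_def indicator_def\<close>)
    then have "(\<integral>y. h' y * ftc_kernel c y x \<partial>lborel) = (\<integral>y. - (h' y * indicator {x..c} y) \<partial>lborel)"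
      by (intro integral_cong_AE) measurable
    then show ?thesis using integral_FTC_Icc_real[of x c h h'] h ic False by simp
  qed
qed

text \<open>Interface between smoothness and quadrature. Order \<open>card S\<close> covers every
  mixed derivative with at most one differentiation per coordinate, and \<open>\<beta> k\<close> is
  the growth exponent, (2d-1) B_k in the application.\<close>

locale smooth_integrand = positive_density \<rho> for \<rho> +
  fixes S :: "nat set" and H :: "(nat \<Rightarrow> real) \<Rightarrow> real" and \<beta> :: "nat \<Rightarrow> real" and B :: real
  assumes S: "finite S" and smooth: "Cr_on S (card S) H"
    and bound: "\<And>w. set w \<subseteq> S \<Longrightarrow> length w \<le> card S \<Longrightarrow>
      \<exists>C. \<forall>x\<in>rspace S. \<bar>pd w H x\<bar> \<le> C * (\<Prod>k\<in>S. tail (x k) powr (- \<beta> k))"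
    and \<beta>: "\<And>k. k \<in> S \<Longrightarrow> 0 \<le> \<beta> k"
    and \<beta>B: "\<And>k. k \<in> S \<Longrightarrow> \<beta> k + B < 1"
    and tail_integrable: "\<And>a. B < a \<Longrightarrow> integrable lborel (\<lambda>x. tail x powr a)"
begin

text \<open>With this anchor the mean of the kernel has absolute value exactly
  \<open>tail y\<close>, the function that also measures growth.\<close>

definition median :: real where "median = Phi_inv \<rho> (1/2)"

lemma Phi_median: "Phi \<rho> median = 1/2"
  unfolding median_def by (rule Phi_Phi_inv) auto

definition mixed_partial :: "nat list \<Rightarrow> nat set \<Rightarrow> (nat \<Rightarrow> real) \<Rightarrow> real" where
  "mixed_partial ks v = pd (filter (\<lambda>k. k \<in> v) ks) H"

text \<open>\<open>T\<close> holds the coordinates already treated: those in \<open>v\<close> are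
  integration variables, the others sit at the median, and coordinates outside \<open>T\<close>
  still carry \<open>x\<close>.\<close>

definition anchor :: "nat set \<Rightarrow> nat set \<Rightarrow> (nat \<Rightarrow> real) \<Rightarrow> (nat \<Rightarrow> real) \<Rightarrow> nat \<Rightarrow> real" where
  "anchor T v x y = (\<lambda>k. if k \<in> v then y k else if k \<in> T then median else x k)"

definition kernels :: "nat set \<Rightarrow> (nat \<Rightarrow> real) \<Rightarrow> (nat \<Rightarrow> real) \<Rightarrow> real" where
  "kernels v y x = (\<Prod>k\<in>v. ftc_kernel median (y k) (x k))"

lemma anchor_in: "x \<in> rspace S \<Longrightarrow> v \<subseteq> T \<Longrightarrow> T \<subseteq> S \<Longrightarrow> anchor T v x y \<in> rspace S"
  by (auto simp: anchor_def rspace_iff)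

lemma Cr_on_mixed_partial:
  assumes "distinct ks" "set ks \<subseteq> S"
  shows "Cr_on S (card S - length (filter (\<lambda>k. k \<in> v) ks)) (mixed_partial ks v)"
    and "length (filter (\<lambda>k. k \<in> v) ks) \<le> card (set ks)" "card (set ks) \<le> card S"
proof -
  show l: "length (filter (\<lambda>k. k \<in> v) ks) \<le> card (set ks)" using assms(1) by (simp add: distinct_card)
  show c: "card (set ks) \<le> card S" by (rule card_mono[OF S assms(2)])
  show "Cr_on S (card S - length (filter (\<lambda>k. k \<in> v) ks)) (mixed_partial ks v)"
    unfolding mixed_partial_def by (rule Cr_on_pd[OF smooth]) (use assms(2) l c in auto)
qed

lemma mixed_partial_bound:
  assumes "distinct ks" "set ks \<subseteq> S"
  obtains C where "0 \<le> C" "\<And>x. x \<in> rspace S \<Longrightarrow> \<bar>mixed_partial ks v x\<bar> \<le> C * (\<Prod>k\<in>S. tail (x k) powr (- \<beta> k))"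
proof -
  have "\<exists>C. \<forall>x\<in>rspace S. \<bar>mixed_partial ks v x\<bar> \<le> C * (\<Prod>k\<in>S. tail (x k) powr (- \<beta> k))"
    unfolding mixed_partial_def
    by (rule bound) (use assms(2) Cr_on_mixed_partial(2)[OF assms, of v] Cr_on_mixed_partial(3)[OF assms] in auto)
  then obtain C where C: "\<And>x. x \<in> rspace S \<Longrightarrow> \<bar>mixed_partial ks v x\<bar> \<le> C * (\<Prod>k\<in>S. tail (x k) powr (- \<beta> k))"
    by blast
  show ?thesis
  proof (rule that[of "\<bar>C\<bar>"])
    show "\<bar>mixed_partial ks v x\<bar> \<le> \<bar>C\<bar> * (\<Prod>k\<in>S. tail (x k) powr (- \<beta> k))" if "x \<in> rspace S" for x
      by (rule order_trans[OF C[OF that] mult_right_mono[OF abs_ge_self]]) (auto intro: prod_nonneg)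
  qed simp
qed

lemma anchor_bound:
  assumes ks: "distinct ks" "set ks \<subseteq> S" and v: "v \<subseteq> T" "T \<subseteq> S" and x: "x \<in> rspace S"
  obtains C where "0 \<le> C"
    "\<And>y. \<bar>mixed_partial ks v (anchor T v x y)\<bar> \<le> C * (\<Prod>k\<in>v. tail (y k) powr (- \<beta> k))"
proof -
  obtain C where C: "0 \<le> C" "\<And>x. x \<in> rspace S \<Longrightarrow> \<bar>mixed_partial ks v x\<bar> \<le> C * (\<Prod>k\<in>S. tail (x k) powr (- \<beta> k))"
    using mixed_partial_bound[OF ks] by blast
  define K where "K = (\<Prod>k\<in>S - v. tail (if k \<in> T then median else x k) powr (- \<beta> k))"
  show ?thesis
  proof (rule that)
    show "0 \<le> C * K" using C(1) by (simp add: K_def prod_nonneg)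
    fix y
    have vS: "v \<subseteq> S" using v by blast
    have "(\<Prod>k\<in>S. tail (anchor T v x y k) powr (- \<beta> k))
      = (\<Prod>k\<in>S - v. tail (anchor T v x y k) powr (- \<beta> k)) * (\<Prod>k\<in>v. tail (anchor T v x y k) powr (- \<beta> k))"
      by (rule prod.subset_diff[OF vS S])
    also have "(\<Prod>k\<in>S - v. tail (anchor T v x y k) powr (- \<beta> k)) = K"
      unfolding K_def by (intro prod.cong) (auto simp: anchor_def)
    also have "(\<Prod>k\<in>v. tail (anchor T v x y k) powr (- \<beta> k)) = (\<Prod>k\<in>v. tail (y k) powr (- \<beta> k))"
      by (intro prod.cong) (auto simp: anchor_def)
    finally show "\<bar>mixed_partial ks v (anchor T v x y)\<bar> \<le> C * K * (\<Prod>k\<in>v. tail (y k) powr (- \<beta> k))"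
      using C(2)[OF anchor_in[OF x v, of y]] by (simp add: mult.assoc)
  qed
qed

lemma measurable_anchor:
  assumes ks: "distinct ks" "set ks \<subseteq> S" and v: "v \<subseteq> T" "T \<subseteq> S" and x: "x \<in> rspace S"
  shows "(\<lambda>y. mixed_partial ks v (anchor T v x y)) \<in> borel_measurable (Pi\<^sub>M v (\<lambda>_. lborel))"
proof (rule measurable_continuous_on_rspace[OF Cr_on_continuous[OF Cr_on_mixed_partial(1)[OF ks]]])
  show "(\<lambda>y. anchor T v x y k) \<in> borel_measurable (Pi\<^sub>M v (\<lambda>_. lborel))" for k
    unfolding anchor_def by (cases "k \<in> v"; cases "k \<in> T") auto
qed (rule anchor_in[OF x v])

lemma measurable_kernels: "(\<lambda>y. kernels v y x) \<in> borel_measurable (Pi\<^sub>M v (\<lambda>_. lborel))"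
  unfolding kernels_def by measurable

sublocale lborel_product: product_sigma_finite "\<lambda>_::nat. lborel :: real measure" ..

text \<open>For fixed \<open>x\<close> the kernel has bounded support in \<open>y\<close>, so every
  exponent is admissible. Decay over all \<open>y\<close> matters only after averaging over
  \<open>x\<close>.\<close>

lemma integrable_powr_kernel: "integrable lborel (\<lambda>y. tail y powr a * \<bar>ftc_kernel c y x\<bar>)"
proof (rule Bochner_Integration.integrable_bound)
  have "continuous_on {min c x..max c x} (\<lambda>y. tail y powr a)" by (intro continuous_intros) auto
  then show "integrable lborel (\<lambda>y. indicator {min c x..max c x} y *\<^sub>R tail y powr a)"
    by (intro borel_integrable_compact) auto
  show "AE y in lborel. norm (tail y powr a * \<bar>ftc_kernel c y x\<bar>) \<le> norm (indicator {min c x..max c x} y *\<^sub>R tail y powr a)"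
  proof (rule AE_I2)
    fix y show "norm (tail y powr a * \<bar>ftc_kernel c y x\<bar>) \<le> norm (indicator {min c x..max c x} y *\<^sub>R tail y powr a)"
      using kernel_support[of y c x] abs_kernel_le[of c y x]
      by (cases "y \<in> {min c x..max c x}") (auto intro: mult_left_le)
  qed
qed measurable

lemma integrable_anchor:
  assumes ks: "distinct ks" "set ks \<subseteq> S" and v: "v \<subseteq> T" "T \<subseteq> S" and x: "x \<in> rspace S"
  shows "integrable (Pi\<^sub>M v (\<lambda>_. lborel)) (\<lambda>y. mixed_partial ks v (anchor T v x y) * kernels v y z)"
proof -
  obtain C where C: "0 \<le> C"
    "\<And>y. \<bar>mixed_partial ks v (anchor T v x y)\<bar> \<le> C * (\<Prod>k\<in>v. tail (y k) powr (- \<beta> k))"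
    using anchor_bound[OF ks v x] by blast
  have fv: "finite v" using v S by (meson finite_subset)
  show ?thesis
  proof (rule Bochner_Integration.integrable_bound)
    show "integrable (Pi\<^sub>M v (\<lambda>_. lborel)) (\<lambda>y. C * (\<Prod>k\<in>v. tail (y k) powr (- \<beta> k) * \<bar>ftc_kernel median (y k) (z k)\<bar>))"
      by (intro integrable_mult_right lborel_product.product_integrable_prod fv integrable_powr_kernel)
    show "(\<lambda>y. mixed_partial ks v (anchor T v x y) * kernels v y z) \<in> borel_measurable (Pi\<^sub>M v (\<lambda>_. lborel))"
      by (intro borel_measurable_times measurable_anchor[OF ks v x] measurable_kernels)
    show "AE y in Pi\<^sub>M v (\<lambda>_. lborel). norm (mixed_partial ks v (anchor T v x y) * kernels v y z)
      \<le> norm (C * (\<Prod>k\<in>v. tail (y k) powr (- \<beta> k) * \<bar>ftc_kernel median (y k) (z k)\<bar>))"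
    proof (rule AE_I2)
      fix y
      have "norm (mixed_partial ks v (anchor T v x y) * kernels v y z)
        = \<bar>mixed_partial ks v (anchor T v x y)\<bar> * \<bar>kernels v y z\<bar>" by (simp add: abs_mult)
      also have "\<dots> \<le> C * (\<Prod>k\<in>v. tail (y k) powr (- \<beta> k)) * \<bar>kernels v y z\<bar>"
        by (intro mult_right_mono C(2)) simp
      also have "\<dots> = C * (\<Prod>k\<in>v. tail (y k) powr (- \<beta> k) * \<bar>ftc_kernel median (y k) (z k)\<bar>)"
        by (simp add: kernels_def abs_prod prod.distrib)
      also have "\<dots> \<le> norm (C * (\<Prod>k\<in>v. tail (y k) powr (- \<beta> k) * \<bar>ftc_kernel median (y k) (z k)\<bar>))"
        by (simp only: real_norm_def abs_ge_self)
      finally show "norm (mixed_partial ks v (anchor T v x y) * kernels v y z)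
        \<le> norm (C * (\<Prod>k\<in>v. tail (y k) powr (- \<beta> k) * \<bar>ftc_kernel median (y k) (z k)\<bar>))" .
    qed
  qed
qed

text \<open>Induction over the treated coordinates. The fundamental theorem in coordinate
  \<open>i\<close> splits the term of \<open>v\<close> into one with that coordinate at the median
  and one for \<open>insert i v\<close>; Fubini absorbs the new integral into the product
  measure.\<close>

lemma anchored_representation:
  assumes "distinct ks" "set ks \<subseteq> S" "x \<in> rspace S"
  shows "H x = (\<Sum>v\<in>Pow (set ks). \<integral>y. mixed_partial ks v (anchor (set ks) v x y) * kernels v y x \<partial>Pi\<^sub>M v (\<lambda>_. lborel))"
  using assms
proof (induction ks)
  case Nil
  have "(\<integral>y. mixed_partial [] {} (anchor {} {} x y) * kernels {} y x \<partial>Pi\<^sub>M {} (\<lambda>_. lborel)) = H x"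
    by (simp add: PiM_empty lebesgue_integral_count_space_finite mixed_partial_def anchor_def kernels_def)
  then show ?case by simp
next
  case (Cons i ks)
  define T where "T = set ks"
  have ks: "distinct ks" "set ks \<subseteq> S" and iks: "distinct (i # ks)" "set (i # ks) \<subseteq> S"
    and i: "i \<in> S" "i \<notin> T" and TS: "T \<subseteq> S" "insert i T \<subseteq> S" and x: "x \<in> rspace S"
    using Cons.prems by (auto simp: T_def)
  let ?I = "\<lambda>v. \<integral>y. mixed_partial (i # ks) v (anchor (insert i T) v x y) * kernels v y x \<partial>Pi\<^sub>M v (\<lambda>_. lborel)"
  have step: "(\<integral>y. mixed_partial ks v (anchor T v x y) * kernels v y x \<partial>Pi\<^sub>M v (\<lambda>_. lborel)) = ?I v + ?I (insert i v)"
    if v: "v \<subseteq> T" for v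
  proof -
    have iv: "i \<notin> v" and fv: "finite v" using v i TS S by (auto intro: finite_subset)
    have mp: "mixed_partial (i # ks) v = mixed_partial ks v"
      using iv by (simp add: mixed_partial_def)
    have mpi: "mixed_partial (i # ks) (insert i v) = partial_deriv i (mixed_partial ks v)"
    proof -
      have "filter (\<lambda>k. k \<in> insert i v) ks = filter (\<lambda>k. k \<in> v) ks"
        using i(2) by (intro filter_cong) (auto simp: T_def)
      then show ?thesis by (simp add: mixed_partial_def)
    qed
    have viT: "v \<subseteq> insert i T" "insert i v \<subseteq> insert i T" using v by auto
    have ftc: "mixed_partial ks v (anchor T v x y) = mixed_partial (i # ks) v (anchor (insert i T) v x y)
      + (\<integral>t. mixed_partial (i # ks) (insert i v) (anchor (insert i T) (insert i v) x (y(i := t))) * ftc_kernel median t (x i) \<partial>lborel)" for y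
    proof -
      define z where "z = anchor T v x y"
      have z: "z \<in> rspace S" unfolding z_def by (rule anchor_in[OF x v TS(1)])
      have zx: "z(i := x i) = z" "z(i := median) = anchor (insert i T) v x y"
        "\<And>t. z(i := t) = anchor (insert i T) (insert i v) x (y(i := t))"
        using iv i(2) by (auto simp: z_def anchor_def)
      let ?n = "card S - length (filter (\<lambda>k. k \<in> v) ks)"
      have n: "0 < ?n"
      proof -
        have "card (set ks) < card S" using i TS unfolding T_def
          by (intro psubset_card_mono[OF S]) auto
        then show ?thesis using Cr_on_mixed_partial(2)[OF ks, of v] by linarith
      qed
      have C: "Cr_on S ?n (mixed_partial ks v)" by (rule Cr_on_mixed_partial(1)[OF ks])
      have "((\<lambda>t. mixed_partial ks v (z(i := t))) has_real_derivative
          partial_deriv i (mixed_partial ks v) (z(i := t))) (at t)" for t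
        by (rule Cr_on_has_partial[OF C n i(1) z])
      moreover have "continuous_on UNIV (\<lambda>t. partial_deriv i (mixed_partial ks v) (z(i := t)))"
      proof -
        have "continuous_on (rspace S) (partial_deriv i (mixed_partial ks v))"
          using Cr_on_continuous[OF Cr_on_mixed_partial(1)[OF iks, of "insert i v"]] unfolding mpi .
        from continuous_on_rspace_line[OF this z i(1)] show ?thesis
          by (intro continuous_at_imp_continuous_on) simp
      qed
      ultimately have "mixed_partial ks v (z(i := x i)) = mixed_partial ks v (z(i := median))
          + (\<integral>t. partial_deriv i (mixed_partial ks v) (z(i := t)) * ftc_kernel median t (x i) \<partial>lborel)"
        by (rule fundamental_theorem_kernel)
      then show ?thesis unfolding zx(1) zx(2) unfolding zx(3) mp mpi z_def[symmetric] .
    qed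
    have int1: "integrable (Pi\<^sub>M v (\<lambda>_. lborel)) (\<lambda>y. mixed_partial (i # ks) v (anchor (insert i T) v x y) * kernels v y x)"
      by (rule integrable_anchor[OF iks viT(1) TS(2) x])
    have int0: "integrable (Pi\<^sub>M v (\<lambda>_. lborel)) (\<lambda>y. mixed_partial ks v (anchor T v x y) * kernels v y x)"
      by (rule integrable_anchor[OF ks v TS(1) x])
    have kern: "kernels (insert i v) (y(i := t)) x = ftc_kernel median t (x i) * kernels v y x" for y t
    proof -
      have "kernels v (y(i := t)) x = kernels v y x" unfolding kernels_def using iv by (intro prod.cong) auto
      then show ?thesis using iv fv by (simp add: kernels_def)
    qed
    have "?I (insert i v) = (\<integral>y. \<integral>t. mixed_partial (i # ks) (insert i v) (anchor (insert i T) (insert i v) x (y(i := t)))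
        * kernels (insert i v) (y(i := t)) x \<partial>lborel \<partial>Pi\<^sub>M v (\<lambda>_. lborel))"
      by (rule lborel_product.product_integral_insert[OF fv iv integrable_anchor[OF iks viT(2) TS(2) x]])
    also have "\<dots> = (\<integral>y. mixed_partial ks v (anchor T v x y) * kernels v y x
        - mixed_partial (i # ks) v (anchor (insert i T) v x y) * kernels v y x \<partial>Pi\<^sub>M v (\<lambda>_. lborel))"
    proof (rule Bochner_Integration.integral_cong[OF refl])
      fix y
      have "(\<integral>t. mixed_partial (i # ks) (insert i v) (anchor (insert i T) (insert i v) x (y(i := t)))
          * kernels (insert i v) (y(i := t)) x \<partial>lborel)
        = (\<integral>t. mixed_partial (i # ks) (insert i v) (anchor (insert i T) (insert i v) x (y(i := t))) * ftc_kernel median t (x i) \<partial>lborel)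
          * kernels v y x"
        unfolding kern by (simp add: mult.assoc[symmetric])
      then show "(\<integral>t. mixed_partial (i # ks) (insert i v) (anchor (insert i T) (insert i v) x (y(i := t)))
          * kernels (insert i v) (y(i := t)) x \<partial>lborel)
        = mixed_partial ks v (anchor T v x y) * kernels v y x
          - mixed_partial (i # ks) v (anchor (insert i T) v x y) * kernels v y x"
        unfolding ftc[of y] by (simp add: algebra_simps)
    qed
    also have "\<dots> = (\<integral>y. mixed_partial ks v (anchor T v x y) * kernels v y x \<partial>Pi\<^sub>M v (\<lambda>_. lborel)) - ?I v"
      by (rule Bochner_Integration.integral_diff[OF int0 int1])
    finally show ?thesis by simp
  qed
  have "H x = (\<Sum>v\<in>Pow T. ?I v + ?I (insert i v))"
    using Cons.IH[OF ks x] by (simp add: T_def[symmetric] step)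
  also have "\<dots> = (\<Sum>v\<in>Pow T. ?I v) + (\<Sum>v\<in>insert i ` Pow T. ?I v)"
  proof -
    have "inj_on (insert i) (Pow T)" using i(2) by (auto simp: inj_on_def insert_eq_iff)
    then show ?thesis by (simp add: sum.distrib sum.reindex)
  qed
  also have "\<dots> = (\<Sum>v\<in>Pow (insert i T). ?I v)"
    unfolding Pow_insert using i(2) TS S
    by (intro sum.union_disjoint[symmetric]) (auto intro: finite_subset)
  finally show ?case by (simp add: T_def)
qed

end

section \<open>The quantile function and product laws\<close>

context positive_density
begin

lemma Phi_inv_measurable [measurable]: "Phi_inv \<rho> \<in> borel_measurable borel"
proof -
  have range: "u \<in> range (Phi \<rho>) \<longleftrightarrow> u \<in> {0<..<1}" for u
    using Phi_surj[of u] by (auto simp: image_iff)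
  \<comment> \<open>Outside the range of \<open>Phi\<close> the inverse is one fixed unspecified
    value, which measurability has to take into account.\<close>
  have "Phi_inv \<rho> u = (SOME x. False)" if "u \<notin> {0<..<1}" for u
  proof -
    have "(\<lambda>x. x \<in> UNIV \<and> Phi \<rho> x = u) = (\<lambda>_. False)" using range[of u] that by auto
    then show ?thesis by (simp add: inv_into_def)
  qed
  then have eq: "Phi_inv \<rho> = (\<lambda>u. if u \<in> {0<..<1} then Phi_inv \<rho> u else (SOME x. False))" by auto
  have "isCont (Phi_inv \<rho>) u" if "u \<in> {0<..<1}" for u
  proof -
    have "0 < u" "u < 1" using that by auto
    from Phi_surj[OF this] obtain x where "Phi \<rho> x = u" .
    then show ?thesis using DERIV_isCont[OF Phi_inv_derivative[of x]] by simp
  qed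
  then have "continuous_on {0<..<1} (Phi_inv \<rho>)" by (intro continuous_at_imp_continuous_on) auto
  then show ?thesis by (subst eq) (intro borel_measurable_continuous_on_if continuous_intros, auto)
qed

lemma Phi_inv_less_iff: "0 < u \<Longrightarrow> u < 1 \<Longrightarrow> Phi_inv \<rho> u < y \<longleftrightarrow> u < Phi \<rho> y"
  using Phi_less_iff[of "Phi_inv \<rho> u" y] Phi_Phi_inv[of u] by simp

lemma AE_law_neq: "AE x in law \<rho>. x \<noteq> y"
  unfolding law_def using AE_lborel_singleton[of y]
  by (subst AE_density) (auto elim: eventually_mono)

lemma space_joint_law: "space (joint_law \<rho> S) = rspace S"
  by (simp add: joint_law_def space_PiM rspace_def law_def)

sublocale law_product: product_prob_space "\<lambda>_::nat. law \<rho>" ..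

lemma prob_space_joint_law: "prob_space (joint_law \<rho> S)"
  unfolding joint_law_def by (rule prob_space_PiM) (rule law.prob_space_axioms)

lemma measurable_joint_component:
  assumes "k \<in> S" "h \<in> borel_measurable borel"
  shows "(\<lambda>x. h (x k)) \<in> borel_measurable (joint_law \<rho> S)"
  unfolding joint_law_def using assms by (intro measurable_compose[OF measurable_component_singleton]) auto

lemma joint_prod:
  fixes f :: "nat \<Rightarrow> real \<Rightarrow> real"
  assumes S: "finite S" and v: "v \<subseteq> S" and f: "\<And>k. k \<in> v \<Longrightarrow> integrable (law \<rho>) (f k)"
  shows "integrable (joint_law \<rho> S) (\<lambda>x. \<Prod>k\<in>v. f k (x k))"
    and "(\<integral>x. (\<Prod>k\<in>v. f k (x k)) \<partial>joint_law \<rho> S) = (\<Prod>k\<in>v. \<integral>t. f k t \<partial>law \<rho>)"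
proof -
  \<comment> \<open>Coordinates outside \<open>v\<close> are filled with the constant factor 1, of
    integral 1.\<close>
  define g where "g k = (if k \<in> v then f k else (\<lambda>_. 1))" for k
  have g: "integrable (law \<rho>) (g k)" for k using f by (simp add: g_def)
  have eq: "(\<Prod>k\<in>v. f k (x k)) = (\<Prod>k\<in>S. g k (x k))" for x
    using S v by (intro prod.mono_neutral_cong_left) (auto simp: g_def)
  show "integrable (joint_law \<rho> S) (\<lambda>x. \<Prod>k\<in>v. f k (x k))"
    unfolding eq joint_law_def by (intro law_product.product_integrable_prod S g)
  have "(\<integral>x. (\<Prod>k\<in>v. f k (x k)) \<partial>joint_law \<rho> S) = (\<Prod>k\<in>S. \<integral>t. g k t \<partial>law \<rho>)"
    unfolding eq joint_law_def by (intro law_product.product_integral_prod S g)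
  also have "\<dots> = (\<Prod>k\<in>v. \<integral>t. f k t \<partial>law \<rho>)"
    using S v law.prob_space by (intro prod.mono_neutral_cong_right) (auto simp: g_def)
  finally show "(\<integral>x. (\<Prod>k\<in>v. f k (x k)) \<partial>joint_law \<rho> S) = (\<Prod>k\<in>v. \<integral>t. f k t \<partial>law \<rho>)" .
qed

end

context smooth_integrand
begin

text \<open>Once all coordinates are treated, nothing of the base point remains in the anchored
  vector, so the undefined vector serves as base point.\<close>

definition mixed_density :: "nat set \<Rightarrow> (nat \<Rightarrow> real) \<Rightarrow> real" where
  "mixed_density v y = mixed_partial (sorted_list_of_set S) v (anchor S v (\<lambda>_. undefined) y)"

lemma sorted_list: "distinct (sorted_list_of_set S)" "set (sorted_list_of_set S) \<subseteq> S" "set (sorted_list_of_set S) = S"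
  using S by auto

lemma undefined_in_rspace: "(\<lambda>_. undefined) \<in> rspace S" by (simp add: rspace_iff)

lemma H_representation:
  assumes "x \<in> rspace S"
  shows "H x = (\<Sum>v\<in>Pow S. \<integral>y. mixed_density v y * kernels v y x \<partial>Pi\<^sub>M v (\<lambda>_. lborel))"
proof -
  have "anchor S v x y = anchor S v (\<lambda>_. undefined) y" for v y
    using assms by (auto simp: anchor_def rspace_iff)
  then show ?thesis
    using anchored_representation[OF sorted_list(1,2) assms] by (simp add: sorted_list(3) mixed_density_def)
qed

lemma density_bound:
  assumes "v \<subseteq> S"
  obtains C where "0 \<le> C" "\<And>y. \<bar>mixed_density v y\<bar> \<le> C * (\<Prod>k\<in>v. tail (y k) powr (- \<beta> k))"
  using anchor_bound[OF sorted_list(1,2) assms order_refl undefined_in_rspace] unfolding mixed_density_def by blast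

lemma density_measurable [measurable]:
  "v \<subseteq> S \<Longrightarrow> mixed_density v \<in> borel_measurable (Pi\<^sub>M v (\<lambda>_. lborel))"
  using measurable_anchor[OF sorted_list(1,2) _ order_refl undefined_in_rspace] unfolding mixed_density_def[abs_def] by blast

lemma density_integrable:
  "v \<subseteq> S \<Longrightarrow> integrable (Pi\<^sub>M v (\<lambda>_. lborel)) (\<lambda>y. mixed_density v y * kernels v y z)"
  using integrable_anchor[OF sorted_list(1,2) _ order_refl undefined_in_rspace] unfolding mixed_density_def by blast

definition kernel_mean :: "nat set \<Rightarrow> (nat \<Rightarrow> real) \<Rightarrow> real" where
  "kernel_mean v y = (\<Prod>k\<in>v. of_bool (median < y k) - Phi \<rho> (y k))"

text \<open>For fixed \<open>y\<close> the kernel has constant sign \<open>s\<close> in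
  \<open>x\<close>, decided by the side of the median on which \<open>y\<close> lies. Hence its mean
  absolute value is the absolute value of its mean, and at the median anchor that is
  \<open>tail y\<close>.\<close>

lemma law_kernel:
  "integrable (law \<rho>) (ftc_kernel median y)"
  "(\<integral>x. ftc_kernel median y x \<partial>law \<rho>) = of_bool (median < y) - Phi \<rho> y"
  "(\<integral>x. \<bar>ftc_kernel median y x\<bar> \<partial>law \<rho>) = tail y"
  "\<bar>of_bool (median < y) - Phi \<rho> y\<bar> = tail y"
proof -
  show int: "integrable (law \<rho>) (ftc_kernel median y)"
    by (rule law.integrable_const_bound[of _ 1]) (auto intro: abs_kernel_le)
  have "(\<integral>x. ftc_kernel median y x \<partial>law \<rho>) = (\<integral>x. of_bool (median < y) - indicator {..y} x \<partial>law \<rho>)"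
  proof (rule integral_cong_AE)
    show "AE x in law \<rho>. ftc_kernel median y x = of_bool (median < y) - indicator {..y} x"
      using AE_law_neq[of y] by eventually_elim (auto simp: ftc_kernel_def)
  qed auto
  also have "\<dots> = of_bool (median < y) - Phi \<rho> y"
    using law.prob_space by (subst Bochner_Integration.integral_diff) (auto simp: cdf_def law.emeasure_eq_measure)
  finally show mean: "(\<integral>x. ftc_kernel median y x \<partial>law \<rho>) = of_bool (median < y) - Phi \<rho> y" .
  define s :: real where "s = (if median < y then 1 else -1)"
  have s: "s * (of_bool (median < y) - Phi \<rho> y) = tail y"
  proof (cases "median < y")
    case True
    then have "1/2 < Phi \<rho> y" using Phi_less_iff[of median y] Phi_median by simp
    then show ?thesis using True by (simp add: s_def tail_def)
  next
    case False
    then have "Phi \<rho> y \<le> 1/2" using Phi_less_iff[of median y] Phi_median by simp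
    then show ?thesis using False by (simp add: s_def tail_def)
  qed
  show "\<bar>of_bool (median < y) - Phi \<rho> y\<bar> = tail y"
    using s tail_nonneg[of y] by (auto simp: s_def split: if_splits)
  have "\<bar>ftc_kernel median y x\<bar> = s * ftc_kernel median y x" for x
    by (auto simp: ftc_kernel_def s_def)
  then show "(\<integral>x. \<bar>ftc_kernel median y x\<bar> \<partial>law \<rho>) = tail y"
    using s by (simp add: mean)
qed

lemma abs_kernel_mean: "\<bar>kernel_mean v y\<bar> = (\<Prod>k\<in>v. tail (y k))"
  by (simp add: kernel_mean_def abs_prod law_kernel(4))

lemma integrable_tail_product:
  assumes v: "v \<subseteq> S" and \<theta>: "\<And>k. k \<in> S \<Longrightarrow> B < \<theta> - \<beta> k"
  shows "integrable (Pi\<^sub>M v (\<lambda>_. lborel)) (\<lambda>y. (\<Prod>k\<in>v. tail (y k) powr (- \<beta> k)) * (\<Prod>k\<in>v. tail (y k) powr \<theta>))"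
proof -
  have "integrable (Pi\<^sub>M v (\<lambda>_. lborel)) (\<lambda>y. \<Prod>k\<in>v. tail (y k) powr (\<theta> - \<beta> k))"
    using v S \<theta> by (intro lborel_product.product_integrable_prod tail_integrable) (auto intro: finite_subset)
  then show ?thesis by (simp add: prod.distrib[symmetric] powr_add[symmetric])
qed

lemma kernels_jointly_measurable:
  assumes "v \<subseteq> S" "\<And>k. k \<in> v \<Longrightarrow> (\<lambda>a. X a k) \<in> borel_measurable N"
  shows "(\<lambda>(y, a). kernels v y (X a)) \<in> borel_measurable (Pi\<^sub>M v (\<lambda>_. lborel) \<Otimes>\<^sub>M N)"
  unfolding kernels_def case_prod_beta'
proof (rule borel_measurable_prod)
  fix k assume k: "k \<in> v"
  have "(\<lambda>z. (fst z k, X (snd z) k)) \<in> measurable (Pi\<^sub>M v (\<lambda>_. lborel) \<Otimes>\<^sub>M N)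
      (borel \<Otimes>\<^sub>M borel :: (real \<times> real) measure)"
  proof (rule measurable_Pair)
    have "(\<lambda>y :: nat \<Rightarrow> real. y k) \<in> borel_measurable (Pi\<^sub>M v (\<lambda>_. lborel))"
      using measurable_component_singleton[OF k, of "\<lambda>_. lborel :: real measure"] by simp
    then show "(\<lambda>z. (fst z :: nat \<Rightarrow> real) k) \<in> borel_measurable (Pi\<^sub>M v (\<lambda>_. lborel) \<Otimes>\<^sub>M N)"
      by (rule measurable_compose[OF measurable_fst])
    show "(\<lambda>z. X (snd z) k) \<in> borel_measurable (Pi\<^sub>M v (\<lambda>_. lborel) \<Otimes>\<^sub>M N)"
      by (rule measurable_compose[OF measurable_snd assms(2)[OF k]])
  qed
  from measurable_compose[OF this kernel_measurable(1)]
  show "(\<lambda>z. ftc_kernel median (fst z k) (X (snd z) k)) \<in> borel_measurable (Pi\<^sub>M v (\<lambda>_. lborel) \<Otimes>\<^sub>M N)" by simp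
qed

text \<open>Integrating the representation against the product law replaces each kernel by its mean.
  Fubini is justified by the weight of exponent 1, for which the condition
  \<open>\<beta> k + B < 1\<close> is made.\<close>

lemma integral_H:
  "(\<integral>x. H x \<partial>joint_law \<rho> S) = (\<Sum>v\<in>Pow S. \<integral>y. mixed_density v y * kernel_mean v y \<partial>Pi\<^sub>M v (\<lambda>_. lborel))"
  "v \<subseteq> S \<Longrightarrow> integrable (Pi\<^sub>M v (\<lambda>_. lborel)) (\<lambda>y. mixed_density v y * kernel_mean v y)"
proof -
  have kern: "integrable (joint_law \<rho> S) (\<lambda>x. kernels v y x)"
    "(\<integral>x. kernels v y x \<partial>joint_law \<rho> S) = kernel_mean v y"
    "(\<integral>x. \<bar>kernels v y x\<bar> \<partial>joint_law \<rho> S) = (\<Prod>k\<in>v. tail (y k))" if v: "v \<subseteq> S" for v y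
    using joint_prod[OF S v law_kernel(1), of y] joint_prod(2)[OF S v integrable_abs[OF law_kernel(1)], of y]
    by (simp_all add: kernels_def kernel_mean_def abs_prod law_kernel)
  have *: "integrable (joint_law \<rho> S) (\<lambda>x. \<integral>y. mixed_density v y * kernels v y x \<partial>Pi\<^sub>M v (\<lambda>_. lborel))
      \<and> (\<integral>x. \<integral>y. mixed_density v y * kernels v y x \<partial>Pi\<^sub>M v (\<lambda>_. lborel) \<partial>joint_law \<rho> S)
        = (\<integral>y. mixed_density v y * kernel_mean v y \<partial>Pi\<^sub>M v (\<lambda>_. lborel))
      \<and> integrable (Pi\<^sub>M v (\<lambda>_. lborel)) (\<lambda>y. mixed_density v y * kernel_mean v y)"
    if v: "v \<subseteq> S" for v
  proof -
    have fv: "finite v" using v S by (rule finite_subset)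
    interpret V: sigma_finite_measure "Pi\<^sub>M v (\<lambda>_. lborel :: real measure)"
      using lborel_product.sigma_finite[OF fv] .
    interpret J: prob_space "joint_law \<rho> S" by (rule prob_space_joint_law)
    interpret VJ: pair_sigma_finite "Pi\<^sub>M v (\<lambda>_. lborel :: real measure)" "joint_law \<rho> S" ..
    obtain C where C: "0 \<le> C" "\<And>y. \<bar>mixed_density v y\<bar> \<le> C * (\<Prod>k\<in>v. tail (y k) powr (- \<beta> k))"
      using density_bound[OF v] by blast
    have dm: "mixed_density v \<in> borel_measurable (Pi\<^sub>M v (\<lambda>_. lborel))" by (rule density_measurable[OF v])
    have tm: "(\<lambda>y. \<Prod>k\<in>v. tail (y k)) \<in> borel_measurable (Pi\<^sub>M v (\<lambda>_. lborel :: real measure))"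
      by measurable
    have abs_int: "integrable (Pi\<^sub>M v (\<lambda>_. lborel)) (\<lambda>y. \<bar>mixed_density v y\<bar> * (\<Prod>k\<in>v. tail (y k)))"
    proof (rule Bochner_Integration.integrable_bound)
      show "integrable (Pi\<^sub>M v (\<lambda>_. lborel)) (\<lambda>y. C * ((\<Prod>k\<in>v. tail (y k) powr (- \<beta> k)) * (\<Prod>k\<in>v. tail (y k) powr 1)))"
        by (intro integrable_mult_right integrable_tail_product[OF v]) (use \<beta>B in fastforce)
      show "(\<lambda>y. \<bar>mixed_density v y\<bar> * (\<Prod>k\<in>v. tail (y k))) \<in> borel_measurable (Pi\<^sub>M v (\<lambda>_. lborel))"
        using dm tm by measurable
      show "AE y in Pi\<^sub>M v (\<lambda>_. lborel). norm (\<bar>mixed_density v y\<bar> * (\<Prod>k\<in>v. tail (y k)))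
        \<le> norm (C * ((\<Prod>k\<in>v. tail (y k) powr (- \<beta> k)) * (\<Prod>k\<in>v. tail (y k) powr 1)))"
      proof (rule AE_I2)
        fix y
        have "\<bar>mixed_density v y\<bar> * (\<Prod>k\<in>v. tail (y k)) \<le> C * (\<Prod>k\<in>v. tail (y k) powr (- \<beta> k)) * (\<Prod>k\<in>v. tail (y k))"
          by (intro mult_right_mono C(2) prod_nonneg) auto
        then show "norm (\<bar>mixed_density v y\<bar> * (\<Prod>k\<in>v. tail (y k)))
          \<le> norm (C * ((\<Prod>k\<in>v. tail (y k) powr (- \<beta> k)) * (\<Prod>k\<in>v. tail (y k) powr 1)))"
          using C(1) by (simp add: abs_mult prod_nonneg mult.assoc)
      qed
    qed
    have meas: "(\<lambda>(y, x). mixed_density v y * kernels v y x) \<in> borel_measurable (Pi\<^sub>M v (\<lambda>_. lborel) \<Otimes>\<^sub>M joint_law \<rho> S)"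
    proof -
      have "(\<lambda>(y, x). kernels v y x) \<in> borel_measurable (Pi\<^sub>M v (\<lambda>_. lborel) \<Otimes>\<^sub>M joint_law \<rho> S)"
        by (rule kernels_jointly_measurable[OF v]) (use v in \<open>auto intro: measurable_joint_component\<close>)
      from borel_measurable_times[OF measurable_compose[OF measurable_fst dm] this]
      show ?thesis by (simp add: case_prod_beta')
    qed
    have int: "integrable (Pi\<^sub>M v (\<lambda>_. lborel) \<Otimes>\<^sub>M joint_law \<rho> S) (\<lambda>(y, x). mixed_density v y * kernels v y x)"
    proof (rule VJ.Fubini_integrable[OF meas])
      show "integrable (Pi\<^sub>M v (\<lambda>_. lborel)) (\<lambda>y. \<integral>x. norm (case (y, x) of (y, x) \<Rightarrow> mixed_density v y * kernels v y x) \<partial>joint_law \<rho> S)"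
        using abs_int by (simp add: abs_mult kern[OF v])
      show "AE y in Pi\<^sub>M v (\<lambda>_. lborel). integrable (joint_law \<rho> S) (\<lambda>x. case (y, x) of (y, x) \<Rightarrow> mixed_density v y * kernels v y x)"
        using kern(1)[OF v] by simp
    qed
    show ?thesis
      using VJ.integrable_snd[OF int] VJ.Fubini_integral[OF int] VJ.integrable_fst[OF int] kern[OF v] by simp
  qed
  show "v \<subseteq> S \<Longrightarrow> integrable (Pi\<^sub>M v (\<lambda>_. lborel)) (\<lambda>y. mixed_density v y * kernel_mean v y)" using * by blast
  have "(\<integral>x. H x \<partial>joint_law \<rho> S)
    = (\<integral>x. (\<Sum>v\<in>Pow S. \<integral>y. mixed_density v y * kernels v y x \<partial>Pi\<^sub>M v (\<lambda>_. lborel)) \<partial>joint_law \<rho> S)"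
    by (intro Bochner_Integration.integral_cong refl H_representation) (simp add: space_joint_law)
  also have "\<dots> = (\<Sum>v\<in>Pow S. \<integral>x. \<integral>y. mixed_density v y * kernels v y x \<partial>Pi\<^sub>M v (\<lambda>_. lborel) \<partial>joint_law \<rho> S)"
    by (rule Bochner_Integration.integral_sum) (use * in blast)
  also have "\<dots> = (\<Sum>v\<in>Pow S. \<integral>y. mixed_density v y * kernel_mean v y \<partial>Pi\<^sub>M v (\<lambda>_. lborel))"
    by (intro sum.cong refl) (use * in blast)
  finally show "(\<integral>x. H x \<partial>joint_law \<rho> S) = (\<Sum>v\<in>Pow S. \<integral>y. mixed_density v y * kernel_mean v y \<partial>Pi\<^sub>M v (\<lambda>_. lborel))" .
qed

end

subsection \<open>Quadrature error\<close>

locale scrambled_quadrature = smooth_integrand \<rho> S H \<beta> B + owen: owen_scrambling b M S \<pi>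
  for \<rho> S H \<beta> B and b :: nat and M :: "'w measure" and \<pi> +
  fixes t :: nat and p :: "nat \<Rightarrow> nat \<Rightarrow> real"
  assumes seq: "ts_sequence b t S p"
begin

definition node :: "nat \<Rightarrow> 'w \<Rightarrow> nat \<Rightarrow> real" where
  "node i \<omega> = (\<lambda>k\<in>S. Phi_inv \<rho> (owen.point p i \<omega> k))"

definition kernel_error :: "nat \<Rightarrow> nat set \<Rightarrow> (nat \<Rightarrow> real) \<Rightarrow> 'w \<Rightarrow> real" where
  "kernel_error n v y \<omega> = 1 / real n * (\<Sum>i=1..n. kernels v y (node i \<omega>)) - kernel_mean v y"

definition error :: "nat \<Rightarrow> 'w \<Rightarrow> real" where
  "error n \<omega> = \<bar>Ihat \<rho> S (\<lambda>i. owen.point p i \<omega>) n H - (\<integral>x. H x \<partial>joint_law \<rho> S)\<bar>"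

lemma node_in: "node i \<omega> \<in> rspace S"
  by (simp add: node_def rspace_iff)

lemma node_measurable: "(\<lambda>\<omega>. node i \<omega> k) \<in> borel_measurable M"
proof (cases "k \<in> S")
  case True
  then have "(\<lambda>\<omega>. node i \<omega> k) = (\<lambda>\<omega>. Phi_inv \<rho> (scramble b (\<lambda>w. \<pi> k w \<omega>) (p i k)))"
    by (simp add: node_def owen.point_apply)
  then show ?thesis
    using measurable_compose[OF owen.measurable_scramble[OF True] Phi_inv_measurable] by simp
qed (simp add: node_def)

lemma error_measurable: "error n \<in> borel_measurable M"
proof -
  have "(\<lambda>\<omega>. H (node i \<omega>)) \<in> borel_measurable M" for i
    by (rule measurable_continuous_on_rspace[OF Cr_on_continuous[OF smooth] node_measurable node_in])
  then show ?thesis unfolding error_def[abs_def] Ihat_def node_def[symmetric] by measurable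
qed

lemma error_eq:
  "error n \<omega> = \<bar>\<Sum>v\<in>Pow S. \<integral>y. mixed_density v y * kernel_error n v y \<omega> \<partial>Pi\<^sub>M v (\<lambda>_. lborel)\<bar>"
proof -
  have "(\<integral>y. mixed_density v y * kernel_error n v y \<omega> \<partial>Pi\<^sub>M v (\<lambda>_. lborel))
    = 1 / real n * (\<Sum>i=1..n. \<integral>y. mixed_density v y * kernels v y (node i \<omega>) \<partial>Pi\<^sub>M v (\<lambda>_. lborel))
      - (\<integral>y. mixed_density v y * kernel_mean v y \<partial>Pi\<^sub>M v (\<lambda>_. lborel))" if v: "v \<subseteq> S" for v
  proof -
    have "(\<integral>y. mixed_density v y * kernel_error n v y \<omega> \<partial>Pi\<^sub>M v (\<lambda>_. lborel))
      = (\<integral>y. 1 / real n * (\<Sum>i=1..n. mixed_density v y * kernels v y (node i \<omega>))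
          - mixed_density v y * kernel_mean v y \<partial>Pi\<^sub>M v (\<lambda>_. lborel))"
      by (rule Bochner_Integration.integral_cong) (simp_all add: kernel_error_def sum_distrib_left right_diff_distrib ac_simps)
    also have "\<dots> = (\<integral>y. 1 / real n * (\<Sum>i=1..n. mixed_density v y * kernels v y (node i \<omega>)) \<partial>Pi\<^sub>M v (\<lambda>_. lborel))
        - (\<integral>y. mixed_density v y * kernel_mean v y \<partial>Pi\<^sub>M v (\<lambda>_. lborel))"
      by (intro Bochner_Integration.integral_diff integrable_mult_right Bochner_Integration.integrable_sum
          density_integrable v integral_H(2))
    also have "(\<integral>y. 1 / real n * (\<Sum>i=1..n. mixed_density v y * kernels v y (node i \<omega>)) \<partial>Pi\<^sub>M v (\<lambda>_. lborel))
      = 1 / real n * (\<Sum>i=1..n. \<integral>y. mixed_density v y * kernels v y (node i \<omega>) \<partial>Pi\<^sub>M v (\<lambda>_. lborel))"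
      unfolding Bochner_Integration.integral_mult_right_zero
      by (subst Bochner_Integration.integral_sum) (auto intro: density_integrable[OF v])
    finally show ?thesis .
  qed
  then have "(\<Sum>v\<in>Pow S. \<integral>y. mixed_density v y * kernel_error n v y \<omega> \<partial>Pi\<^sub>M v (\<lambda>_. lborel))
    = 1 / real n * (\<Sum>v\<in>Pow S. \<Sum>i=1..n. \<integral>y. mixed_density v y * kernels v y (node i \<omega>) \<partial>Pi\<^sub>M v (\<lambda>_. lborel))
      - (\<Sum>v\<in>Pow S. \<integral>y. mixed_density v y * kernel_mean v y \<partial>Pi\<^sub>M v (\<lambda>_. lborel))"
    by (simp add: sum_subtractf sum_distrib_left)
  also have "(\<Sum>v\<in>Pow S. \<Sum>i=1..n. \<integral>y. mixed_density v y * kernels v y (node i \<omega>) \<partial>Pi\<^sub>M v (\<lambda>_. lborel))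
    = (\<Sum>i=1..n. H (node i \<omega>))"
    by (subst sum.swap) (simp add: H_representation[OF node_in, symmetric])
  finally show ?thesis unfolding error_def Ihat_def integral_H(1) node_def[symmetric] by simp
qed

lemma kernel_error_jointly_measurable:
  assumes v: "v \<subseteq> S"
  shows "(\<lambda>(y, \<omega>). kernel_error n v y \<omega>) \<in> borel_measurable (Pi\<^sub>M v (\<lambda>_. lborel) \<Otimes>\<^sub>M M)"
proof -
  have 1: "(\<lambda>z. kernels v (fst z) (node i (snd z))) \<in> borel_measurable (Pi\<^sub>M v (\<lambda>_. lborel) \<Otimes>\<^sub>M M)" for i
    using kernels_jointly_measurable[OF v, of "node i" M] node_measurable by (simp add: case_prod_beta')
  have "kernel_mean v \<in> borel_measurable (Pi\<^sub>M v (\<lambda>_. lborel))"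
    unfolding kernel_mean_def[abs_def] of_bool_def by measurable
  then have 2: "(\<lambda>z. kernel_mean v (fst z)) \<in> borel_measurable (Pi\<^sub>M v (\<lambda>_. lborel) \<Otimes>\<^sub>M M)"
    by (rule measurable_compose[OF measurable_fst])
  show ?thesis unfolding kernel_error_def case_prod_beta'
    by (intro borel_measurable_diff borel_measurable_times borel_measurable_sum borel_measurable_const 1 2)
qed

text \<open>\<open>C\<close> is fixed before \<open>n\<close> and \<open>K\<close>, so any rate for
  the corner-box errors passes to the quadrature error. Nonnegative extended integrals are used
  because integrability of the error is itself derived from this lemma, with exponent 1.\<close>

lemma expected_error_le:
  assumes \<theta>: "\<And>k. k \<in> S \<Longrightarrow> B < \<theta> - \<beta> k"
  obtains C where "0 \<le> C" "\<And>n K. 0 \<le> K \<Longrightarrow>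
    (\<And>v y. v \<subseteq> S \<Longrightarrow> (\<integral>\<^sup>+\<omega>. ennreal \<bar>kernel_error n v y \<omega>\<bar> \<partial>M) \<le> ennreal (K * (\<Prod>k\<in>v. tail (y k) powr \<theta>))) \<Longrightarrow>
    (\<integral>\<^sup>+\<omega>. ennreal (error n \<omega>) \<partial>M) \<le> ennreal (C * K)"
proof -
  define J where "J v = (\<integral>y. (\<Prod>k\<in>v. tail (y k) powr (- \<beta> k)) * (\<Prod>k\<in>v. tail (y k) powr \<theta>) \<partial>Pi\<^sub>M v (\<lambda>_. lborel))" for v
  have "\<exists>C\<ge>0. \<forall>y. \<bar>mixed_density v y\<bar> \<le> C * (\<Prod>k\<in>v. tail (y k) powr (- \<beta> k))" if "v \<subseteq> S" for v
    using density_bound[OF that] by metis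
  then obtain C where C: "\<And>v. v \<subseteq> S \<Longrightarrow> 0 \<le> C v"
    "\<And>v y. v \<subseteq> S \<Longrightarrow> \<bar>mixed_density v y\<bar> \<le> C v * (\<Prod>k\<in>v. tail (y k) powr (- \<beta> k))" by metis
  have J: "0 \<le> J v" for v
    unfolding J_def by (intro Bochner_Integration.integral_nonneg) (auto intro!: mult_nonneg_nonneg prod_nonneg)
  show ?thesis
  proof (rule that)
    show "0 \<le> (\<Sum>v\<in>Pow S. C v * J v)" using C(1) J by (intro sum_nonneg mult_nonneg_nonneg) auto
    fix n and K :: real
    assume K: "0 \<le> K" and E: "\<And>v y. v \<subseteq> S \<Longrightarrow>
      (\<integral>\<^sup>+\<omega>. ennreal \<bar>kernel_error n v y \<omega>\<bar> \<partial>M) \<le> ennreal (K * (\<Prod>k\<in>v. tail (y k) powr \<theta>))"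
    have part: "(\<integral>\<^sup>+\<omega>. \<integral>\<^sup>+y. ennreal \<bar>mixed_density v y * kernel_error n v y \<omega>\<bar> \<partial>Pi\<^sub>M v (\<lambda>_. lborel) \<partial>M)
      \<le> ennreal (C v * J v * K)" if v: "v \<subseteq> S" for v
    proof -
      have fv: "finite v" using v S by (rule finite_subset)
      interpret V: sigma_finite_measure "Pi\<^sub>M v (\<lambda>_. lborel :: real measure)"
        using lborel_product.sigma_finite[OF fv] .
      interpret VM: pair_sigma_finite "Pi\<^sub>M v (\<lambda>_. lborel :: real measure)" M ..
      have dm: "mixed_density v \<in> borel_measurable (Pi\<^sub>M v (\<lambda>_. lborel))" by (rule density_measurable[OF v])
      have km: "(\<lambda>z. kernel_error n v (fst z) (snd z)) \<in> borel_measurable (Pi\<^sub>M v (\<lambda>_. lborel) \<Otimes>\<^sub>M M)"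
        using kernel_error_jointly_measurable[OF v] by (simp add: case_prod_beta')
      have m: "(\<lambda>(y, \<omega>). ennreal \<bar>mixed_density v y * kernel_error n v y \<omega>\<bar>) \<in> borel_measurable (Pi\<^sub>M v (\<lambda>_. lborel) \<Otimes>\<^sub>M M)"
        using borel_measurable_times[OF measurable_compose[OF measurable_fst dm] km] unfolding case_prod_beta'
        by measurable
      have "(\<integral>\<^sup>+\<omega>. \<integral>\<^sup>+y. ennreal \<bar>mixed_density v y * kernel_error n v y \<omega>\<bar> \<partial>Pi\<^sub>M v (\<lambda>_. lborel) \<partial>M)
        = (\<integral>\<^sup>+y. \<integral>\<^sup>+\<omega>. ennreal \<bar>mixed_density v y * kernel_error n v y \<omega>\<bar> \<partial>M \<partial>Pi\<^sub>M v (\<lambda>_. lborel))"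
        by (rule VM.Fubini'[OF m])
      also have "\<dots> \<le> (\<integral>\<^sup>+y. ennreal (C v * K * ((\<Prod>k\<in>v. tail (y k) powr (- \<beta> k)) * (\<Prod>k\<in>v. tail (y k) powr \<theta>))) \<partial>Pi\<^sub>M v (\<lambda>_. lborel))"
      proof (rule nn_integral_mono)
        fix y assume y: "y \<in> space (Pi\<^sub>M v (\<lambda>_. lborel :: real measure))"
        have "(\<lambda>\<omega>. kernel_error n v y \<omega>) \<in> borel_measurable M"
          using measurable_compose[OF measurable_Pair1'[OF y] km] by simp
        then have "(\<integral>\<^sup>+\<omega>. ennreal \<bar>mixed_density v y * kernel_error n v y \<omega>\<bar> \<partial>M)
          = ennreal \<bar>mixed_density v y\<bar> * (\<integral>\<^sup>+\<omega>. ennreal \<bar>kernel_error n v y \<omega>\<bar> \<partial>M)"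
          by (simp add: abs_mult ennreal_mult nn_integral_cmult)
        also have "\<dots> \<le> ennreal (C v * (\<Prod>k\<in>v. tail (y k) powr (- \<beta> k))) * ennreal (K * (\<Prod>k\<in>v. tail (y k) powr \<theta>))"
          by (intro mult_mono E v ennreal_leI C(2)) auto
        also have "\<dots> = ennreal ((C v * (\<Prod>k\<in>v. tail (y k) powr (- \<beta> k))) * (K * (\<Prod>k\<in>v. tail (y k) powr \<theta>)))"
          using C(1)[OF v] K by (intro ennreal_mult[symmetric] mult_nonneg_nonneg prod_nonneg) auto
        finally show "(\<integral>\<^sup>+\<omega>. ennreal \<bar>mixed_density v y * kernel_error n v y \<omega>\<bar> \<partial>M)
          \<le> ennreal (C v * K * ((\<Prod>k\<in>v. tail (y k) powr (- \<beta> k)) * (\<Prod>k\<in>v. tail (y k) powr \<theta>)))"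
          by (simp add: ac_simps)
      qed
      also have "\<dots> = ennreal (\<integral>y. C v * K * ((\<Prod>k\<in>v. tail (y k) powr (- \<beta> k)) * (\<Prod>k\<in>v. tail (y k) powr \<theta>)) \<partial>Pi\<^sub>M v (\<lambda>_. lborel))"
        using C(1)[OF v] K by (intro nn_integral_eq_integral integrable_mult_right integrable_tail_product[OF v \<theta>] AE_I2)
          (auto intro!: mult_nonneg_nonneg prod_nonneg)
      also have "\<dots> = ennreal (C v * J v * K)" by (simp add: J_def ac_simps)
      finally show ?thesis .
    qed
    have "(\<integral>\<^sup>+\<omega>. ennreal (error n \<omega>) \<partial>M)
      \<le> (\<integral>\<^sup>+\<omega>. (\<Sum>v\<in>Pow S. \<integral>\<^sup>+y. ennreal \<bar>mixed_density v y * kernel_error n v y \<omega>\<bar> \<partial>Pi\<^sub>M v (\<lambda>_. lborel)) \<partial>M)"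
    proof (rule nn_integral_mono)
      fix \<omega> assume \<omega>: "\<omega> \<in> space M"
      have "error n \<omega> \<le> (\<Sum>v\<in>Pow S. \<bar>\<integral>y. mixed_density v y * kernel_error n v y \<omega> \<partial>Pi\<^sub>M v (\<lambda>_. lborel)\<bar>)"
        unfolding error_eq by (rule sum_abs)
      then have "ennreal (error n \<omega>) \<le> (\<Sum>v\<in>Pow S. ennreal \<bar>\<integral>y. mixed_density v y * kernel_error n v y \<omega> \<partial>Pi\<^sub>M v (\<lambda>_. lborel)\<bar>)"
        by (subst sum_ennreal) (auto intro: ennreal_leI)
      also have "\<dots> \<le> (\<Sum>v\<in>Pow S. \<integral>\<^sup>+y. ennreal \<bar>mixed_density v y * kernel_error n v y \<omega>\<bar> \<partial>Pi\<^sub>M v (\<lambda>_. lborel))"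
      proof (rule sum_mono)
        fix v
        have "ennreal (norm (\<integral>y. mixed_density v y * kernel_error n v y \<omega> \<partial>Pi\<^sub>M v (\<lambda>_. lborel)))
          \<le> (\<integral>\<^sup>+y. ennreal (norm (mixed_density v y * kernel_error n v y \<omega>)) \<partial>Pi\<^sub>M v (\<lambda>_. lborel))"
        \<comment> \<open>In the non-integrable case the Bochner integral is 0 by convention and the
          bound is trivial.\<close>
        proof (cases "integrable (Pi\<^sub>M v (\<lambda>_. lborel)) (\<lambda>y. mixed_density v y * kernel_error n v y \<omega>)")
          case True
          then show ?thesis by (rule integral_norm_bound_ennreal)
        qed (simp add: not_integrable_integral_eq)
        then show "ennreal \<bar>\<integral>y. mixed_density v y * kernel_error n v y \<omega> \<partial>Pi\<^sub>M v (\<lambda>_. lborel)\<bar>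
          \<le> (\<integral>\<^sup>+y. ennreal \<bar>mixed_density v y * kernel_error n v y \<omega>\<bar> \<partial>Pi\<^sub>M v (\<lambda>_. lborel))" by simp
      qed
      finally show "ennreal (error n \<omega>) \<le> (\<Sum>v\<in>Pow S. \<integral>\<^sup>+y. ennreal \<bar>mixed_density v y * kernel_error n v y \<omega>\<bar> \<partial>Pi\<^sub>M v (\<lambda>_. lborel))" .
    qed
    also have "\<dots> = (\<Sum>v\<in>Pow S. \<integral>\<^sup>+\<omega>. \<integral>\<^sup>+y. ennreal \<bar>mixed_density v y * kernel_error n v y \<omega>\<bar> \<partial>Pi\<^sub>M v (\<lambda>_. lborel) \<partial>M)"
    proof (rule nn_integral_sum)
      fix v assume "v \<in> Pow S"
      then have v: "v \<subseteq> S" by simp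
      have fv: "finite v" using v S by (rule finite_subset)
      interpret V: sigma_finite_measure "Pi\<^sub>M v (\<lambda>_. lborel :: real measure)"
        using lborel_product.sigma_finite[OF fv] .
      have dm: "mixed_density v \<in> borel_measurable (Pi\<^sub>M v (\<lambda>_. lborel))" by (rule density_measurable[OF v])
      have km: "(\<lambda>z. kernel_error n v (snd z) (fst z)) \<in> borel_measurable (M \<Otimes>\<^sub>M Pi\<^sub>M v (\<lambda>_. lborel))"
        using measurable_pair_swap[OF kernel_error_jointly_measurable[OF v]] by (simp add: case_prod_beta')
      have "(\<lambda>z. ennreal \<bar>mixed_density v (snd z) * kernel_error n v (snd z) (fst z)\<bar>) \<in> borel_measurable (M \<Otimes>\<^sub>M Pi\<^sub>M v (\<lambda>_. lborel))"
        using borel_measurable_times[OF measurable_compose[OF measurable_snd dm] km] by measurable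
      from V.borel_measurable_nn_integral_fst[OF this]
      show "(\<lambda>\<omega>. \<integral>\<^sup>+y. ennreal \<bar>mixed_density v y * kernel_error n v y \<omega>\<bar> \<partial>Pi\<^sub>M v (\<lambda>_. lborel)) \<in> borel_measurable M" by simp
    qed
    also have "\<dots> \<le> (\<Sum>v\<in>Pow S. ennreal (C v * J v * K))" by (intro sum_mono part) simp
    also have "\<dots> = ennreal ((\<Sum>v\<in>Pow S. C v * J v) * K)"
      using C(1) J K by (subst sum_ennreal) (auto simp: sum_distrib_right)
    finally show "(\<integral>\<^sup>+\<omega>. ennreal (error n \<omega>) \<partial>M) \<le> ennreal ((\<Sum>v\<in>Pow S. C v * J v) * K)" .
  qed
qed

lemma kernel_node:
  assumes "owen.regular p \<omega>" "k \<in> S"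
  shows "node i \<omega> k < y \<longleftrightarrow> owen.point p i \<omega> k < Phi \<rho> y"
  using owen.point_bounds[OF assms, of i] assms(2) by (simp add: node_def Phi_inv_less_iff)

text \<open>A nonzero product of kernels puts the point in the corner box of sides
  \<open>tail (y k)\<close>: at the upper end where \<open>y k\<close> exceeds the median, at the
  lower end elsewhere. Each term of the average is thus controlled by a corner probability, whatever
  \<open>n\<close> is.\<close>

lemma expected_kernel_error_tail:
  assumes v: "v \<subseteq> S"
  shows "integrable M (kernel_error n v y)"
    and "(\<integral>\<omega>. \<bar>kernel_error n v y \<omega>\<bar> \<partial>M) \<le> (real b ^ card S + 1) * (\<Prod>k\<in>v. tail (y k))"
proof -
  define T where "T = (\<Prod>k\<in>v. tail (y k))"
  have T: "0 \<le> T" by (simp add: T_def prod_nonneg)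
  have meas: "(\<lambda>\<omega>. kernels v y (node i \<omega>)) \<in> borel_measurable M" for i
    unfolding kernels_def
    by (intro borel_measurable_prod measurable_compose[OF node_measurable kernel_measurable(3)])
  have bnd: "\<bar>kernels v y x\<bar> \<le> 1" for x
    unfolding kernels_def abs_prod by (intro prod_le_1) (auto simp: abs_kernel_le)
  have int: "integrable M (\<lambda>\<omega>. kernels v y (node i \<omega>))" for i
    by (rule owen.integrable_const_bound[of _ 1]) (auto simp: bnd meas)
  show ie: "integrable M (kernel_error n v y)"
    unfolding kernel_error_def[abs_def]
    by (intro Bochner_Integration.integrable_diff integrable_mult_right Bochner_Integration.integrable_sum int) simp
  have one: "(\<integral>\<omega>. \<bar>kernels v y (node i \<omega>)\<bar> \<partial>M) \<le> real b ^ card S * T" for i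
  proof -
    let ?A = "{\<omega>\<in>space M. \<forall>k\<in>v. if median < y k then 1 - tail (y k) \<le> owen.point p i \<omega> k else owen.point p i \<omega> k < tail (y k)}"
    have fv: "finite v" using v S by (rule finite_subset)
    have A: "?A \<in> sets M"
    proof (intro sets.sets_Collect_finite_All fv)
      fix k assume "k \<in> v"
      then have "(\<lambda>\<omega>. owen.point p i \<omega> k) \<in> borel_measurable M"
        using owen.measurable_scramble v by (simp add: owen.point_apply subset_iff)
      then show "{\<omega>\<in>space M. if median < y k then 1 - tail (y k) \<le> owen.point p i \<omega> k else owen.point p i \<omega> k < tail (y k)} \<in> sets M"
        by measurable
    qed
    have "(\<integral>\<omega>. \<bar>kernels v y (node i \<omega>)\<bar> \<partial>M) \<le> (\<integral>\<omega>. indicator ?A \<omega> \<partial>M)"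
    proof (rule integral_mono_AE)
      show "integrable M (\<lambda>\<omega>. \<bar>kernels v y (node i \<omega>)\<bar>)" by (intro integrable_abs int)
      show "integrable M (indicator ?A :: 'w \<Rightarrow> real)" using A by (simp add: owen.emeasure_eq_measure)
      show "AE \<omega> in M. \<bar>kernels v y (node i \<omega>)\<bar> \<le> indicator ?A \<omega>"
        using owen.AE_regular[of p]
      proof eventually_elim
        case (elim \<omega>)
        show ?case
        proof (cases "\<omega> \<in> ?A")
          case False
          then obtain k where k: "k \<in> v"
            "\<not> (if median < y k then 1 - tail (y k) \<le> owen.point p i \<omega> k else owen.point p i \<omega> k < tail (y k))"
            using elim by (auto simp: owen.regular_def)
          have kS: "k \<in> S" using k(1) v by blast
          have "ftc_kernel median (y k) (node i \<omega> k) = 0"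
          proof (cases "median < y k")
            case True
            then have "tail (y k) = 1 - Phi \<rho> (y k)"
              using law_kernel(4)[of "y k"] Phi_less_1[of "y k"] by simp
            then show ?thesis using True k(2) kernel_node[OF elim kS, of i "y k"] by (simp add: ftc_kernel_def)
          next
            case False
            then have "tail (y k) = Phi \<rho> (y k)"
              using law_kernel(4)[of "y k"] Phi_pos[of "y k"] by simp
            then show ?thesis using False k(2) kernel_node[OF elim kS, of i "y k"] by (simp add: ftc_kernel_def)
          qed
          then have "kernels v y (node i \<omega>) = 0" unfolding kernels_def using fv k(1) by (intro prod_zero) auto
          then show ?thesis by simp
        qed (simp add: bnd)
      qed
    qed
    also have "\<dots> = measure M ?A" using A by simp
    also have "\<dots> \<le> real b ^ card v * T" unfolding T_def
      by (rule owen.prob_corner_le[OF v]) (auto intro: order_le_less_trans[OF tail_le_half])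
    also have "\<dots> \<le> real b ^ card S * T"
      using owen.b v S T by (intro mult_right_mono power_increasing card_mono) auto
    finally show ?thesis .
  qed
  have "(\<integral>\<omega>. \<bar>kernel_error n v y \<omega>\<bar> \<partial>M)
    \<le> (\<integral>\<omega>. 1 / real n * (\<Sum>i=1..n. \<bar>kernels v y (node i \<omega>)\<bar>) + T \<partial>M)"
  proof (rule integral_mono)
    show "integrable M (\<lambda>\<omega>. \<bar>kernel_error n v y \<omega>\<bar>)" using ie by (rule integrable_abs)
    show "integrable M (\<lambda>\<omega>. 1 / real n * (\<Sum>i=1..n. \<bar>kernels v y (node i \<omega>)\<bar>) + T)"
      by (intro Bochner_Integration.integrable_add integrable_mult_right Bochner_Integration.integrable_sum integrable_abs int) simp
    fix \<omega>
    have "\<bar>1 / real n * (\<Sum>i=1..n. kernels v y (node i \<omega>))\<bar> \<le> 1 / real n * (\<Sum>i=1..n. \<bar>kernels v y (node i \<omega>)\<bar>)"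
      unfolding abs_mult by (intro mult_mono sum_abs) auto
    then show "\<bar>kernel_error n v y \<omega>\<bar> \<le> 1 / real n * (\<Sum>i=1..n. \<bar>kernels v y (node i \<omega>)\<bar>) + T"
      using abs_kernel_mean[of v y] unfolding kernel_error_def T_def by linarith
  qed
  also have "\<dots> = 1 / real n * (\<Sum>i=1..n. \<integral>\<omega>. \<bar>kernels v y (node i \<omega>)\<bar> \<partial>M) + T"
  proof -
    have "integrable M (\<lambda>\<omega>. \<Sum>i=1..n. \<bar>kernels v y (node i \<omega>)\<bar>)"
      by (intro Bochner_Integration.integrable_sum integrable_abs int)
    then show ?thesis
      using owen.prob_space
      by (subst Bochner_Integration.integral_add)
        (auto simp: Bochner_Integration.integral_sum[OF integrable_abs[OF int]])
  qed
  also have "\<dots> \<le> 1 / real n * (\<Sum>i=1..n. real b ^ card S * T) + T"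
    by (intro add_right_mono mult_left_mono sum_mono one) auto
  \<comment> \<open>For \<open>n = 0\<close> the average vanishes, as \<open>1 / real 0 = 0\<close>;
    so the bound holds for every \<open>n\<close>.\<close>
  also have "\<dots> \<le> real b ^ card S * T + T"
    using T by (cases "n = 0") auto
  finally show "(\<integral>\<omega>. \<bar>kernel_error n v y \<omega>\<bar> \<partial>M) \<le> (real b ^ card S + 1) * (\<Prod>k\<in>v. tail (y k))"
    by (simp add: T_def algebra_simps)
qed

text \<open>Multiplying out the kernels gives a signed sum over the subsets \<open>w\<close> of
  \<open>v\<close>, each term counting points in a box anchored at the origin, and the mean expands
  in the same way. Each of the at most \<open>2 ^ card S\<close> differences is a local discrepancy
  of the scrambled sequence.\<close>

lemma expected_kernel_error_discrepancy:
  fixes \<epsilon> :: real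
  assumes \<epsilon>: "0 < \<epsilon>"
  obtains C where "0 \<le> C" "\<And>v n y. v \<subseteq> S \<Longrightarrow> 1 \<le> n \<Longrightarrow>
    (\<integral>\<omega>. \<bar>kernel_error n v y \<omega>\<bar> \<partial>M) \<le> C * real n powr (\<epsilon> - 1)"
proof -
  obtain C where C: "0 \<le> C"
    "\<And>p n Q z. \<lbrakk>ts_sequence b t S p; 1 \<le> n; Q \<subseteq> S; \<And>k. k \<in> Q \<Longrightarrow> 0 \<le> z k \<and> z k < 1\<rbrakk> \<Longrightarrow>
      \<bar>real (card {i\<in>{1..n}. \<forall>k\<in>Q. p i k < z k}) - real n * (\<Prod>k\<in>Q. z k)\<bar> \<le> C * real n powr \<epsilon>"
    using sequence_discrepancy[OF owen.b S \<epsilon>, of t] by blast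
  show ?thesis
  proof (rule that)
    show "0 \<le> 2 ^ card S * C" using C(1) by simp
    fix v and y :: "nat \<Rightarrow> real" and n :: nat
    assume v: "v \<subseteq> S" and n: "1 \<le> n"
    have fv: "finite v" using v S by (rule finite_subset)
    define A where "A k = (of_bool (median < y k) :: real)" for k
    have point: "\<bar>kernel_error n v y \<omega>\<bar> \<le> 2 ^ card S * C * real n powr (\<epsilon> - 1)" if \<omega>: "owen.regular p \<omega>" for \<omega>
    proof -
      define N where "N w = {i\<in>{1..n}. \<forall>k\<in>w. owen.point p i \<omega> k < Phi \<rho> (y k)}" for w
      have kern: "kernels v y (node i \<omega>) = (\<Sum>w\<in>Pow v. (\<Prod>k\<in>v - w. A k) * (- 1) ^ card w
          * of_bool (\<forall>k\<in>w. owen.point p i \<omega> k < Phi \<rho> (y k)))" for i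
      proof -
        have "kernels v y (node i \<omega>) = (\<Prod>k\<in>v. - of_bool (owen.point p i \<omega> k < Phi \<rho> (y k)) + A k)"
          unfolding kernels_def
        proof (rule prod.cong[OF refl])
          fix k assume "k \<in> v"
          then have "k \<in> S" using v by blast
          from kernel_node[OF \<omega> this, of i "y k"]
          show "ftc_kernel median (y k) (node i \<omega> k) = - of_bool (owen.point p i \<omega> k < Phi \<rho> (y k)) + A k"
            by (simp add: ftc_kernel_def A_def)
        qed
        also have "\<dots> = (\<Sum>w\<in>Pow v. (\<Prod>k\<in>w. - of_bool (owen.point p i \<omega> k < Phi \<rho> (y k))) * (\<Prod>k\<in>v - w. A k))"
          by (rule prod_add[OF fv])
        also have "\<dots> = (\<Sum>w\<in>Pow v. (\<Prod>k\<in>v - w. A k) * (- 1) ^ card w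
          * of_bool (\<forall>k\<in>w. owen.point p i \<omega> k < Phi \<rho> (y k)))"
        proof (rule sum.cong[OF refl])
          fix w assume "w \<in> Pow v"
          then have fw: "finite w" using fv by (auto intro: finite_subset)
          have "(\<Prod>k\<in>w. - of_bool (P k)) = (- 1) ^ card w * (of_bool (\<forall>k\<in>w. P k) :: real)" for P
            using fw by (induction w rule: finite_induct) auto
          then show "(\<Prod>k\<in>w. - of_bool (owen.point p i \<omega> k < Phi \<rho> (y k))) * (\<Prod>k\<in>v - w. A k)
            = (\<Prod>k\<in>v - w. A k) * (- 1) ^ card w * of_bool (\<forall>k\<in>w. owen.point p i \<omega> k < Phi \<rho> (y k))"
            by simp
        qed
        finally show ?thesis .
      qed
      have mean: "kernel_mean v y = (\<Sum>w\<in>Pow v. (\<Prod>k\<in>v - w. A k) * (- 1) ^ card w * (\<Prod>k\<in>w. Phi \<rho> (y k)))"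
      proof -
        have "kernel_mean v y = (\<Prod>k\<in>v. - Phi \<rho> (y k) + A k)"
          unfolding kernel_mean_def A_def by (intro prod.cong) auto
        also have "\<dots> = (\<Sum>w\<in>Pow v. (\<Prod>k\<in>w. - Phi \<rho> (y k)) * (\<Prod>k\<in>v - w. A k))"
          by (rule prod_add[OF fv])
        finally show ?thesis by (simp add: prod_uminus ac_simps)
      qed
      have sumN: "(\<Sum>i=1..n. of_bool (\<forall>k\<in>w. owen.point p i \<omega> k < Phi \<rho> (y k))) = real (card (N w))" for w
        by (simp add: N_def of_bool_def sum.If_cases Int_def conj_commute)
      have "(\<Sum>i=1..n. kernels v y (node i \<omega>))
        = (\<Sum>w\<in>Pow v. (\<Prod>k\<in>v - w. A k) * (- 1) ^ card w * real (card (N w)))"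
        unfolding kern sumN[symmetric] sum_distrib_left by (rule sum.swap)
      then have "kernel_error n v y \<omega> = (\<Sum>w\<in>Pow v. (\<Prod>k\<in>v - w. A k) * (- 1) ^ card w
          * (real (card (N w)) - real n * (\<Prod>k\<in>w. Phi \<rho> (y k))) / real n)"
        using n by (simp add: kernel_error_def mean sum_divide_distrib sum_subtractf[symmetric] field_simps)
      also have "\<bar>\<dots>\<bar> \<le> (\<Sum>w\<in>Pow v. C * real n powr (\<epsilon> - 1))"
      proof (rule order_trans[OF sum_abs sum_mono])
        fix w assume w: "w \<in> Pow v"
        have seq': "ts_sequence b t S (\<lambda>i. owen.point p i \<omega>)" by (rule owen.ts_sequence_scrambled[OF seq \<omega>])
        have "\<bar>real (card (N w)) - real n * (\<Prod>k\<in>w. Phi \<rho> (y k))\<bar> \<le> C * real n powr \<epsilon>"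
          unfolding N_def by (rule C(2)[OF seq' n]) (use w v in \<open>auto simp: less_imp_le\<close>)
        moreover have "\<bar>\<Prod>k\<in>v - w. A k\<bar> \<le> 1" unfolding abs_prod by (intro prod_le_1) (auto simp: A_def)
        ultimately have "\<bar>\<Prod>k\<in>v - w. A k\<bar> * \<bar>real (card (N w)) - real n * (\<Prod>k\<in>w. Phi \<rho> (y k))\<bar> / real n
          \<le> 1 * (C * real n powr \<epsilon>) / real n"
          by (intro divide_right_mono mult_mono) auto
        also have "\<dots> = C * real n powr (\<epsilon> - 1)" using n by (simp add: powr_diff)
        finally show "\<bar>(\<Prod>k\<in>v - w. A k) * (- 1) ^ card w
          * (real (card (N w)) - real n * (\<Prod>k\<in>w. Phi \<rho> (y k))) / real n\<bar> \<le> C * real n powr (\<epsilon> - 1)"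
          by (simp add: abs_mult power_abs)
      qed
      also have "\<dots> = 2 ^ card v * (C * real n powr (\<epsilon> - 1))" by (simp add: card_Pow[OF fv])
      also have "\<dots> \<le> 2 ^ card S * (C * real n powr (\<epsilon> - 1))"
        using C(1) v S by (intro mult_right_mono power_increasing card_mono) auto
      finally show ?thesis by (simp add: mult.assoc)
    qed
    have "(\<integral>\<omega>. \<bar>kernel_error n v y \<omega>\<bar> \<partial>M) \<le> (\<integral>\<omega>. 2 ^ card S * C * real n powr (\<epsilon> - 1) \<partial>M)"
      by (rule integral_mono_AE[OF integrable_abs[OF expected_kernel_error_tail(1)[OF v]]])
        (use owen.AE_regular[of p] point in \<open>auto elim: eventually_mono\<close>)
    then show "(\<integral>\<omega>. \<bar>kernel_error n v y \<omega>\<bar> \<partial>M) \<le> 2 ^ card S * C * real n powr (\<epsilon> - 1)"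
      using owen.prob_space by simp
  qed
qed

end

context scrambled_quadrature
begin

lemma error_integrable: "integrable M (error n)"
proof -
  have "\<And>k. k \<in> S \<Longrightarrow> B < 1 - \<beta> k" using \<beta>B by fastforce
  from expected_error_le[OF this] obtain C where C: "\<And>n K. 0 \<le> K \<Longrightarrow>
    (\<And>v y. v \<subseteq> S \<Longrightarrow> (\<integral>\<^sup>+\<omega>. ennreal \<bar>kernel_error n v y \<omega>\<bar> \<partial>M) \<le> ennreal (K * (\<Prod>k\<in>v. tail (y k) powr 1))) \<Longrightarrow>
    (\<integral>\<^sup>+\<omega>. ennreal (error n \<omega>) \<partial>M) \<le> ennreal (C * K)" by blast
  have "(\<integral>\<^sup>+\<omega>. ennreal (error n \<omega>) \<partial>M) \<le> ennreal (C * (real b ^ card S + 1))"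
  proof (rule C)
    fix v y assume v: "v \<subseteq> S"
    have "(\<integral>\<^sup>+\<omega>. ennreal \<bar>kernel_error n v y \<omega>\<bar> \<partial>M) = ennreal (\<integral>\<omega>. \<bar>kernel_error n v y \<omega>\<bar> \<partial>M)"
      by (rule nn_integral_eq_integral[OF integrable_abs[OF expected_kernel_error_tail(1)[OF v]]]) simp
    then show "(\<integral>\<^sup>+\<omega>. ennreal \<bar>kernel_error n v y \<omega>\<bar> \<partial>M)
      \<le> ennreal ((real b ^ card S + 1) * (\<Prod>k\<in>v. tail (y k) powr 1))"
      using expected_kernel_error_tail(2)[OF v, of n y] by (simp add: ennreal_leI)
  qed simp
  then show ?thesis
    using error_measurable[of n]
    by (intro integrableI_bounded) (auto simp: error_def intro: order_le_less_trans)
qed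

text \<open>The two bounds hold for every \<open>y\<close>, so the power \<theta> of one and the
  power 1 - \<theta> of the other multiply to a bound with both weight and rate.\<close>

lemma expected_error_rate:
  fixes \<theta> \<epsilon> :: real
  assumes \<theta>: "0 < \<theta>" "\<theta> < 1" "\<And>k. k \<in> S \<Longrightarrow> B < \<theta> - \<beta> k" and \<epsilon>: "0 < \<epsilon>"
  shows "\<exists>C. \<forall>n\<ge>1. (\<integral>\<omega>. error n \<omega> \<partial>M) \<le> C * real n powr ((\<epsilon> - 1) * (1 - \<theta>))"
proof -
  from expected_error_le[OF \<theta>(3)] obtain C where C: "0 \<le> C" "\<And>n K. 0 \<le> K \<Longrightarrow>
    (\<And>v y. v \<subseteq> S \<Longrightarrow> (\<integral>\<^sup>+\<omega>. ennreal \<bar>kernel_error n v y \<omega>\<bar> \<partial>M) \<le> ennreal (K * (\<Prod>k\<in>v. tail (y k) powr \<theta>))) \<Longrightarrow>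
    (\<integral>\<^sup>+\<omega>. ennreal (error n \<omega>) \<partial>M) \<le> ennreal (C * K)" by blast
  obtain C' where C': "0 \<le> C'" "\<And>v n y. v \<subseteq> S \<Longrightarrow> 1 \<le> n \<Longrightarrow>
    (\<integral>\<omega>. \<bar>kernel_error n v y \<omega>\<bar> \<partial>M) \<le> C' * real n powr (\<epsilon> - 1)"
    using expected_kernel_error_discrepancy[OF \<epsilon>] by blast
  define K1 where "K1 = real b ^ card S + 1"
  have K1: "0 \<le> K1" by (simp add: K1_def)
  have "(\<integral>\<omega>. error n \<omega> \<partial>M) \<le> (C * (K1 powr \<theta> * C' powr (1 - \<theta>))) * real n powr ((\<epsilon> - 1) * (1 - \<theta>))"
    if n: "1 \<le> n" for n
  proof -
    define K where "K = K1 powr \<theta> * C' powr (1 - \<theta>) * real n powr ((\<epsilon> - 1) * (1 - \<theta>))"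
    have "(\<integral>\<^sup>+\<omega>. ennreal (error n \<omega>) \<partial>M) \<le> ennreal (C * K)"
    proof (rule C(2))
      fix v y assume v: "v \<subseteq> S"
      define T where "T = (\<Prod>k\<in>v. tail (y k))"
      define x where "x = (\<integral>\<omega>. \<bar>kernel_error n v y \<omega>\<bar> \<partial>M)"
      have fv: "finite v" using v S by (rule finite_subset)
      have T: "0 \<le> T" by (simp add: T_def prod_nonneg)
      have x0: "0 \<le> x" by (simp add: x_def)
      have x1: "x \<le> K1 * T" using expected_kernel_error_tail(2)[OF v, of n y] by (simp add: x_def K1_def T_def)
      have x2: "x \<le> C' * real n powr (\<epsilon> - 1)" unfolding x_def by (rule C'(2)[OF v n])
      have "x = x powr \<theta> * x powr (1 - \<theta>)" using x0 by (cases "x = 0") (simp_all add: powr_add[symmetric])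
      also have "\<dots> \<le> (K1 * T) powr \<theta> * (C' * real n powr (\<epsilon> - 1)) powr (1 - \<theta>)"
        using \<theta> x0 x1 x2 by (intro mult_mono powr_mono2) auto
      also have "\<dots> = K * T powr \<theta>"
        using K1 T C'(1) by (simp add: K_def powr_mult powr_powr ac_simps)
      also have "T powr \<theta> = (\<Prod>k\<in>v. tail (y k) powr \<theta>)"
        unfolding T_def using fv by (induction v rule: finite_induct) (simp_all add: powr_mult prod_nonneg)
      finally have x: "x \<le> K * (\<Prod>k\<in>v. tail (y k) powr \<theta>)" .
      have "(\<integral>\<^sup>+\<omega>. ennreal \<bar>kernel_error n v y \<omega>\<bar> \<partial>M) = ennreal x"
        unfolding x_def
        by (rule nn_integral_eq_integral[OF integrable_abs[OF expected_kernel_error_tail(1)[OF v]]]) simp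
      then show "(\<integral>\<^sup>+\<omega>. ennreal \<bar>kernel_error n v y \<omega>\<bar> \<partial>M) \<le> ennreal (K * (\<Prod>k\<in>v. tail (y k) powr \<theta>))"
        using x by (simp add: ennreal_leI)
    qed (simp add: K_def)
    moreover have "(\<integral>\<^sup>+\<omega>. ennreal (error n \<omega>) \<partial>M) = ennreal (\<integral>\<omega>. error n \<omega> \<partial>M)"
      by (rule nn_integral_eq_integral[OF error_integrable]) (simp add: error_def)
    moreover have "0 \<le> C * K" using C(1) by (simp add: K_def)
    ultimately have "(\<integral>\<omega>. error n \<omega> \<partial>M) \<le> C * K" by simp
    then show ?thesis by (simp add: K_def ac_simps)
  qed
  then show ?thesis by blast
qed

end

section \<open>The preintegrated function as an integrand\<close>

context preintegration
begin

lemma Pj_eq_preint: "Pj \<rho> j (\<lambda>x. g x * of_bool (0 \<le> \<phi> x)) = preint g"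
  by (intro ext) (simp add: Pj_def preint_def \<theta>_def)

lemma integrable_section_f:
  assumes x: "x \<in> rspace S"
  shows "integrable lborel (\<lambda>t. g (x(j := t)) * of_bool (0 \<le> \<phi> (x(j := t))) * \<rho> t)"
  using integrable_preint[OF x measurable_section[OF continuous_pd_g[of "[]"] x] pd_g_bound[of "[]" x]] x
  by (simp add: \<theta>_def)

lemma measurable_f: "(\<lambda>x. g x * of_bool (0 \<le> \<phi> x)) \<in> borel_measurable (joint_law \<rho> D)"
proof -
  have c: "(\<lambda>x. x k) \<in> borel_measurable (joint_law \<rho> D)" for k
  proof (cases "k \<in> D")
    case False
    have "(\<lambda>x. x k) \<in> borel_measurable (joint_law \<rho> D) \<longleftrightarrow>
        (\<lambda>x::nat \<Rightarrow> real. undefined :: real) \<in> borel_measurable (joint_law \<rho> D)"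
      using False by (intro measurable_cong) (auto simp: space_joint_law rspace_iff)
    then show ?thesis by simp
  qed (rule measurable_joint_component, auto)
  have "g \<in> borel_measurable (joint_law \<rho> D)" "\<phi> \<in> borel_measurable (joint_law \<rho> D)"
    using measurable_continuous_on_rspace[of D g "\<lambda>x. x" "joint_law \<rho> D"]
      measurable_continuous_on_rspace[of D \<phi> "\<lambda>x. x" "joint_law \<rho> D"] c continuous_pd_g[of "[]"] continuous_\<phi>
    by (auto simp: space_joint_law)
  then show ?thesis by measurable
qed

lemma integrable_f: "integrable (joint_law \<rho> D) (\<lambda>x. g x * of_bool (0 \<le> \<phi> x))"
proof (rule Bochner_Integration.integrable_bound[OF _ measurable_f])
  have "integrable (law \<rho>) (\<lambda>s. tail s powr (- Bs k))" if "k \<in> D" for k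
    using integrable_tail_powr_rho[of "- Bs k"] Bs[OF that] by (subst integrable_law) auto
  then show "integrable (joint_law \<rho> D) (\<lambda>x. L * (\<Prod>k\<in>D. tail (x k) powr (- Bs k)))"
    by (intro integrable_mult_right joint_prod(1) D) auto
  show "AE x in joint_law \<rho> D. norm (g x * of_bool (0 \<le> \<phi> x)) \<le> norm (L * (\<Prod>k\<in>D. tail (x k) powr (- Bs k)))"
  proof (rule AE_I2)
    fix x assume "x \<in> space (joint_law \<rho> D)"
    then have "\<bar>g x\<bar> \<le> L * (\<Prod>k\<in>D. tail (x k) powr (- Bs k))"
      using growth_pd[of "[]" x] by (simp add: space_joint_law)
    then have "norm (g x * of_bool (0 \<le> \<phi> x)) \<le> L * (\<Prod>k\<in>D. tail (x k) powr (- Bs k))"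
      using order_trans[OF abs_ge_zero] by (auto simp: abs_mult)
    also have "\<dots> \<le> norm (L * (\<Prod>k\<in>D. tail (x k) powr (- Bs k)))"
      by (simp only: real_norm_def abs_ge_self)
    finally show "norm (g x * of_bool (0 \<le> \<phi> x)) \<le> norm (L * (\<Prod>k\<in>D. tail (x k) powr (- Bs k)))" .
  qed
qed

lemma integral_f: "(\<integral>x. g x * of_bool (0 \<le> \<phi> x) \<partial>joint_law \<rho> D) = (\<integral>x. preint g x \<partial>joint_law \<rho> S)"
proof -
  have "(\<integral>x. g x * of_bool (0 \<le> \<phi> x) \<partial>joint_law \<rho> D)
    = (\<integral>x. (\<integral>t. g (x(j := t)) * of_bool (0 \<le> \<phi> (x(j := t))) \<partial>law \<rho>) \<partial>joint_law \<rho> S)"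
    using law_product.product_integral_insert[of S j "\<lambda>x. g x * of_bool (0 \<le> \<phi> x)"] D integrable_f
    by (simp add: insert_absorb[OF j] joint_law_def)
  also have "\<dots> = (\<integral>x. preint g x \<partial>joint_law \<rho> S)"
  proof (rule Bochner_Integration.integral_cong[OF refl])
    fix x assume "x \<in> space (joint_law \<rho> S)"
    then have x: "x \<in> rspace S" by (simp add: space_joint_law)
    have "(\<lambda>t. g (x(j := t)) * \<theta> x t) \<in> borel_measurable borel"
      using measurable_section[OF continuous_pd_g[of "[]"] x] measurable_\<theta>[OF x]
      by (intro borel_measurable_times) auto
    then show "(\<integral>t. g (x(j := t)) * of_bool (0 \<le> \<phi> (x(j := t))) \<partial>law \<rho>) = preint g x"
      using integral_law by (simp add: preint_def \<theta>_def)
  qed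
  finally show ?thesis .
qed

text \<open>Derivatives up to order \<open>R = card S\<close> are used; the power
  \<open>2 * R + 1\<close> of \<open>sgrowth\<close> becomes the factor of B_k in the growth
  exponents.\<close>

lemma smooth_integrand_preint:
  assumes R: "card S \<le> r" "real (2 * card S + 1) * Bs j < 1"
    and B: "0 < B" "\<And>k. k \<in> S \<Longrightarrow> real (2 * card S + 1) * Bs k + B < 1"
    and L': "0 < L'" "\<forall>u\<in>{0<..<1}. deriv (Phi_inv \<rho>) u \<le> L' * min u (1 - u) powr (- 1 - B)"
  shows "smooth_integrand \<rho> S (preint g) (\<lambda>k. real (2 * card S + 1) * Bs k) B"
proof
  show "finite S" using D by simp
  show "Cr_on S (card S) (preint g)" using Cr_on_pd_preint[OF R, of "[]"] by simp
  show "\<exists>C. \<forall>x\<in>rspace S. \<bar>pd w (preint g) x\<bar> \<le> C * (\<Prod>k\<in>S. tail (x k) powr - (real (2 * card S + 1) * Bs k))"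
    if "set w \<subseteq> S" "length w \<le> card S" for w
  proof -
    have "sgrowth x ^ (2 * card S + 1) = (\<Prod>k\<in>S. tail (x k) powr - (real (2 * card S + 1) * Bs k))" for x
      unfolding sgrowth_def prod_power_distrib by (intro prod.cong refl tail_powr_power)
    then show ?thesis using pd_preint_bound[OF R that] by simp
  qed
  show "0 \<le> real (2 * card S + 1) * Bs k" if "k \<in> S" for k using Bs[of k] that by simp
  show "real (2 * card S + 1) * Bs k + B < 1" if "k \<in> S" for k by (rule B(2)[OF that])
  show "integrable lborel (\<lambda>x. tail x powr a)" if "B < a" for a by (rule integrable_tail_powr[OF L' that])
qed

end

section \<open>Assembly from the conditions (A1), (A2) and (A3)\<close>

lemma preintegration_intro:
  fixes d r j :: nat
  assumes "prob_density \<rho>" "1 \<le> r" "j \<in> {1..d}" "Cr_on {1..d} r g" "Cr_on {1..d} r \<phi>"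
    and Bs: "\<forall>i\<in>{1..d}. 0 < Bs i \<and> Bs i < 1"
    and "condA1 d j \<phi>" "condA2 \<rho> d r j Bs g \<phi>" "condA3 \<rho> r B"
  shows "\<exists>L. preintegration \<rho> {1..d} j r g \<phi> Bs L"
proof -
  interpret positive_density \<rho>
    using assms by unfold_locales (auto simp: condA3_def Cr_real_def dest: spec[of _ 0])
  obtain L where L: "L > 0" and bounds: "\<And>y \<alpha>. y \<in> rspace {1..d} \<Longrightarrow> (\<Sum>i=1..d. \<alpha> i) \<le> r \<Longrightarrow>
      \<bar>multi_deriv d \<alpha> g y\<bar> \<le> L * growth_bound \<rho> d Bs y \<and> \<bar>multi_deriv d \<alpha> \<phi> y\<bar> \<le> L * growth_bound \<rho> d Bs y"
    and inv: "\<And>y b. y \<in> rspace {1..d} \<Longrightarrow> 1 \<le> b \<Longrightarrow> b \<le> 2 * r - 1 \<Longrightarrow>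
      \<bar>partial_deriv j \<phi> y\<bar> powi (- int b) \<le> L * growth_bound \<rho> d Bs y"
    using assms(8) unfolding condA2_def by blast
  have G: "growth_bound \<rho> d Bs y = (\<Prod>i\<in>{1..d}. tail (y i) powr (- Bs i))" for y
    by (simp add: growth_bound_def tail_def)
  have "preintegration \<rho> {1..d} j r g \<phi> Bs L"
  proof
    show "partial_deriv j \<phi> y \<noteq> 0" if "y \<in> rspace {1..d}" for y using assms(7) that by (simp add: condA1_def)
    show "\<bar>pd w g y\<bar> \<le> L * (\<Prod>i\<in>{1..d}. tail (y i) powr (- Bs i)) \<and>
        \<bar>pd w \<phi> y\<bar> \<le> L * (\<Prod>i\<in>{1..d}. tail (y i) powr (- Bs i))"
      if "set w \<subseteq> {1..d}" "length w \<le> r" "y \<in> rspace {1..d}" for w y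
      using bounds[OF that(3), of "count_list w"] that sum_count_list[OF _ that(1)]
        pd_eq_multi_deriv[OF assms(4) that] pd_eq_multi_deriv[OF assms(5) that] by (simp add: G)
    show "\<bar>1 / partial_deriv j \<phi> y ^ b\<bar> \<le> L * (\<Prod>i\<in>{1..d}. tail (y i) powr (- Bs i))"
      if "1 \<le> b" "b \<le> 2 * r - 1" "y \<in> rspace {1..d}" for b y
      using inv[OF that(3,1,2)] by (simp add: G power_int_minus divide_inverse power_abs)
    show "0 < Bs i \<and> Bs i < 1" if "i \<in> {1..d}" for i using Bs that by blast
    show "\<forall>a\<in>{0<..<1}. ((\<lambda>x. (deriv ^^ c) \<rho> x / (1 - Phi \<rho> x) powr a) \<longlongrightarrow> 0) at_top \<and>
        ((\<lambda>x. (deriv ^^ c) \<rho> x / (Phi \<rho> x) powr a) \<longlongrightarrow> 0) at_bot" if "c \<le> r - 1" for c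
      using assms(9) that unfolding condA3_def by blast
    show "Cr_real (r - 1) \<rho>" using assms(9) by (simp add: condA3_def)
  qed (use assms L in auto)
  then show ?thesis ..
qed

lemma scrambled_preintegration_rate:
  fixes d r j b t :: nat and M :: "'w measure"
  assumes dens: "prob_density \<rho>"
    and b: "2 \<le> b" and seq: "ts_sequence b t ({1..d} - {j}) p"
    and owen: "owen_permutations M b ({1..d} - {j}) \<pi>"
    and r: "1 \<le> r" and j: "j \<in> {1..d}"
    and smooth: "Cr_on {1..d} r g" "Cr_on {1..d} r \<phi>"
    and f: "f = (\<lambda>x. g x * of_bool (0 \<le> \<phi> x))"
    and Bs: "\<forall>i\<in>{1..d}. 0 < Bs i \<and> Bs i < 1" and B: "0 < B"
    and A: "condA1 d j \<phi>" "condA2 \<rho> d r j Bs g \<phi>" "condA3 \<rho> r B"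
    and rate: "d - 1 \<le> r" "Bs j < 1 / (2 * real d - 1)" "gamma_rate d j Bs B < 1"
  shows "integrable (joint_law \<rho> {1..d}) f"
    and "integrable M (quad_error \<rho> d j b \<pi> p f n)"
    and "0 < \<epsilon> \<Longrightarrow> (\<lambda>n. \<integral>\<omega>. quad_error \<rho> d j b \<pi> p f n \<omega> \<partial>M)
      \<in> O(\<lambda>n. real n powr (- 1 + gamma_rate d j Bs B + \<epsilon>))"
proof -
  define \<gamma> where "\<gamma> = gamma_rate d j Bs B"
  obtain L where "preintegration \<rho> {1..d} j r g \<phi> Bs L"
    using preintegration_intro[OF dens r j smooth Bs A] by blast
  then interpret P: preintegration \<rho> "{1..d}" j r g \<phi> Bs L .
  have card: "card ({1..d} - {j}) = d - 1" using j by simp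
  have d1: "1 \<le> d" using j by simp
  then have N: "real (2 * card ({1..d} - {j}) + 1) = 2 * real d - 1" unfolding card by (simp add: of_nat_diff)
  have Npos: "0 < 2 * real d - 1" using d1 by linarith
  obtain L' where L': "0 < L'" "\<forall>u\<in>{0<..<1}. deriv (Phi_inv \<rho>) u \<le> L' * min u (1 - u) powr (- 1 - B)"
    using A(3) unfolding condA3_def by blast
  have \<gamma>k: "(2 * real d - 1) * Bs k + B \<le> \<gamma>" if "k \<in> {1..d} - {j}" for k
  proof -
    have "Bs k \<le> Max (Bs ` ({1..d} - {j}))" using that by (intro Max_ge) auto
    then have "(2 * real d - 1) * Bs k \<le> (2 * real d - 1) * Max (Bs ` ({1..d} - {j}))"
      using Npos by (intro mult_left_mono) auto
    moreover have "{1..d} - {j} \<noteq> {}" using that by blast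
    ultimately show ?thesis unfolding \<gamma>_def gamma_rate_def by (simp only: if_False)
  qed
  have \<gamma>0: "0 < \<gamma>"
  proof (cases "{1..d} - {j} = {}")
    case True
    then have "\<gamma> = B" unfolding \<gamma>_def gamma_rate_def by simp
    then show ?thesis using B by simp
  next
    case False
    then obtain k where k: "k \<in> {1..d} - {j}" by blast
    have "0 < (2 * real d - 1) * Bs k" using Npos Bs k by (intro mult_pos_pos) auto
    then show ?thesis using \<gamma>k[OF k] B by linarith
  qed
  have SI: "smooth_integrand \<rho> ({1..d} - {j}) (P.preint g) (\<lambda>k. (2 * real d - 1) * Bs k) B"
    unfolding N[symmetric]
  proof (rule P.smooth_integrand_preint[OF _ _ B _ L'])
    show "card ({1..d} - {j}) \<le> r" unfolding card by (rule rate(1))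
    show "real (2 * card ({1..d} - {j}) + 1) * Bs j < 1"
      unfolding N using rate(2) Npos by (simp add: field_simps)
    show "real (2 * card ({1..d} - {j}) + 1) * Bs k + B < 1" if "k \<in> {1..d} - {j}" for k
      unfolding N using \<gamma>k[OF that] rate(3) by (simp add: \<gamma>_def)
  qed
  have "scrambled_quadrature \<rho> ({1..d} - {j}) (P.preint g) (\<lambda>k. (2 * real d - 1) * Bs k) B b M \<pi> t p"
    unfolding scrambled_quadrature_def scrambled_quadrature_axioms_def owen_scrambling_def
      owen_scrambling_axioms_def base_def using SI b seq owen by auto
  then interpret Q: scrambled_quadrature \<rho> "{1..d} - {j}" "P.preint g" "\<lambda>k. (2 * real d - 1) * Bs k" B b M \<pi> t p .
  have err: "quad_error \<rho> d j b \<pi> p f n = Q.error n" for n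
    by (intro ext) (simp only: quad_error_def Q.error_def f P.Pj_eq_preint Iexact_def P.integral_f)
  show "integrable (joint_law \<rho> {1..d}) f" unfolding f by (rule P.integrable_f)
  show "integrable M (quad_error \<rho> d j b \<pi> p f n)" unfolding err by (rule Q.error_integrable)
  assume \<epsilon>: "0 < \<epsilon>"
  \<comment> \<open>Strictly between \<gamma> and 1, so that the weighted integrals converge, and
    within \<epsilon>/2 of \<gamma>; the other \<epsilon>/2 is spent on the logarithms of the
    discrepancy.\<close>
  define \<theta> where "\<theta> = min (\<gamma> + \<epsilon> / 2) ((1 + \<gamma>) / 2)"
  have \<theta>: "\<gamma> < \<theta>" "\<theta> < 1" "\<theta> \<le> \<gamma> + \<epsilon> / 2"
    using \<epsilon> rate(3) by (auto simp: \<theta>_def \<gamma>_def min_def)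
  have "B < \<theta> - (2 * real d - 1) * Bs k" if "k \<in> {1..d} - {j}" for k
    using \<gamma>k[OF that] \<theta>(1) by linarith
  then obtain C where C: "\<And>n. 1 \<le> n \<Longrightarrow> (\<integral>\<omega>. Q.error n \<omega> \<partial>M) \<le> C * real n powr ((\<epsilon> / 2 - 1) * (1 - \<theta>))"
    using Q.expected_error_rate[of \<theta> "\<epsilon> / 2"] \<theta> \<gamma>0 \<epsilon> by auto
  show "(\<lambda>n. \<integral>\<omega>. quad_error \<rho> d j b \<pi> p f n \<omega> \<partial>M) \<in> O(\<lambda>n. real n powr (- 1 + gamma_rate d j Bs B + \<epsilon>))"
  proof (rule bigoI)
    show "\<forall>\<^sub>F n in at_top. norm (\<integral>\<omega>. quad_error \<rho> d j b \<pi> p f n \<omega> \<partial>M)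
        \<le> \<bar>C\<bar> * norm (real n powr (- 1 + gamma_rate d j Bs B + \<epsilon>))"
      using eventually_ge_at_top[of 1]
    proof eventually_elim
      case (elim n)
      have "\<epsilon> / 2 * (1 - \<theta>) \<le> \<epsilon> / 2 * 1" using \<epsilon> \<theta> \<gamma>0 by (intro mult_left_mono) auto
      then have "(\<epsilon> / 2 - 1) * (1 - \<theta>) \<le> - 1 + \<gamma> + \<epsilon>" using \<theta>(3) by (simp add: left_diff_distrib)
      then have "real n powr ((\<epsilon> / 2 - 1) * (1 - \<theta>)) \<le> real n powr (- 1 + \<gamma> + \<epsilon>)"
        using elim by (intro powr_mono) auto
      then have "\<bar>C\<bar> * real n powr ((\<epsilon> / 2 - 1) * (1 - \<theta>)) \<le> \<bar>C\<bar> * real n powr (- 1 + \<gamma> + \<epsilon>)"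
        by (intro mult_left_mono) auto
      moreover have "C * real n powr ((\<epsilon> / 2 - 1) * (1 - \<theta>)) \<le> \<bar>C\<bar> * real n powr ((\<epsilon> / 2 - 1) * (1 - \<theta>))"
        by (intro mult_right_mono) auto
      moreover have "0 \<le> (\<integral>\<omega>. Q.error n \<omega> \<partial>M)"
        by (intro Bochner_Integration.integral_nonneg) (simp only: Q.error_def abs_ge_zero)
      then have "norm (\<integral>\<omega>. Q.error n \<omega> \<partial>M) = (\<integral>\<omega>. Q.error n \<omega> \<partial>M)"
        by (simp only: real_norm_def abs_of_nonneg)
      ultimately have "norm (\<integral>\<omega>. Q.error n \<omega> \<partial>M) \<le> \<bar>C\<bar> * real n powr (- 1 + \<gamma> + \<epsilon>)"
        using C[OF elim] by linarith
      then show ?case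
        unfolding err \<gamma>_def[symmetric] real_norm_def abs_of_nonneg[OF powr_ge_zero] .
    qed
  qed
qed

theorem theorem4p8:
  fixes d r j b t :: nat
    and \<rho> :: "real \<Rightarrow> real"
    and g \<phi> f :: "(nat \<Rightarrow> real) \<Rightarrow> real"
    and Bs :: "nat \<Rightarrow> real" and B :: real
    and p :: "nat \<Rightarrow> nat \<Rightarrow> real"
    and M :: "'w measure"
    and \<pi> :: "nat \<Rightarrow> nat list \<Rightarrow> 'w \<Rightarrow> nat \<Rightarrow> nat"
  assumes "prob_density \<rho>"
    and "2 \<le> b" and "ts_sequence b t ({1..d} - {j}) p"
    and "owen_permutations M b ({1..d} - {j}) \<pi>"
    and "1 \<le> r" and "j \<in> {1..d}"
    and "Cr_on {1..d} r g" and "Cr_on {1..d} r \<phi>"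
    and "f = (\<lambda>x. g x * of_bool (0 \<le> \<phi> x))"
    and "\<forall>i\<in>{1..d}. 0 < Bs i \<and> Bs i < 1" and "0 < B"
    and "condA1 d j \<phi>" and "condA2 \<rho> d r j Bs g \<phi>" and "condA3 \<rho> r B"
  shows "(Bs j < 1 / (2 * real r + 1) \<longrightarrow>
           (\<forall>x\<in>rspace ({1..d} - {j}). integrable lborel (\<lambda>t. f (x(j := t)) * \<rho> t)) \<and>
           Cr_on ({1..d} - {j}) r (Pj \<rho> j f))
       \<and> (d - 1 \<le> r \<and> Bs j < 1 / (2 * real d - 1) \<and> gamma_rate d j Bs B < 1 \<longrightarrow>
           integrable (joint_law \<rho> {1..d}) f \<and>
           (\<forall>n. integrable M (quad_error \<rho> d j b \<pi> p f n)) \<and>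
           (\<forall>\<epsilon>>0. (\<lambda>n. \<integral>\<omega>. quad_error \<rho> d j b \<pi> p f n \<omega> \<partial>M)
              \<in> O(\<lambda>n. real n powr (- 1 + gamma_rate d j Bs B + \<epsilon>))))
       \<and> (d - 1 \<le> r \<and>
          (\<forall>\<delta>>0. \<exists>Bs' B'. (\<forall>i\<in>{1..d}. 0 < Bs' i \<and> Bs' i < \<delta>) \<and> 0 < B' \<and> B' < \<delta> \<and>
             condA2 \<rho> d r j Bs' g \<phi> \<and> condA3 \<rho> r B') \<longrightarrow>
           integrable (joint_law \<rho> {1..d}) f \<and>
           (\<forall>n. integrable M (quad_error \<rho> d j b \<pi> p f n)) \<and>
           (\<forall>\<epsilon>>0. (\<lambda>n. \<integral>\<omega>. quad_error \<rho> d j b \<pi> p f n \<omega> \<partial>M)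
              \<in> O(\<lambda>n. real n powr (- 1 + \<epsilon>))))"
proof (intro conjI impI; (elim conjE)?)
  obtain L where "preintegration \<rho> {1..d} j r g \<phi> Bs L"
    using preintegration_intro[OF assms(1,5-8,10,12-14)] by blast
  then interpret P: preintegration \<rho> "{1..d}" j r g \<phi> Bs L .
  show "\<forall>x\<in>rspace ({1..d} - {j}). integrable lborel (\<lambda>t. f (x(j := t)) * \<rho> t)"
    unfolding assms(9) by (intro ballI P.integrable_section_f)
  assume "Bs j < 1 / (2 * real r + 1)"
  then have "real (2 * r + 1) * Bs j < 1" by (simp add: field_simps)
  from P.Cr_on_pd_preint[OF order_refl this, of "[]" r]
  show "Cr_on ({1..d} - {j}) r (Pj \<rho> j f)" unfolding assms(9) P.Pj_eq_preint by simp
next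
  assume "d - 1 \<le> r" "Bs j < 1 / (2 * real d - 1)" "gamma_rate d j Bs B < 1"
  note * = scrambled_preintegration_rate[OF assms this]
  show "integrable (joint_law \<rho> {1..d}) f" by (rule *(1))
  show "\<forall>n. integrable M (quad_error \<rho> d j b \<pi> p f n)" by (intro allI *(2))
  show "\<forall>\<epsilon>>0. (\<lambda>n. \<integral>\<omega>. quad_error \<rho> d j b \<pi> p f n \<omega> \<partial>M)
      \<in> O(\<lambda>n. real n powr (- 1 + gamma_rate d j Bs B + \<epsilon>))" by (intro allI impI *(3))
next
  assume r: "d - 1 \<le> r" and small: "\<forall>\<delta>>0. \<exists>Bs' B'. (\<forall>i\<in>{1..d}. 0 < Bs' i \<and> Bs' i < \<delta>) \<and> 0 < B' \<and> B' < \<delta> \<and>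
             condA2 \<rho> d r j Bs' g \<phi> \<and> condA3 \<rho> r B'"
  have d1: "1 \<le> real d" using assms(6) by simp
  have key: "integrable (joint_law \<rho> {1..d}) f \<and> (\<forall>n. integrable M (quad_error \<rho> d j b \<pi> p f n)) \<and>
      (\<lambda>n. \<integral>\<omega>. quad_error \<rho> d j b \<pi> p f n \<omega> \<partial>M) \<in> O(\<lambda>n. real n powr (- 1 + \<epsilon>))"
    if \<epsilon>: "0 < \<epsilon>" for \<epsilon>
  proof -
    \<comment> \<open>The rate for the new constants is below (2d-1) \<delta> + \<delta> = 2d
      \<delta>, which is at most 1 and at most \<epsilon>/2. The remaining \<epsilon>/2 is the loss
      in the rate itself.\<close>
    define \<delta> where "\<delta> = min 1 (\<epsilon> / 2) / (2 * real d)"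
    have \<delta>: "0 < \<delta>" "2 * real d * \<delta> = min 1 (\<epsilon> / 2)" using \<epsilon> d1 by (auto simp: \<delta>_def)
    obtain Bs' B' where B': "\<forall>i\<in>{1..d}. 0 < Bs' i \<and> Bs' i < \<delta>" "0 < B'" "B' < \<delta>"
      "condA2 \<rho> d r j Bs' g \<phi>" "condA3 \<rho> r B'" using small \<delta>(1) by blast
    have lt1: "(2 * real d - 1) * \<delta> < 1" using \<delta> by (simp add: algebra_simps min_def split: if_splits)
    have "(2 * real d - 1) * Bs' j < 1"
    proof -
      have "Bs' j \<le> \<delta>" using B'(1) assms(6) by (blast intro: less_imp_le)
      then have "(2 * real d - 1) * Bs' j \<le> (2 * real d - 1) * \<delta>" using d1 by (intro mult_left_mono) auto
      then show ?thesis using lt1 by linarith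
    qed
    then have 1: "Bs' j < 1 / (2 * real d - 1)" using d1 by (simp add: field_simps)
    have g: "gamma_rate d j Bs' B' < 2 * real d * \<delta>"
    proof (cases "{1..d} - {j} = {}")
      case True
      have "\<delta> * 1 \<le> \<delta> * (2 * real d)" using \<delta>(1) d1 by (intro mult_left_mono) auto
      then have "B' < 2 * real d * \<delta>" using B'(3) by (simp add: ac_simps)
      moreover have "gamma_rate d j Bs' B' = B'" unfolding gamma_rate_def using True by simp
      ultimately show ?thesis by simp
    next
      case False
      have "Max (Bs' ` ({1..d} - {j})) \<in> Bs' ` ({1..d} - {j})" using False by (intro Max_in) auto
      then have "Max (Bs' ` ({1..d} - {j})) \<le> \<delta>" using B'(1) by (auto simp: less_imp_le)
      then have "(2 * real d - 1) * Max (Bs' ` ({1..d} - {j})) \<le> (2 * real d - 1) * \<delta>"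
        using d1 by (intro mult_left_mono) auto
      then have "(2 * real d - 1) * Max (Bs' ` ({1..d} - {j})) + B' < 2 * real d * \<delta>"
        using B'(3) by (simp add: left_diff_distrib)
      then show ?thesis unfolding gamma_rate_def using False by (simp only: if_False)
    qed
    have 2: "gamma_rate d j Bs' B' < 1" using g unfolding \<delta>(2) by linarith
    have 3: "gamma_rate d j Bs' B' \<le> \<epsilon> / 2" using g unfolding \<delta>(2) by linarith
    have "\<delta> \<le> 1 / (2 * real d)" using d1 by (simp add: \<delta>_def divide_right_mono)
    also have "\<dots> \<le> 1" using d1 by simp
    finally have "\<forall>i\<in>{1..d}. 0 < Bs' i \<and> Bs' i < 1" using B'(1) by (meson order_less_le_trans)
    note * = scrambled_preintegration_rate[OF assms(1-9) this B'(2) assms(12) B'(4,5) r 1 2]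
    have "(\<lambda>n. real n powr (- 1 + gamma_rate d j Bs' B' + \<epsilon> / 2)) \<in> O(\<lambda>n. real n powr (- 1 + \<epsilon>))"
    proof (rule bigoI)
      show "\<forall>\<^sub>F n in at_top. norm (real n powr (- 1 + gamma_rate d j Bs' B' + \<epsilon> / 2)) \<le> 1 * norm (real n powr (- 1 + \<epsilon>))"
        using eventually_ge_at_top[of 1]
        by eventually_elim (use 3 in \<open>auto intro: powr_mono\<close>)
    qed
    with *(3)[of "\<epsilon> / 2"] \<epsilon> *(1,2) show ?thesis by (auto intro: landau_o.big_trans)
  qed
  \<comment> \<open>These claims do not involve \<epsilon>, so any positive value will do.\<close>
  show "integrable (joint_law \<rho> {1..d}) f" "\<forall>n. integrable M (quad_error \<rho> d j b \<pi> p f n)"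
    using key[of 1] by auto
  show "\<forall>\<epsilon>>0. (\<lambda>n. \<integral>\<omega>. quad_error \<rho> d j b \<pi> p f n \<omega> \<partial>M) \<in> O(\<lambda>n. real n powr (- 1 + \<epsilon>))"
    using key by blast
qed

end
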